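(* Let $X_t$ be a real-valued Lévy process with Lévy triplet $(0,0,\nu)$, i.e. $X_t=\int_{|x|\le1}x\,\tilde N(t,dx)+\int_{|x|>1}x\,N(t,dx)$ where $N$ is a Poisson random measure with intensity $dt\,\nu(dx)$ and $\tilde N$ its compensation. Let $\bar\nu(A)=\nu(-A)$, $\rho=\nu\wedge\bar\nu$, and $\eta(r)=\int_{(0,r]}x^2\rho(dx)$ for $r>0$. If $\int_0^1\frac{r}{\eta(r)}\,dr<\infty$, then $X_t$ has the local coupling property.
   Context: $\nu$ is a Lévy measure on $\mathbb{R}$ ($\nu(\{0\})=0$, $\int\min(1,x^2)\nu(dx)<\infty$). For measures $\mu_1,\mu_2$, $\mu_1\wedge\mu_2$ denotes their minimum, the largest measure dominated by both: $(\mu_1\wedge\mu_2)(A)=\inf\{\mu_1(B)+\mu_2(A\setminus B): B\subseteq A \text{ Borel}\}$ (equal to $\frac12(\mu_1+\mu_2-|\mu_1-\mu_2|)$ when finite). The local coupling property: for every $x\in\mathbb{R}$ and $\epsilon>0$ there exists $\delta>0$ such that for every $y$ with $|y-x|<\delta$ there is a coupling $(X_t,Y_t)$ of the laws of the process started at $x$ and at $y$, such that $T=\inf\{t\ge0:X_t=Y_t\}$ satisfies $P(T>\epsilon)<\epsilon$. *)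

theory Defs
  imports "HOL-Probability.Probability"
begin

definition levy_measure :: "real measure \<Rightarrow> bool" where
  "levy_measure \<nu> \<longleftrightarrow> sets \<nu> = sets borel \<and> emeasure \<nu> {0} = 0 \<and>
     (\<integral>\<^sup>+ x. ennreal (min 1 (x\<^sup>2)) \<partial>\<nu>) < \<infinity>"

definition reflect_measure :: "real measure \<Rightarrow> real measure" where
  "reflect_measure \<nu> = distr \<nu> borel uminus"

text \<open>Minimum of two measures (largest measure dominated by both).\<close>
definition min_measure :: "real measure \<Rightarrow> real measure \<Rightarrow> real measure" where
  "min_measure \<mu>1 \<mu>2 = measure_of UNIV (sets borel)
     (\<lambda>A. \<Sqinter>B\<in>{B. B \<in> sets borel \<and> B \<subseteq> A}. emeasure \<mu>1 B + emeasure \<mu>2 (A - B))"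

definition levy_exponent :: "real measure \<Rightarrow> real \<Rightarrow> complex" where
  "levy_exponent \<nu> \<xi> = (\<integral>x. (iexp (\<xi> * x) - 1 - \<i> * complex_of_real (\<xi> * x) * indicator {-1..1} x) \<partial>\<nu>)"

definition cadlag :: "(real \<Rightarrow> real) \<Rightarrow> bool" where
  "cadlag f \<longleftrightarrow> (\<forall>t\<ge>0. continuous (at_right t) f) \<and> (\<forall>t>0. \<exists>l. (f \<longlongrightarrow> l) (at_left t))"

definition levy_process_from :: "real measure \<Rightarrow> real \<Rightarrow> 'w measure \<Rightarrow> (real \<Rightarrow> 'w \<Rightarrow> real) \<Rightarrow> bool" where
  "levy_process_from \<nu> x M X \<longleftrightarrow>
     prob_space M \<and>
     (\<forall>t\<ge>0. X t \<in> borel_measurable M) \<and>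
     (\<forall>\<omega>\<in>space M. cadlag (\<lambda>t. X t \<omega>)) \<and>
     (AE \<omega> in M. X 0 \<omega> = x) \<and>
     (\<forall>(n::nat) (t::nat \<Rightarrow> real). t 0 = 0 \<longrightarrow> (\<forall>i<n. t i < t (Suc i)) \<longrightarrow>
        prob_space.indep_vars M (\<lambda>_. borel) (\<lambda>i \<omega>. X (t (Suc i)) \<omega> - X (t i) \<omega>) {..<n} \<and>
        (\<forall>i<n. char (distr M borel (\<lambda>\<omega>. X (t (Suc i)) \<omega> - X (t i) \<omega>)) =
                 (\<lambda>\<xi>. exp (complex_of_real (t (Suc i) - t i) * levy_exponent \<nu> \<xi>))))"

text \<open>Coupling time of a pair of paths (infinite if they never meet).\<close>
definition coupling_time :: "(real \<Rightarrow> real) \<times> (real \<Rightarrow> real) \<Rightarrow> ereal" where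
  "coupling_time \<omega> = Inf {ereal t | t. t \<ge> 0 \<and> fst \<omega> t = snd \<omega> t}"

text \<open>Local coupling property. Couplings are realised canonically on pairs of paths;
  P(T > eps) < eps is read as an outer-probability bound.\<close>
definition local_coupling_property :: "real measure \<Rightarrow> bool" where
  "local_coupling_property \<nu> \<longleftrightarrow>
    (\<forall>x. \<forall>\<epsilon>>0. \<exists>\<delta>>0. \<forall>y. \<bar>y - x\<bar> < \<delta> \<longrightarrow>
       (\<exists>M :: ((real \<Rightarrow> real) \<times> (real \<Rightarrow> real)) measure.
          levy_process_from \<nu> x M (\<lambda>t \<omega>. fst \<omega> t) \<and>
          levy_process_from \<nu> y M (\<lambda>t \<omega>. snd \<omega> t) \<and>
          (\<exists>A\<in>sets M. {\<omega>\<in>space M. ereal \<epsilon> < coupling_time \<omega>} \<subseteq> A \<and> measure M A < \<epsilon>)))"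

end

(*
  Since T <= eps as soon as X_eps = Y_eps, it suffices to couple the processes started at x and y such that
  X_eps = Y_eps with high probability, and this only concerns the total variation distance of the laws of
  x + X_eps and y + X_eps. Up to a weak limit X_eps is compound Poisson, with jumps larger than c. Two walks at
  distance z are coupled by reflecting the jumps a of the symmetric part with 2|a| <= z: the distance becomes
  z - 2a. With w(z) the integral over (0,1/2] of min(z,2u)/eta(u), which is finite by the hypothesis and tends to
  0 with z, the expectation of w(distance) decreases by a constant per unit of time until the distance is tiny,
  so that for Lipschitz h with |h| <= 1 one gets |E h(z + X_t) - E h(X_t)| <= 2 z + 16 w(z) / t, uniformly in
  the Lipschitz constant; approximating indicators of closed sets turns this into a bound in total variation.

  A maximal coupling of the two laws at time eps is lifted to a coupling of the whole processes by sampling each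
  process from its conditional law given its value at time eps. The process is constructed on a countable product
  of clouds of points (time, jump), which is coded by one real number, so that the conditional laws are given by
  quantile functions. Its partial sums converge uniformly on bounded time intervals by a maximal inequality of
  Ottaviani type, and independence of increments is read off joint characteristic functions.
*)
theory Submission
  imports Defs
begin

text \<open>The function \<open>w\<close> comes from a differential equation. For
  \<open>0 < z < 1\<close> formally \<open>w''(z) = - 1 / (2 * \<eta> (z / 2))\<close>, while
  reflecting the jumps \<open>a\<close> with \<open>2 * \<bar>a\<bar> \<le> z\<close> acts on
  \<open>w\<close> like \<open>w''(z)\<close> times a multiple of the second moment of the reflected
  jumps, which is of the order of \<open>\<eta> (z / 2)\<close>. The product is a negative constant
  at every scale, and the hypothesis makes the solution that vanishes at \<open>0\<close> finite.

  The hypothesis also forces infinitely many small jumps, so a reflected pair of the full process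
  would be awkward to construct. It is never built: reflection appears only in an induction on the
  number of steps of a random walk, as an inequality between expectations of a test function. A walk
  without jumps below \<open>c\<close> cannot close a tiny distance, so below a distance
  \<open>r\<close> only the Lipschitz bound \<open>L * r\<close> is available. For fixed
  \<open>h\<close> first \<open>c\<close> tends to \<open>0\<close> with \<open>r\<close> fixed,
  then \<open>r\<close> tends to \<open>0\<close>, and \<open>L\<close> disappears.\<close>

section \<open>Independence from joint characteristic functions\<close>

text \<open>\<open>2 + G\<close> is a positive density, and tilting by it leaves the characteristic function of \<open>U\<close> unchanged.\<close>

lemma (in prob_space) indicator_expectation_of_char:
  fixes U :: "'a \<Rightarrow> real" and G :: "'a \<Rightarrow> real"
  assumes [measurable]: "U \<in> borel_measurable M" "G \<in> borel_measurable M" "A \<in> sets borel"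
    and bd: "\<And>x. \<bar>G x\<bar> \<le> 1"
    and eq: "\<And>\<theta>. (\<integral>x. iexp (\<theta> * U x) * of_real (G x) \<partial>M) = char (distr M borel U) \<theta> * of_real (\<integral>x. G x \<partial>M)"
  shows "(\<integral>x. indicator A (U x) * G x \<partial>M) = prob (U -` A \<inter> space M) * (\<integral>x. G x \<partial>M)"
proof -
  have intG: "integrable M G"
    by (rule integrable_const_bound[where B=1]) (use bd in auto)
  have intGe: "integrable M (\<lambda>x. iexp (\<theta> * U x) * of_real (G x))" for \<theta>
    by (rule integrable_const_bound[where B=1]) (use bd in \<open>auto simp: norm_mult\<close>)
  have inte: "integrable M (\<lambda>x. iexp (\<theta> * U x))" for \<theta>
    by (rule integrable_const_bound[where B=1]) auto
  define g where "g = (\<integral>x. G x \<partial>M)"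
  have "\<bar>g\<bar> \<le> (\<integral>x. \<bar>G x\<bar> \<partial>M)" unfolding g_def by (rule integral_abs_bound)
  also have "\<dots> \<le> (\<integral>x. 1 \<partial>M)"
    by (rule integral_mono) (use bd intG in auto)
  finally have g1: "\<bar>g\<bar> \<le> 1" by (simp add: prob_space)
  define h where "h x = (2 + G x) / (2 + g)" for x
  have hm[measurable]: "h \<in> borel_measurable M" unfolding h_def by measurable
  have h0: "h x \<ge> 0" for x using bd[of x] g1 unfolding h_def by auto
  have inth: "integrable M h" unfolding h_def using intG by auto
  have hint: "(\<integral>x. h x \<partial>M) = 1"
    unfolding h_def using intG g1 by (simp add: prob_space g_def[symmetric])
  define N where "N = density M (\<lambda>x. ennreal (h x))"
  have "emeasure N (space N) = (\<integral>\<^sup>+x. ennreal (h x) \<partial>M)"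
    unfolding N_def by (simp add: emeasure_density cong: nn_integral_cong)
  also have "\<dots> = ennreal (\<integral>x. h x \<partial>M)"
    by (rule nn_integral_eq_integral) (use inth h0 in auto)
  finally have "prob_space N" using hint by (intro prob_spaceI) simp
  then interpret N: prob_space N .
  have UN[measurable]: "U \<in> borel_measurable N" unfolding N_def by simp
  have sn: "space N = space M" unfolding N_def by simp
  interpret D1: real_distribution "distr M borel U" by (rule real_distribution_distr) simp
  interpret D2: real_distribution "distr N borel U" by (rule N.real_distribution_distr) simp
  have "char (distr N borel U) \<theta> = char (distr M borel U) \<theta>" for \<theta>
  proof -
    have "char (distr N borel U) \<theta> = (\<integral>x. iexp (\<theta> * U x) \<partial>N)"
      unfolding char_def complex_of_real_def[symmetric] by (subst integral_distr) simp_all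
    also have "\<dots> = (\<integral>x. h x *\<^sub>R iexp (\<theta> * U x) \<partial>M)"
      unfolding N_def by (rule integral_density) (use h0 in auto)
    also have "\<dots> = (\<integral>x. (2 * iexp (\<theta> * U x) + iexp (\<theta> * U x) * of_real (G x)) / of_real (2 + g) \<partial>M)"
      by (rule Bochner_Integration.integral_cong) (auto simp: h_def scaleR_conv_of_real field_simps)
    also have "\<dots> = (2 * (\<integral>x. iexp (\<theta> * U x) \<partial>M) + (\<integral>x. iexp (\<theta> * U x) * of_real (G x) \<partial>M)) / of_real (2 + g)"
      using inte[of \<theta>] intGe[of \<theta>] by simp
    also have "(\<integral>x. iexp (\<theta> * U x) \<partial>M) = char (distr M borel U) \<theta>"
      unfolding char_def by (subst integral_distr) simp_all
    also have "(2 * char (distr M borel U) \<theta> + (\<integral>x. iexp (\<theta> * U x) * of_real (G x) \<partial>M)) / of_real (2 + g)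
        = char (distr M borel U) \<theta> * (of_real (2 + g) / of_real (2 + g))"
      unfolding eq g_def[symmetric] by (simp add: field_simps)
    also have "of_real (2 + g) / of_real (2 + g) = (1::complex)"
    proof (rule divide_self)
      have "2 + g \<noteq> 0" using g1 by linarith
      then show "complex_of_real (2 + g) \<noteq> 0" by (simp only: of_real_eq_0_iff not_False_eq_True)
    qed
    finally show ?thesis by simp
  qed
  then have "distr N borel U = distr M borel U"
    by (intro Levy_uniqueness D1.real_distribution_axioms D2.real_distribution_axioms) auto
  then have "measure (distr N borel U) A = measure (distr M borel U) A" by simp
  then have *: "measure N (U -` A \<inter> space M) = prob (U -` A \<inter> space M)"
    by (simp add: measure_distr sn)
  have "measure N (U -` A \<inter> space M) = (\<integral>x. indicator (U -` A \<inter> space M) x \<partial>N)"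
    by (simp add: sn[symmetric])
  also have "\<dots> = (\<integral>x. h x *\<^sub>R indicator (U -` A \<inter> space M) x \<partial>M)"
    unfolding N_def by (rule integral_density) (use h0 in auto)
  also have "\<dots> = (\<integral>x. (2 * indicator (U -` A \<inter> space M) x + indicator A (U x) * G x) / (2 + g) \<partial>M)"
    by (rule Bochner_Integration.integral_cong) (auto simp: h_def indicator_def)
  also have "\<dots> = (2 * prob (U -` A \<inter> space M) + (\<integral>x. indicator A (U x) * G x \<partial>M)) / (2 + g)"
  proof -
    have "integrable M (\<lambda>x. indicator A (U x) * G x)"
      by (rule integrable_const_bound[where B=1]) (use bd in \<open>auto simp: indicator_def\<close>)
    moreover have "integrable M (\<lambda>x. indicator (U -` A \<inter> space M) x :: real)"
      by (rule integrable_const_bound[where B=1]) (auto simp: indicator_def)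
    ultimately show ?thesis by simp
  qed
  finally have "(2 * prob (U -` A \<inter> space M) + (\<integral>x. indicator A (U x) * G x \<partial>M)) = prob (U -` A \<inter> space M) * (2 + g)"
    using * g1 by (simp add: field_simps split: if_splits)
  then show ?thesis by (simp add: g_def algebra_simps)
qed

text \<open>\<open>Re G\<close> and \<open>Im G\<close> are combinations of \<open>G\<close> and its
  conjugate, so a factorization known for both of these passes to two real weights, to which the
  real case applies.\<close>

lemma (in prob_space) indicator_expectation_of_char_complex:
  fixes U :: "'a \<Rightarrow> real" and G :: "'a \<Rightarrow> complex"
  assumes [measurable]: "U \<in> borel_measurable M" "G \<in> borel_measurable M" "A \<in> sets borel"
    and bd: "\<And>x. cmod (G x) \<le> 1"
    and eq: "\<And>\<theta>. (\<integral>x. iexp (\<theta> * U x) * G x \<partial>M) = char (distr M borel U) \<theta> * (\<integral>x. G x \<partial>M)"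
    and eq': "\<And>\<theta>. (\<integral>x. iexp (\<theta> * U x) * cnj (G x) \<partial>M) = char (distr M borel U) \<theta> * (\<integral>x. cnj (G x) \<partial>M)"
  shows "(\<integral>x. indicator A (U x) * G x \<partial>M) = prob (U -` A \<inter> space M) * (\<integral>x. G x \<partial>M)"
proof -
  have intG: "integrable M G"
    by (rule integrable_const_bound[where B=1]) (use bd in auto)
  have [measurable]: "(\<lambda>x. cnj (G x)) \<in> borel_measurable M"
    by (rule measurable_compose[OF assms(2)]) (intro borel_measurable_continuous_onI continuous_intros)
  have intGe: "integrable M (\<lambda>x. iexp (\<theta> * U x) * (G x))" "integrable M (\<lambda>x. iexp (\<theta> * U x) * cnj (G x))" for \<theta>
    by (rule integrable_const_bound[where B=1]; use bd in \<open>auto simp: norm_mult\<close>)+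
  have cG: "integrable M (\<lambda>x. cnj (G x))" using intG by simp
  have b1: "\<bar>Re (G x)\<bar> \<le> 1" "\<bar>Im (G x)\<bar> \<le> 1" for x
    using abs_Re_le_cmod[of "G x"] abs_Im_le_cmod[of "G x"] bd[of x] by linarith+
  have R: "(\<integral>x. indicator A (U x) * Re (G x) \<partial>M) = prob (U -` A \<inter> space M) * (\<integral>x. Re (G x) \<partial>M)"
  proof (rule indicator_expectation_of_char)
    fix \<theta>
    have "(\<integral>x. iexp (\<theta> * U x) * of_real (Re (G x)) \<partial>M) = (\<integral>x. (iexp (\<theta> * U x) * G x + iexp (\<theta> * U x) * cnj (G x)) / 2 \<partial>M)"
      by (rule Bochner_Integration.integral_cong) (auto simp: complex_eq_iff)
    also have "\<dots> = char (distr M borel U) \<theta> * (((\<integral>x. G x \<partial>M) + (\<integral>x. cnj (G x) \<partial>M)) / 2)"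
      using intGe[of \<theta>] by (simp only: integral_divide_zero Bochner_Integration.integral_add eq eq') (simp only: distrib_left times_divide_eq_right)
    also have "((\<integral>x. G x \<partial>M) + (\<integral>x. cnj (G x) \<partial>M)) / 2 = of_real (\<integral>x. Re (G x) \<partial>M)"
      using intG by (simp add: complex_eq_iff)
    finally show "(\<integral>x. iexp (\<theta> * U x) * of_real (Re (G x)) \<partial>M) = char (distr M borel U) \<theta> * of_real (\<integral>x. Re (G x) \<partial>M)" .
  qed (use b1 in auto)
  have I: "(\<integral>x. indicator A (U x) * Im (G x) \<partial>M) = prob (U -` A \<inter> space M) * (\<integral>x. Im (G x) \<partial>M)"
  proof (rule indicator_expectation_of_char)
    fix \<theta>
    have "(\<integral>x. iexp (\<theta> * U x) * of_real (Im (G x)) \<partial>M) = (\<integral>x. (iexp (\<theta> * U x) * G x - iexp (\<theta> * U x) * cnj (G x)) / (2 * \<i>) \<partial>M)"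
      by (rule Bochner_Integration.integral_cong) (simp_all add: right_diff_distrib[symmetric] complex_diff_cnj complex_eq_iff)
    also have "\<dots> = char (distr M borel U) \<theta> * (((\<integral>x. G x \<partial>M) - (\<integral>x. cnj (G x) \<partial>M)) / (2 * \<i>))"
      using intGe[of \<theta>] by (simp only: integral_divide_zero Bochner_Integration.integral_diff eq eq') (simp only: right_diff_distrib times_divide_eq_right)
    also have "((\<integral>x. G x \<partial>M) - (\<integral>x. cnj (G x) \<partial>M)) / (2 * \<i>) = of_real (\<integral>x. Im (G x) \<partial>M)"
      using intG by (simp add: complex_eq_iff)
    finally show "(\<integral>x. iexp (\<theta> * U x) * of_real (Im (G x)) \<partial>M) = char (distr M borel U) \<theta> * of_real (\<integral>x. Im (G x) \<partial>M)" .
  qed (use b1 in auto)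
  have "integrable M (\<lambda>x. indicator A (U x) * G x)"
    by (rule integrable_const_bound[where B=1]) (use bd in \<open>auto simp: indicator_def\<close>)
  moreover have "Re (indicator A (U x) * G x) = indicator A (U x) * Re (G x)"
    "Im (indicator A (U x) * G x) = indicator A (U x) * Im (G x)" for x by (auto simp: indicator_def)
  ultimately show ?thesis using R I intG
    by (simp add: complex_eq_iff flip: integral_Re integral_Im)
qed

text \<open>Exponentials are exchanged for indicators one coordinate at a time. At stage
  \<open>k\<close> the weight is the product of the indicators already present and of the
  exponentials still to come; it is bounded by \<open>1\<close>, and the induction hypothesis gives
  its factorization against \<open>iexp (s * Z k \<omega>)\<close> for every
  \<open>s\<close>.\<close>

lemma (in prob_space) joint_char_product:
  fixes Z :: "nat \<Rightarrow> 'a \<Rightarrow> real"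
  assumes Z[measurable]: "\<And>i. i < n \<Longrightarrow> Z i \<in> borel_measurable M"
    and joint: "\<And>\<theta>. (\<integral>\<omega>. iexp (\<Sum>i<n. \<theta> i * Z i \<omega>) \<partial>M) = (\<Prod>i<n. char (distr M borel (Z i)) (\<theta> i))"
    and A: "\<And>i. A i \<in> sets borel"
  shows "k \<le> n \<Longrightarrow> (\<integral>\<omega>. (\<Prod>i<k. indicator (A i) (Z i \<omega>)) * iexp (\<Sum>i=k..<n. \<theta> i * Z i \<omega>) \<partial>M)
     = (\<Prod>i<k. of_real (prob (Z i -` A i \<inter> space M))) * (\<Prod>i=k..<n. char (distr M borel (Z i)) (\<theta> i))"
proof (induction k arbitrary: \<theta>)
  case 0
  then show ?case using joint[of \<theta>] by (simp add: lessThan_atLeast0)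
next
  case (Suc k)
  note [measurable] = A
  have kn: "k < n" using Suc by simp
  define G where "G \<theta> \<omega> = (\<Prod>i<k. indicator (A i) (Z i \<omega>)) * iexp (\<Sum>i=Suc k..<n. \<theta> i * Z i \<omega>)" for \<theta> \<omega>
  have m1: "(\<lambda>\<omega>. (\<Prod>i<k. indicator (A i) (Z i \<omega>)) :: complex) \<in> borel_measurable M"
    by (rule borel_measurable_prod) (use kn in \<open>auto intro!: measurable_compose[OF Z]\<close>)
  have m2: "(\<lambda>\<omega>. (\<Sum>i=Suc k..<n. \<theta> i * Z i \<omega>)) \<in> borel_measurable M" for \<theta>
    by (rule borel_measurable_sum) (use kn in auto)
  have Gm[measurable]: "G \<theta> \<in> borel_measurable M" for \<theta>
    unfolding G_def using m1 m2[of \<theta>] by measurable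
  \<comment> \<open>The induction hypothesis is available for all frequencies, so the one at
    \<open>k\<close> can be moved to \<open>s\<close> while the others stay.\<close>
  have step: "(\<integral>\<omega>. iexp (s * Z k \<omega>) * G \<theta> \<omega> \<partial>M) =
     char (distr M borel (Z k)) s * ((\<Prod>i<k. of_real (prob (Z i -` A i \<inter> space M))) * (\<Prod>i=Suc k..<n. char (distr M borel (Z i)) (\<theta> i)))" for s \<theta>
  proof -
    have "(\<integral>\<omega>. iexp (s * Z k \<omega>) * G \<theta> \<omega> \<partial>M) = (\<integral>\<omega>. (\<Prod>i<k. indicator (A i) (Z i \<omega>)) * iexp (\<Sum>i=k..<n. (\<theta>(k:=s)) i * Z i \<omega>) \<partial>M)"
      unfolding G_def using kn
      by (intro Bochner_Integration.integral_cong) (auto simp: sum.atLeast_Suc_lessThan exp_add algebra_simps)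
    also have "\<dots> = (\<Prod>i<k. of_real (prob (Z i -` A i \<inter> space M))) * (\<Prod>i=k..<n. char (distr M borel (Z i)) ((\<theta>(k:=s)) i))"
      by (rule Suc.IH) (use Suc in auto)
    also have "\<dots> = char (distr M borel (Z k)) s * ((\<Prod>i<k. of_real (prob (Z i -` A i \<inter> space M))) * (\<Prod>i=Suc k..<n. char (distr M borel (Z i)) (\<theta> i)))"
      using kn by (auto simp: prod.atLeast_Suc_lessThan)
    finally show ?thesis .
  qed
  interpret Dk: prob_space "distr M borel (Z k)" by (rule prob_space_distr) (use kn in auto)
  have D0: "char (distr M borel (Z k)) 0 = 1"
    using Dk.prob_space by (simp add: char_def)
  have G0: "(\<integral>\<omega>. G \<theta> \<omega> \<partial>M) = (\<Prod>i<k. of_real (prob (Z i -` A i \<inter> space M))) * (\<Prod>i=Suc k..<n. char (distr M borel (Z i)) (\<theta> i))" for \<theta>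
    using step[of 0 \<theta>] by (simp add: D0)
  \<comment> \<open>Conjugation fixes the indicators and negates the remaining frequencies, so the
    conjugate weight is of the same kind and the complex version applies.\<close>
  have cG: "cnj (G \<theta> \<omega>) = G (\<lambda>i. - \<theta> i) \<omega>" for \<theta> \<omega>
  proof -
    have "cnj (\<Prod>i<k. indicator (A i) (Z i \<omega>)) = (\<Prod>i<k. indicator (A i) (Z i \<omega>))"
      by (auto simp: indicator_def intro!: prod.cong)
    then show ?thesis unfolding G_def by (simp add: sum_negf exp_cnj)
  qed
  have pl: "cmod (\<Prod>i<k. indicator (A i) (Z i \<omega>)) \<le> 1" for \<omega>
    by (subst prod_norm[symmetric], rule prod_le_1) (auto simp: indicator_def)
  have "(\<integral>\<omega>. indicator (A k) (Z k \<omega>) * G \<theta> \<omega> \<partial>M) = prob (Z k -` A k \<inter> space M) * (\<integral>\<omega>. G \<theta> \<omega> \<partial>M)"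
  proof (rule indicator_expectation_of_char_complex)
    show "cmod (G \<theta> x) \<le> 1" for x unfolding G_def using pl by (simp add: norm_mult)
  next
    fix s
    show "(\<integral>x. iexp (s * Z k x) * G \<theta> x \<partial>M) = char (distr M borel (Z k)) s * (\<integral>x. G \<theta> x \<partial>M)"
      unfolding step G0 ..
    show "(\<integral>x. iexp (s * Z k x) * cnj (G \<theta> x) \<partial>M) = char (distr M borel (Z k)) s * (\<integral>x. cnj (G \<theta> x) \<partial>M)"
      unfolding cG step G0 ..
  qed (use kn in auto)
  also have "(\<lambda>\<omega>. indicator (A k) (Z k \<omega>) * G \<theta> \<omega>) = (\<lambda>\<omega>. (\<Prod>i<Suc k. indicator (A i) (Z i \<omega>)) * iexp (\<Sum>i=Suc k..<n. \<theta> i * Z i \<omega>))"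
    unfolding G_def by (auto simp: fun_eq_iff)
  finally show ?case by (simp add: G0)
qed

text \<open>Putting all frequencies but one to \<open>0\<close> identifies \<open>\<phi> i\<close>
  as the characteristic function of \<open>Z i\<close>. The joint formula then feeds
  \<open>joint_char_product\<close>, whose last stage contains indicators only and is the product
  rule for probabilities.\<close>

lemma (in prob_space) indep_vars_of_joint_char:
  fixes Z :: "nat \<Rightarrow> 'a \<Rightarrow> real" and \<phi> :: "nat \<Rightarrow> real \<Rightarrow> complex"
  assumes Z[measurable]: "\<And>i. i < n \<Longrightarrow> Z i \<in> borel_measurable M"
    and joint: "\<And>\<theta>. (\<integral>\<omega>. iexp (\<Sum>i<n. \<theta> i * Z i \<omega>) \<partial>M) = (\<Prod>i<n. \<phi> i (\<theta> i))"
    and \<phi>0: "\<And>i. \<phi> i 0 = 1"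
  shows "indep_vars (\<lambda>_. borel) Z {..<n}" "i < n \<Longrightarrow> char (distr M borel (Z i)) = \<phi> i"
proof -
  have char: "char (distr M borel (Z i)) = \<phi> i" if "i < n" for i
  proof
    fix s
    have "char (distr M borel (Z i)) s = (\<integral>\<omega>. iexp (s * Z i \<omega>) \<partial>M)"
      unfolding char_def using that by (subst integral_distr) simp_all
    also have "\<dots> = (\<integral>\<omega>. iexp (\<Sum>j<n. (if j = i then s else 0) * Z j \<omega>) \<partial>M)"
      using that by (simp add: if_distrib[of "\<lambda>x. x * _"] sum.delta cong: if_cong)
    also have "\<dots> = (\<Prod>j<n. \<phi> j (if j = i then s else 0))" by (rule joint)
    also have "\<dots> = (\<Prod>j<n. if j = i then \<phi> i s else 1)" by (intro prod.cong) (auto simp: \<phi>0)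
    also have "\<dots> = \<phi> i s" using that by (simp add: prod.delta)
    finally show "char (distr M borel (Z i)) s = \<phi> i s" .
  qed
  show "i < n \<Longrightarrow> char (distr M borel (Z i)) = \<phi> i" by (rule char)
  have joint': "(\<integral>\<omega>. iexp (\<Sum>i<n. \<theta> i * Z i \<omega>) \<partial>M) = (\<Prod>i<n. char (distr M borel (Z i)) (\<theta> i))" for \<theta>
    unfolding joint by (rule prod.cong) (auto simp: char)
  show "indep_vars (\<lambda>_. borel) Z {..<n}"
  proof (cases "n = 0")
    case True
    then show ?thesis by (simp add: indep_vars_def indep_sets_def)
  next
    case False
    have "prob (\<Inter>j\<in>{..<n}. Z j -` A j \<inter> space M) = (\<Prod>j\<in>{..<n}. prob (Z j -` A j \<inter> space M))"
      if A: "A \<in> {..<n} \<rightarrow> sets borel" for A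
    proof -
      \<comment> \<open>\<open>joint_char_product\<close> wants a Borel set for every index; beyond
        \<open>n\<close> the whole line is harmless.\<close>
      define B where "B i = (if i < n then A i else UNIV)" for i
      have B: "B i \<in> sets borel" for i using A unfolding B_def by auto
      have ev: "(\<Inter>j\<in>{..<n}. Z j -` A j \<inter> space M) \<in> events"
        using A False by (intro sets.finite_INT) (auto intro!: measurable_sets[OF Z])
      have "(\<integral>\<omega>. (\<Prod>i<n. indicator (B i) (Z i \<omega>)) * iexp (\<Sum>i=n..<n. 0 * Z i \<omega>) \<partial>M)
         = (\<Prod>i<n. of_real (prob (Z i -` B i \<inter> space M)))"
        using joint_char_product[OF Z joint' B, where k=n and \<theta>="\<lambda>_. 0"] by simp
      also have "(\<integral>\<omega>. (\<Prod>i<n. indicator (B i) (Z i \<omega>)) * iexp (\<Sum>i=n..<n. 0 * Z i \<omega>) \<partial>M)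
         = (\<integral>\<omega>. of_real (indicator (\<Inter>j\<in>{..<n}. Z j -` A j \<inter> space M) \<omega>) \<partial>M)"
      proof (rule Bochner_Integration.integral_cong)
        fix \<omega> assume "\<omega> \<in> space M"
        have "(\<Prod>i<n. indicator (B i) (Z i \<omega>)) = (of_bool (\<forall>i<n. Z i \<omega> \<in> A i) :: complex)"
          by (auto simp: B_def indicator_def of_bool_def)
        then show "(\<Prod>i<n. indicator (B i) (Z i \<omega>)) * iexp (\<Sum>i=n..<n. 0 * Z i \<omega>) = of_real (indicator (\<Inter>j\<in>{..<n}. Z j -` A j \<inter> space M) \<omega>)"
          using \<open>\<omega> \<in> space M\<close> by (auto simp: indicator_def)
      qed simp
      also have "\<dots> = of_real (prob (\<Inter>j\<in>{..<n}. Z j -` A j \<inter> space M))"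
        using ev by simp
      also have "(\<Prod>i<n. of_real (prob (Z i -` B i \<inter> space M))) = (of_real (\<Prod>i<n. prob (Z i -` A i \<inter> space M)) :: complex)"
        unfolding of_real_prod by (rule prod.cong) (auto simp: B_def)
      finally show ?thesis by (simp only: of_real_eq_iff)
    qed
    then show ?thesis
      using False Z
      by (subst indep_vars_finite[where E="\<lambda>_. sets borel"])
         (auto simp: sets.sigma_sets_eq[of borel, simplified] Int_stable_def)
  qed
qed

section \<open>Poisson clouds\<close>

lemma integral_PiM_prod:
  fixes f :: "nat \<Rightarrow> 'a \<Rightarrow> complex"
  assumes "\<And>i. prob_space (M i)" and f: "\<And>i. integrable (M i) (f i)"
  shows "(\<integral>\<omega>. (\<Prod>i<n. f i (\<omega> i)) \<partial>PiM UNIV M) = (\<Prod>i<n. \<integral>x. f i x \<partial>M i)"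
proof -
  interpret prob_space "M i" for i by fact
  interpret product_prob_space M UNIV ..
  have [measurable]: "f i \<in> borel_measurable (M i)" for i using f by auto
  have "(\<Prod>i<n. \<integral>x. f i x \<partial>M i) = (\<integral>\<omega>. (\<Prod>i<n. f i (\<omega> i)) \<partial>PiM {..<n} M)"
    by (rule product_integral_prod[symmetric]) (use f in auto)
  also have "\<dots> = (\<integral>\<omega>. (\<Prod>i<n. f i (\<omega> i)) \<partial>distr (PiM UNIV M) (PiM {..<n} M) (\<lambda>x. restrict x {..<n}))"
    by (subst distr_PiM_restrict_finite) auto
  also have "\<dots> = (\<integral>\<omega>. (\<Prod>i<n. f i (restrict \<omega> {..<n} i)) \<partial>PiM UNIV M)"
    by (rule integral_distr) (auto intro!: measurable_restrict_subset)
  also have "\<dots> = (\<integral>\<omega>. (\<Prod>i<n. f i (\<omega> i)) \<partial>PiM UNIV M)"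
    by (intro Bochner_Integration.integral_cong prod.cong) auto
  finally show ?thesis ..
qed

text \<open>\<open>poisson_pmf\<close> is meant for positive rates. Layers without mass have rate
  \<open>0\<close>, where the Poisson law degenerates to no points at all.\<close>

definition pois :: "real \<Rightarrow> nat pmf" where
  "pois \<Lambda> = (if \<Lambda> > 0 then poisson_pmf \<Lambda> else return_pmf 0)"

lemma integral_pois:
  fixes f :: "nat \<Rightarrow> 'b::{banach, second_countable_topology}"
  assumes "\<Lambda> \<ge> 0" "\<And>n. norm (f n) \<le> B"
  shows "(\<lambda>n. (\<Lambda> ^ n / fact n * exp (-\<Lambda>)) *\<^sub>R f n) sums (\<integral>n. f n \<partial>measure_pmf (pois \<Lambda>))"
proof -
  have int: "integrable (measure_pmf p) f" for p :: "nat pmf"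
    by (rule measure_pmf.integrable_const_bound[where B=B]) (use assms in auto)
  have pmf: "pmf (pois \<Lambda>) n = \<Lambda> ^ n / fact n * exp (-\<Lambda>)" for n
    using assms by (cases "\<Lambda> > 0") (auto simp: pois_def indicator_def)
  have "integrable (density (count_space UNIV) (pmf (pois \<Lambda>))) f"
    using int[of "pois \<Lambda>"] by (subst (asm) measure_pmf_eq_density)
  then have "integrable (count_space UNIV) (\<lambda>n. pmf (pois \<Lambda>) n *\<^sub>R f n)"
    by (subst (asm) integrable_density) auto
  from sums_integral_count_space_nat[OF this]
  show ?thesis unfolding pmf
    using assms by (subst measure_pmf_eq_density, subst integral_density) (auto simp: pmf)
qed

lemma pois_generating:
  fixes c :: complex
  assumes "\<Lambda> \<ge> 0" "cmod c \<le> 1"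
  shows "(\<integral>n. c ^ n \<partial>measure_pmf (pois \<Lambda>)) = exp (of_real \<Lambda> * (c - 1))"
proof -
  have "(\<lambda>n. (\<Lambda> ^ n / fact n * exp (-\<Lambda>)) *\<^sub>R c ^ n) sums (\<integral>n. c ^ n \<partial>measure_pmf (pois \<Lambda>))"
    by (rule integral_pois[where B=1]) (use assms in \<open>auto simp: norm_power power_le_one\<close>)
  moreover have "(\<lambda>n. of_real (exp (-\<Lambda>)) * ((of_real \<Lambda> * c) ^ n /\<^sub>R fact n)) sums (of_real (exp (-\<Lambda>)) * exp (of_real \<Lambda> * c))"
    by (intro sums_mult exp_converges)
  moreover have "(\<lambda>n. of_real (exp (-\<Lambda>)) * ((of_real \<Lambda> * c) ^ n /\<^sub>R fact n)) = (\<lambda>n. (\<Lambda> ^ n / fact n * exp (-\<Lambda>)) *\<^sub>R c ^ n)"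
    by (auto simp: fun_eq_iff scaleR_conv_of_real power_mult_distrib field_simps)
  ultimately have "(\<integral>n. c ^ n \<partial>measure_pmf (pois \<Lambda>)) = of_real (exp (-\<Lambda>)) * exp (of_real \<Lambda> * c)"
    by (metis sums_unique2)
  also have "\<dots> = exp (of_real \<Lambda> * (c - 1))"
    by (simp add: exp_of_real[symmetric] exp_add[symmetric] algebra_simps)
  finally show ?thesis .
qed

definition cloud :: "real \<Rightarrow> 'a measure \<Rightarrow> (nat \<times> (nat \<Rightarrow> 'a)) measure" where
  "cloud \<Lambda> q = measure_pmf (pois \<Lambda>) \<Otimes>\<^sub>M PiM UNIV (\<lambda>_. q)"

lemma prob_space_cloud: "prob_space q \<Longrightarrow> prob_space (cloud \<Lambda> q)"
  unfolding cloud_def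
  by (intro prob_space_pair prob_space_PiM measure_pmf.prob_space_axioms)

lemma measurable_cloud_fst[measurable]: "fst \<in> cloud \<Lambda> q \<rightarrow>\<^sub>M count_space UNIV"
  unfolding cloud_def by measurable

lemma measurable_cloud_snd[measurable]: "snd \<in> cloud \<Lambda> q \<rightarrow>\<^sub>M PiM UNIV (\<lambda>_. q)"
  unfolding cloud_def by measurable

lemma measurable_cloud_sum[measurable (raw)]:
  fixes g :: "'a \<Rightarrow> real"
  assumes [measurable]: "g \<in> borel_measurable q"
  shows "(\<lambda>\<omega>. \<Sum>i<fst \<omega>. g (snd \<omega> i)) \<in> borel_measurable (cloud \<Lambda> q)"
proof (rule measurable_compose_countable[OF _ measurable_cloud_fst])
  fix n :: nat
  have "(\<lambda>\<omega>. g (snd \<omega> i)) \<in> borel_measurable (cloud \<Lambda> q)" for i by measurable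
  then show "(\<lambda>\<omega>. \<Sum>i<n. g (snd \<omega> i)) \<in> borel_measurable (cloud \<Lambda> q)" by measurable
qed

text \<open>Given the count \<open>n\<close>, independence yields the \<open>n\<close>-th power of
  the characteristic function of one point; the generating function of the Poisson law sums these
  powers to an exponential.\<close>

lemma cloud_char:
  fixes g :: "'a \<Rightarrow> real"
  assumes "prob_space q" and [measurable]: "g \<in> borel_measurable q" and "\<Lambda> \<ge> 0"
  shows "(\<integral>\<omega>. iexp (\<Sum>i<fst \<omega>. g (snd \<omega> i)) \<partial>cloud \<Lambda> q) = exp (of_real \<Lambda> * ((\<integral>x. iexp (g x) \<partial>q) - 1))"
proof -
  interpret q: prob_space q by fact
  interpret Q: prob_space "PiM UNIV (\<lambda>_::nat. q)" by (intro prob_space_PiM q.prob_space_axioms)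
  interpret pair_prob_space "measure_pmf (pois \<Lambda>)" "PiM UNIV (\<lambda>_::nat. q)" ..
  interpret C: prob_space "cloud \<Lambda> q" by (rule prob_space_cloud) fact
  have ig: "integrable q (\<lambda>x. iexp (g x))"
    by (rule q.integrable_const_bound[where B=1]) auto
  have "integrable (cloud \<Lambda> q) (\<lambda>\<omega>. iexp (\<Sum>i<fst \<omega>. g (snd \<omega> i)))"
    by (rule C.integrable_const_bound[where B=1]) (auto simp del: of_real_sum)
  then have "(\<integral>\<omega>. iexp (\<Sum>i<fst \<omega>. g (snd \<omega> i)) \<partial>cloud \<Lambda> q)
     = (\<integral>n. (\<integral>\<xi>. iexp (\<Sum>i<n. g (\<xi> i)) \<partial>PiM UNIV (\<lambda>_::nat. q)) \<partial>measure_pmf (pois \<Lambda>))"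
    unfolding cloud_def by (subst integral_fst'[symmetric]) auto
  also have "\<dots> = (\<integral>n. (\<integral>x. iexp (g x) \<partial>q) ^ n \<partial>measure_pmf (pois \<Lambda>))"
  proof (rule Bochner_Integration.integral_cong)
    fix n
    have "(\<integral>\<xi>. iexp (\<Sum>i<n. g (\<xi> i)) \<partial>PiM UNIV (\<lambda>_::nat. q)) = (\<integral>\<xi>. (\<Prod>i<n. iexp (g (\<xi> i))) \<partial>PiM UNIV (\<lambda>_::nat. q))"
      by (simp add: exp_sum sum_distrib_left)
    also have "\<dots> = (\<Prod>i<n. \<integral>x. iexp (g x) \<partial>q)"
      by (rule integral_PiM_prod) (use ig in \<open>auto intro: q.prob_space_axioms\<close>)
    finally show "(\<integral>\<xi>. iexp (\<Sum>i<n. g (\<xi> i)) \<partial>PiM UNIV (\<lambda>_::nat. q)) = (\<integral>x. iexp (g x) \<partial>q) ^ n" by simp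
  qed simp
  also have "\<dots> = exp (of_real \<Lambda> * ((\<integral>x. iexp (g x) \<partial>q) - 1))"
  proof (rule pois_generating)
    have "cmod (\<integral>x. iexp (g x) \<partial>q) \<le> (\<integral>x. cmod (iexp (g x)) \<partial>q)" by (rule integral_norm_bound)
    then show "cmod (\<integral>x. iexp (g x) \<partial>q) \<le> 1" by (simp add: q.prob_space)
  qed fact
  finally show ?thesis .
qed

text \<open>The quotient \<open>2 * (1 - cos (s * Y)) / s^2\<close> tends to \<open>Y^2\<close> as
  \<open>s\<close> tends to \<open>0\<close>, and its expectation is read off the real part of the
  characteristic function. Fatou's lemma then bounds the second moment without any prior
  integrability of \<open>Y\<close>.\<close>

lemma (in prob_space) second_moment_of_char:
  fixes Y :: "'a \<Rightarrow> real"
  assumes [measurable]: "Y \<in> borel_measurable M"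
    and char: "\<And>\<theta>. (\<integral>\<omega>. iexp (\<theta> * Y \<omega>) \<partial>M) = exp (A \<theta>)"
    and A: "\<And>\<theta>. cmod (A \<theta>) \<le> \<theta>\<^sup>2 * V / 2"
  shows "(\<integral>\<^sup>+\<omega>. ennreal ((Y \<omega>)\<^sup>2) \<partial>M) \<le> ennreal V"
proof -
  have V0: "V \<ge> 0" using order_trans[OF norm_ge_zero A[of 1]] by simp
  define c where "c n = 1 / real (Suc n)" for n
  have c: "c \<longlonglongrightarrow> 0" unfolding c_def by (rule LIMSEQ_Suc[OF lim_1_over_n])
  have c0: "c n > 0" for n by (simp add: c_def)
  define f where "f n \<omega> = ennreal (2 * (1 - cos (c n * Y \<omega>)) / (c n)\<^sup>2)" for n \<omega>
  have sin_over: "((\<lambda>h. sin h / h) \<longlongrightarrow> 1) (at (0::real))"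
    using DERIV_sin[of "0::real"] by (simp add: has_field_derivative_iff)
  have lim: "(\<lambda>n. f n \<omega>) \<longlonglongrightarrow> ennreal ((Y \<omega>)\<^sup>2)" for \<omega>
  proof -
    \<comment> \<open>By the half-angle formula the quotient equals
      \<open>(sin v / v)^2 * Y^2\<close> with \<open>v = s * Y / 2\<close>, so the limit of
      \<open>sin v / v\<close> at \<open>0\<close> suffices.\<close>
    have "((\<lambda>s. 2 * (1 - cos (s * Y \<omega>)) / s\<^sup>2) \<longlongrightarrow> (Y \<omega>)\<^sup>2) (at 0)"
    proof (cases "Y \<omega> = 0")
      case False
      have "((\<lambda>s. (sin (s * Y \<omega> / 2) / (s * Y \<omega> / 2))\<^sup>2 * (Y \<omega>)\<^sup>2) \<longlongrightarrow> 1\<^sup>2 * (Y \<omega>)\<^sup>2) (at 0)"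
        using False
        by (intro tendsto_intros filterlim_compose[OF sin_over]) (auto simp: filterlim_at eventually_at_filter intro!: tendsto_eq_intros)
      moreover have "\<forall>\<^sub>F s in at 0. (sin (s * Y \<omega> / 2) / (s * Y \<omega> / 2))\<^sup>2 * (Y \<omega>)\<^sup>2 = 2 * (1 - cos (s * Y \<omega>)) / s\<^sup>2"
      proof (rule eventually_at_filter[THEN iffD2], intro always_eventually allI impI)
        fix s :: real assume "s \<noteq> 0"
        have "cos (s * Y \<omega>) = 1 - 2 * (sin (s * Y \<omega> / 2))\<^sup>2"
          using cos_double_sin[of "s * Y \<omega> / 2"] by simp
        then show "(sin (s * Y \<omega> / 2) / (s * Y \<omega> / 2))\<^sup>2 * (Y \<omega>)\<^sup>2 = 2 * (1 - cos (s * Y \<omega>)) / s\<^sup>2"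
          using False \<open>s \<noteq> 0\<close> by (simp add: field_simps power2_eq_square)
      qed
      ultimately show ?thesis by (subst (asm) filterlim_cong[OF refl refl]) auto
    qed simp
    moreover have "filterlim c (at 0) sequentially"
      using c c0 by (auto simp: filterlim_at less_le)
    ultimately have "(\<lambda>n. 2 * (1 - cos (c n * Y \<omega>)) / (c n)\<^sup>2) \<longlonglongrightarrow> (Y \<omega>)\<^sup>2"
      by (rule filterlim_compose)
    then show ?thesis unfolding f_def by (rule tendsto_ennrealI)
  qed
  \<comment> \<open>The factor \<open>exp ((c n)\<^sup>2 * V / 2)\<close> is the price of estimating
    \<open>exp v - 1\<close> by \<open>\<bar>v\<bar> * exp \<bar>v\<bar>\<close>; it tends to
    \<open>1\<close>, so the limit keeps the constant \<open>V\<close>.\<close>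
  have bound: "(\<integral>\<^sup>+\<omega>. f n \<omega> \<partial>M) \<le> ennreal (V * exp ((c n)\<^sup>2 * V / 2))" for n
  proof -
    have int: "integrable M (\<lambda>\<omega>. iexp (c n * Y \<omega>))"
      by (rule integrable_const_bound[where B=1]) auto
    have intc: "integrable M (\<lambda>\<omega>. cos (c n * Y \<omega>))"
      by (rule integrable_const_bound[where B=1]) auto
    have Rec: "(\<integral>\<omega>. cos (c n * Y \<omega>) \<partial>M) = Re (exp (A (c n)))"
      unfolding char[symmetric] integral_Re[OF int, symmetric] by (simp add: Re_exp)
    have "(\<integral>\<^sup>+\<omega>. f n \<omega> \<partial>M) = ennreal (\<integral>\<omega>. 2 * (1 - cos (c n * Y \<omega>)) / (c n)\<^sup>2 \<partial>M)"
      unfolding f_def by (rule nn_integral_eq_integral) (use intc in auto)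
    also have "(\<integral>\<omega>. 2 * (1 - cos (c n * Y \<omega>)) / (c n)\<^sup>2 \<partial>M) = 2 * (1 - Re (exp (A (c n)))) / (c n)\<^sup>2"
      using intc by (simp add: prob_space Rec)
    also have "\<dots> \<le> 2 * ((c n)\<^sup>2 * V / 2 * exp ((c n)\<^sup>2 * V / 2)) / (c n)\<^sup>2"
    proof (intro divide_right_mono mult_left_mono)
      have "1 - Re (exp (A (c n))) \<le> cmod (exp (A (c n)) - 1)"
        using abs_Re_le_cmod[of "exp (A (c n)) - 1"] by simp
      also have "\<dots> \<le> cmod (A (c n)) * exp (cmod (A (c n)))"
        using Taylor_exp[of "A (c n)" 0] abs_Re_le_cmod[of "A (c n)"]
        by (simp add: mult.commute) (meson exp_le_cancel_iff mult_left_mono norm_ge_zero order_trans)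
      also have "\<dots> \<le> (c n)\<^sup>2 * V / 2 * exp ((c n)\<^sup>2 * V / 2)"
        by (intro mult_mono) (use A[of "c n"] V0 in auto)
      finally show "1 - Re (exp (A (c n))) \<le> (c n)\<^sup>2 * V / 2 * exp ((c n)\<^sup>2 * V / 2)" .
    qed auto
    also have "\<dots> = V * exp ((c n)\<^sup>2 * V / 2)" using c0[of n] by simp
    finally show ?thesis by (simp add: ennreal_leI)
  qed
  have "(\<integral>\<^sup>+\<omega>. ennreal ((Y \<omega>)\<^sup>2) \<partial>M) = (\<integral>\<^sup>+\<omega>. liminf (\<lambda>n. f n \<omega>) \<partial>M)"
    by (intro nn_integral_cong) (simp add: lim_imp_Liminf[OF _ lim])
  also have "\<dots> \<le> liminf (\<lambda>n. \<integral>\<^sup>+\<omega>. f n \<omega> \<partial>M)"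
    by (rule nn_integral_liminf) (simp add: f_def)
  also have "\<dots> \<le> liminf (\<lambda>n. ennreal (V * exp ((c n)\<^sup>2 * V / 2)))"
    by (rule Liminf_mono) (simp add: bound)
  also have "\<dots> = ennreal (V * exp (0\<^sup>2 * V / 2))"
    by (intro lim_imp_Liminf tendsto_ennrealI tendsto_intros c) simp_all
  finally show ?thesis by simp
qed

lemma (in prob_space) chebyshev_of_char:
  fixes Y :: "'a \<Rightarrow> real"
  assumes [measurable]: "Y \<in> borel_measurable M"
    and char: "\<And>\<theta>. (\<integral>\<omega>. iexp (\<theta> * Y \<omega>) \<partial>M) = exp (A \<theta>)"
    and A: "\<And>\<theta>. cmod (A \<theta>) \<le> \<theta>\<^sup>2 * V / 2" and "a > 0"
  shows "prob {\<omega>\<in>space M. \<bar>Y \<omega>\<bar> > a} \<le> V / a\<^sup>2"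
proof -
  have V0: "V \<ge> 0" using order_trans[OF norm_ge_zero A[of 1]] by simp
  have "emeasure M {\<omega>\<in>space M. \<bar>Y \<omega>\<bar> > a} \<le> emeasure M {\<omega>\<in>space M. 1 \<le> ennreal (1 / a\<^sup>2) * ennreal ((Y \<omega>)\<^sup>2)}"
  proof (rule emeasure_mono)
    show "{\<omega>\<in>space M. \<bar>Y \<omega>\<bar> > a} \<subseteq> {\<omega>\<in>space M. 1 \<le> ennreal (1 / a\<^sup>2) * ennreal ((Y \<omega>)\<^sup>2)}"
    proof safe
      fix \<omega> assume "\<bar>Y \<omega>\<bar> > a"
      then have "a\<^sup>2 \<le> (Y \<omega>)\<^sup>2" using \<open>a > 0\<close> by (metis abs_le_square_iff abs_of_pos less_imp_le)
      then show "1 \<le> ennreal (1 / a\<^sup>2) * ennreal ((Y \<omega>)\<^sup>2)"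
        using \<open>a > 0\<close> by (simp add: ennreal_mult[symmetric] ennreal_1[symmetric] del: ennreal_1)
    qed
  qed measurable
  also have "\<dots> \<le> ennreal (1 / a\<^sup>2) * (\<integral>\<^sup>+\<omega>. ennreal ((Y \<omega>)\<^sup>2) * indicator (space M) \<omega> \<partial>M)"
    by (rule nn_integral_Markov_inequality) measurable
  also have "(\<integral>\<^sup>+\<omega>. ennreal ((Y \<omega>)\<^sup>2) * indicator (space M) \<omega> \<partial>M) = (\<integral>\<^sup>+\<omega>. ennreal ((Y \<omega>)\<^sup>2) \<partial>M)"
    by (intro nn_integral_cong) auto
  also have "ennreal (1 / a\<^sup>2) * (\<integral>\<^sup>+\<omega>. ennreal ((Y \<omega>)\<^sup>2) \<partial>M) \<le> ennreal (1 / a\<^sup>2) * ennreal V"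
    by (intro mult_left_mono second_moment_of_char[OF _ char A]) auto
  also have "\<dots> = ennreal (V / a\<^sup>2)" using V0 by (simp add: ennreal_mult[symmetric])
  finally show ?thesis using V0 by (simp add: emeasure_eq_measure)
qed

section \<open>Maximal inequality and cadlag paths\<close>

text \<open>Decompose according to the first \<open>k\<close> at which the partial sum exceeds
  \<open>2 * a\<close> (the event \<open>F k\<close>). If the rest of the sum is then at most
  \<open>a\<close> (the event \<open>E k\<close>), the full sum still exceeds \<open>a\<close>.
  \<open>F k\<close> depends on the first \<open>k\<close> variables and \<open>E k\<close> on the
  others, so the probabilities multiply, and the second one is at least
  \<open>1 - \<delta>\<close>.\<close>

lemma (in prob_space) ottaviani:
  fixes Y :: "nat \<Rightarrow> 'a \<Rightarrow> real"
  defines "S \<equiv> \<lambda>k \<omega>. \<Sum>i<k. Y i \<omega>"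
  assumes ind: "indep_vars (\<lambda>_. borel) Y {..<n}"
    and small: "\<And>k. k \<le> n \<Longrightarrow> prob {\<omega>\<in>space M. \<bar>S n \<omega> - S k \<omega>\<bar> > a} \<le> \<delta>"
  shows "(1 - \<delta>) * prob {\<omega>\<in>space M. \<exists>k\<le>n. \<bar>S k \<omega>\<bar> > 2 * a} \<le> prob {\<omega>\<in>space M. \<bar>S n \<omega>\<bar> > a}"
proof -
  have Y: "Y i \<in> borel_measurable M" if "i < n" for i
    using ind that by (auto simp: indep_vars_def)
  have Sm[measurable]: "S k \<in> borel_measurable M" if "k \<le> n" for k
    unfolding S_def by (rule borel_measurable_sum) (use that Y in auto)
  define F where "F k = {\<omega>\<in>space M. \<bar>S k \<omega>\<bar> > 2 * a \<and> (\<forall>j<k. \<bar>S j \<omega>\<bar> \<le> 2 * a)}" for k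
  define E where "E k = {\<omega>\<in>space M. \<bar>S n \<omega> - S k \<omega>\<bar> \<le> a}" for k
  have Fm: "F k \<in> events" if "k \<le> n" for k
  proof -
    have "F k = {\<omega>\<in>space M. \<bar>S k \<omega>\<bar> > 2 * a} \<inter> (space M \<inter> (\<Inter>j\<in>{..<k}. {\<omega>\<in>space M. \<bar>S j \<omega>\<bar> \<le> 2 * a}))"
      by (auto simp: F_def)
    moreover have "{\<omega>\<in>space M. \<bar>S k \<omega>\<bar> > 2 * a} \<in> events" using Sm[OF that] by measurable
    moreover have "{\<omega>\<in>space M. \<bar>S j \<omega>\<bar> \<le> 2 * a} \<in> events" if "j < k" for j
      using Sm[of j] that \<open>k \<le> n\<close> by auto
    ultimately show ?thesis by (cases "k = 0") (auto intro!: sets.Int sets.finite_INT)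
  qed
  have Em: "E k \<in> events" if "k \<le> n" for k
    unfolding E_def using Sm[OF that] Sm[OF le_refl] by measurable
  have indep: "prob (F k \<inter> E k) = prob (F k) * prob (E k)" if kn: "k \<le> n" for k
  proof -
    define P1 where "P1 = PiM {..<k} (\<lambda>_. borel :: real measure)"
    define P2 where "P2 = PiM {k..<n} (\<lambda>_. borel :: real measure)"
    define Z1 where "Z1 \<omega> = restrict (\<lambda>i. Y i \<omega>) {..<k}" for \<omega>
    define Z2 where "Z2 \<omega> = restrict (\<lambda>i. Y i \<omega>) {k..<n}" for \<omega>
    \<comment> \<open>The past and the future enter as random elements of two finite product spaces,
      because \<open>F k\<close> involves all the partial sums up to \<open>k\<close> and not only
      the last one.\<close>
    have iv: "indep_var P1 Z1 P2 Z2"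
      unfolding P1_def P2_def Z1_def Z2_def
      by (rule indep_var_restrict[OF ind]) (use kn in auto)
    define A where "A = {x\<in>space P1. \<bar>\<Sum>i<k. x i\<bar> > 2 * a \<and> (\<forall>j\<in>{..<k}. \<bar>\<Sum>i<j. x i\<bar> \<le> 2 * a)}"
    define B where "B = {x\<in>space P2. \<bar>\<Sum>i=k..<n. x i\<bar> \<le> a}"
    have m: "(\<lambda>x. \<Sum>i<j. x i) \<in> borel_measurable P1" if "j \<le> k" for j
      unfolding P1_def by (rule borel_measurable_sum) (use that in auto)
    have Am: "A \<in> sets P1"
    proof -
      have "A = {x\<in>space P1. \<bar>\<Sum>i<k. x i\<bar> > 2 * a} \<inter> (space P1 \<inter> (\<Inter>j\<in>{..<k}. {x\<in>space P1. \<bar>\<Sum>i<j. x i\<bar> \<le> 2 * a}))"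
        by (auto simp: A_def)
      moreover have "{x\<in>space P1. \<bar>\<Sum>i<k. x i\<bar> > 2 * a} \<in> sets P1" using m[of k] by measurable
      moreover have "{x\<in>space P1. \<bar>\<Sum>i<j. x i\<bar> \<le> 2 * a} \<in> sets P1" if "j < k" for j
        using m[of j] that by auto
      ultimately show ?thesis by (cases "k = 0") (auto intro!: sets.Int sets.finite_INT)
    qed
    have Bm: "B \<in> sets P2"
    proof -
      have "(\<lambda>x. \<Sum>i=k..<n. x i) \<in> borel_measurable P2"
        unfolding P2_def by (rule borel_measurable_sum) auto
      then show ?thesis unfolding B_def by measurable
    qed
    have Sk: "(\<Sum>i<j. Z1 \<omega> i) = S j \<omega>" if "j \<le> k" for j \<omega>
      unfolding S_def Z1_def by (rule sum.cong) (use that in auto)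
    have Skn: "(\<Sum>i=k..<n. Z2 \<omega> i) = S n \<omega> - S k \<omega>" for \<omega>
    proof -
      have "S n \<omega> = S k \<omega> + (\<Sum>i=k..<n. Y i \<omega>)"
        unfolding S_def using kn by (metis lessThan_atLeast0 sum.atLeastLessThan_concat zero_le)
      then show ?thesis by (simp add: Z2_def)
    qed
    have Z: "Z1 \<omega> \<in> space P1" "Z2 \<omega> \<in> space P2" for \<omega>
      by (simp_all add: Z1_def Z2_def P1_def P2_def space_PiM)
    have F: "Z1 -` A \<inter> space M = F k" and E: "Z2 -` B \<inter> space M = E k"
      by (auto simp: A_def B_def F_def E_def Sk Skn Z)
    have "prob ((\<lambda>x. (Z1 x, Z2 x)) -` (A \<times> B) \<inter> space M) = prob (Z1 -` A \<inter> space M) * prob (Z2 -` B \<inter> space M)"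
      by (rule indep_varD[OF iv Am Bm])
    moreover have "(\<lambda>x. (Z1 x, Z2 x)) -` (A \<times> B) \<inter> space M = F k \<inter> E k"
      using F E by auto
    ultimately show ?thesis using F E by simp
  qed
  have pE: "prob (E k) \<ge> 1 - \<delta>" if "k \<le> n" for k
  proof -
    have "{\<omega>\<in>space M. \<bar>S n \<omega> - S k \<omega>\<bar> > a} = space M - E k" by (auto simp: E_def)
    then show ?thesis using small[OF that] prob_compl[OF Em[OF that]] by simp
  qed
  have disj: "disjoint_family_on F {..n}"
    unfolding disjoint_family_on_def
  proof (intro ballI impI)
    fix i j :: nat assume "i \<noteq> j"
    then show "F i \<inter> F j = {}"
      unfolding F_def by (cases i j rule: linorder_cases) (auto simp: not_le[symmetric])
  qed
  have "{\<omega>\<in>space M. \<exists>k\<le>n. \<bar>S k \<omega>\<bar> > 2 * a} = (\<Union>k\<in>{..n}. F k)"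
  proof safe
    fix \<omega> k assume *: "\<omega> \<in> space M" "k \<le> n" "\<bar>S k \<omega>\<bar> > 2 * a"
    define m where "m = (LEAST k. \<bar>S k \<omega>\<bar> > 2 * a)"
    have "\<bar>S m \<omega>\<bar> > 2 * a" unfolding m_def by (rule LeastI[of _ k]) (use * in simp)
    moreover have "m \<le> k" unfolding m_def by (rule Least_le) (use * in simp)
    moreover have "\<bar>S j \<omega>\<bar> \<le> 2 * a" if "j < m" for j
      using not_less_Least[of j "\<lambda>k. \<bar>S k \<omega>\<bar> > 2 * a"] that unfolding m_def by simp
    ultimately show "\<omega> \<in> (\<Union>k\<in>{..n}. F k)" using * by (auto simp: F_def intro!: bexI[of _ m])
  qed (auto simp: F_def)
  then have "prob {\<omega>\<in>space M. \<exists>k\<le>n. \<bar>S k \<omega>\<bar> > 2 * a} = (\<Sum>k\<le>n. prob (F k))"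
    using disj Fm by (simp add: finite_measure_finite_Union image_subset_iff)
  then have "(1 - \<delta>) * prob {\<omega>\<in>space M. \<exists>k\<le>n. \<bar>S k \<omega>\<bar> > 2 * a} = (\<Sum>k\<le>n. prob (F k) * (1 - \<delta>))"
    by (simp add: sum_distrib_left mult.commute)
  also have "\<dots> \<le> (\<Sum>k\<le>n. prob (F k \<inter> E k))"
    by (rule sum_mono) (auto simp: indep intro!: mult_left_mono pE)
  also have "\<dots> = prob (\<Union>k\<in>{..n}. F k \<inter> E k)"
    using disj Fm Em by (intro finite_measure_finite_Union[symmetric]) (auto simp: disjoint_family_on_def)
  also have "\<dots> \<le> prob {\<omega>\<in>space M. \<bar>S n \<omega>\<bar> > a}"
  proof (rule finite_measure_mono)
    show "(\<Union>k\<in>{..n}. F k \<inter> E k) \<subseteq> {\<omega>\<in>space M. \<bar>S n \<omega>\<bar> > a}" by (auto simp: F_def E_def)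
    show "{\<omega>\<in>space M. \<bar>S n \<omega>\<bar> > a} \<in> events" using Sm[OF le_refl] by measurable
  qed
  finally show ?thesis .
qed

text \<open>Ottaviani's inequality bounds the maximum over a dyadic grid by the same constant for
  every mesh. The grid events increase with the refinement, so the bound holds for their union, and
  right continuity carries it from dyadic times to all times.\<close>

lemma (in prob_space) maximal_inequality:
  fixes X :: "real \<Rightarrow> 'a \<Rightarrow> real"
  assumes [measurable]: "\<And>t. X t \<in> borel_measurable M"
    and X0: "\<And>\<omega>. \<omega> \<in> space M \<Longrightarrow> X 0 \<omega> = 0"
    and ind: "\<And>n t. t 0 = 0 \<Longrightarrow> (\<And>i. i < n \<Longrightarrow> t i < t (Suc i)) \<Longrightarrow>
        indep_vars (\<lambda>_. borel) (\<lambda>i \<omega>. X (t (Suc i)) \<omega> - X (t i) \<omega>) {..<n}"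
    and cheb: "\<And>s t. 0 \<le> s \<Longrightarrow> s \<le> t \<Longrightarrow> t \<le> T \<Longrightarrow> prob {\<omega>\<in>space M. \<bar>X t \<omega> - X s \<omega>\<bar> > a} \<le> \<delta>"
    and \<delta>: "\<delta> \<le> 1/2" and "a > 0" "T > 0"
    and rc: "\<And>\<omega> t. \<omega> \<in> space M \<Longrightarrow> 0 \<le> t \<Longrightarrow> continuous (at_right t) (\<lambda>t. X t \<omega>)"
  shows "\<exists>B\<in>events. prob B \<le> 2 * \<delta> \<and> (\<forall>\<omega>\<in>space M - B. \<forall>t\<in>{0..T}. \<bar>X t \<omega>\<bar> \<le> 2 * a)"
proof -
  define g where "g m j = real j * T / 2 ^ m" for m j :: nat
  define B where "B m = {\<omega>\<in>space M. \<exists>k\<le>2^m. \<bar>X (g m k) \<omega>\<bar> > 2 * a}" for m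
  have Bm[measurable]: "B m \<in> events" for m unfolding B_def by measurable
  have PB: "prob (B m) \<le> 2 * \<delta>" for m
  proof -
    define Y where "Y i \<omega> = X (g m (Suc i)) \<omega> - X (g m i) \<omega>" for i \<omega>
    have iv: "indep_vars (\<lambda>_. borel) Y {..<2^m}"
      unfolding Y_def by (rule ind) (use \<open>T > 0\<close> in \<open>auto simp: g_def divide_strict_right_mono\<close>)
    have tel: "(\<Sum>i<k. Y i \<omega>) = X (g m k) \<omega>" if "\<omega> \<in> space M" for k \<omega>
      unfolding Y_def using X0[OF that] by (subst sum_lessThan_telescope) (simp add: g_def)
    have gT: "g m (2^m) = T" by (simp add: g_def)
    have gm: "0 \<le> g m k" "g m k \<le> T" if "k \<le> 2^m" for k
    proof -
      have "real k \<le> 2 ^ m" using that by (metis of_nat_le_iff of_nat_numeral of_nat_power)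
      then show "0 \<le> g m k" "g m k \<le> T" using \<open>T > 0\<close> by (auto simp: g_def field_simps)
    qed
    have "(1 - \<delta>) * prob {\<omega>\<in>space M. \<exists>k\<le>2^m. \<bar>\<Sum>i<k. Y i \<omega>\<bar> > 2 * a} \<le> prob {\<omega>\<in>space M. \<bar>\<Sum>i<2^m. Y i \<omega>\<bar> > a}"
    proof (rule ottaviani[OF iv])
      fix k assume k: "k \<le> (2::nat)^m"
      have "{\<omega>\<in>space M. \<bar>(\<Sum>i<2^m. Y i \<omega>) - (\<Sum>i<k. Y i \<omega>)\<bar> > a} = {\<omega>\<in>space M. \<bar>X T \<omega> - X (g m k) \<omega>\<bar> > a}"
        by (auto simp: tel gT)
      then show "prob {\<omega>\<in>space M. \<bar>(\<Sum>i<2^m. Y i \<omega>) - (\<Sum>i<k. Y i \<omega>)\<bar> > a} \<le> \<delta>"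
        using cheb[of "g m k" T] gm[OF k] by simp
    qed
    also have "{\<omega>\<in>space M. \<bar>\<Sum>i<2^m. Y i \<omega>\<bar> > a} = {\<omega>\<in>space M. \<bar>X T \<omega> - X 0 \<omega>\<bar> > a}"
      by (auto simp: tel gT X0)
    also have "prob \<dots> \<le> \<delta>" using cheb[of 0 T] \<open>T > 0\<close> by simp
    also have "{\<omega>\<in>space M. \<exists>k\<le>2^m. \<bar>\<Sum>i<k. Y i \<omega>\<bar> > 2 * a} = B m"
      unfolding B_def by (auto simp: tel)
    finally have "(1 - \<delta>) * prob (B m) \<le> \<delta>" .
    \<comment> \<open>The condition \<open>\<delta> \<le> 1/2\<close> replaces the factor
      \<open>1 - \<delta>\<close> by \<open>1/2\<close>, whence the constant
      \<open>2 * \<delta>\<close>.\<close>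
    moreover have "(1/2) * prob (B m) \<le> (1 - \<delta>) * prob (B m)"
      using \<delta> by (intro mult_right_mono) auto
    ultimately show ?thesis by simp
  qed
  have "incseq B"
  proof (rule incseq_SucI, safe)
    fix m \<omega> assume "\<omega> \<in> B m"
    then obtain k where k: "\<omega> \<in> space M" "k \<le> 2^m" "\<bar>X (g m k) \<omega>\<bar> > 2 * a" by (auto simp: B_def)
    have "g m k = g (Suc m) (2 * k)" by (simp add: g_def)
    with k show "\<omega> \<in> B (Suc m)" unfolding B_def by (auto intro!: exI[of _ "2 * k"])
  qed
  then have "(\<lambda>m. prob (B m)) \<longlonglongrightarrow> prob (\<Union>m. B m)"
    by (intro finite_Lim_measure_incseq) auto
  then have PU: "prob (\<Union>m. B m) \<le> 2 * \<delta>"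
    by (rule LIMSEQ_le_const2) (use PB in auto)
  have "\<bar>X t \<omega>\<bar> \<le> 2 * a" if \<omega>: "\<omega> \<in> space M - (\<Union>m. B m)" and t: "t \<in> {0..T}" for t \<omega>
  proof (rule ccontr)
    assume "\<not> \<bar>X t \<omega>\<bar> \<le> 2 * a"
    then have big: "\<bar>X t \<omega>\<bar> > 2 * a" by simp
    have nb: "\<bar>X (g m k) \<omega>\<bar> \<le> 2 * a" if "k \<le> 2^m" for m k
      using \<omega> that by (auto simp: B_def not_less)
    show False
    proof (cases "t = T")
      case True
      \<comment> \<open>The end point has nothing to its right in the interval, but it belongs to
        the coarsest grid.\<close>
      then show ?thesis using nb[of 1 0] big by (simp add: g_def)
    next
      case False
      with t have tT: "t < T" by simp
      have "((\<lambda>t. \<bar>X t \<omega>\<bar>) \<longlongrightarrow> \<bar>X t \<omega>\<bar>) (at_right t)"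
        using rc[of \<omega> t] \<omega> t by (auto simp: continuous_within intro!: tendsto_rabs)
      from order_tendstoD(1)[OF this big]
      obtain b where b: "b > t" "\<And>u. t < u \<Longrightarrow> u < b \<Longrightarrow> \<bar>X u \<omega>\<bar> > 2 * a"
        using tT by (auto simp: eventually_at_right[OF tT])
      define e where "e = min b T - t"
      have e: "e > 0" using b tT by (simp add: e_def)
      obtain m where m: "(1/2::real)^m < e / T"
        using real_arch_pow_inv[of "e/T" "1/2"] e \<open>T > 0\<close> by auto
      \<comment> \<open>The added \<open>1\<close> gives the first grid point strictly to the right
        of \<open>t\<close>; the mesh was chosen smaller than \<open>e\<close>, so this point still
        lies where the path is large.\<close>
      define k where "k = nat \<lfloor>t * 2^m / T\<rfloor> + 1"
      have t2: "t * 2^m / T \<ge> 0" using t \<open>T > 0\<close> by simp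
      have "real k = of_int \<lfloor>t * 2^m / T\<rfloor> + 1" unfolding k_def using t2 by simp
      then have k: "t * 2^m / T < real k" "real k \<le> t * 2^m / T + 1"
        by linarith+
      have g1: "t < g m k" using k(1) \<open>T > 0\<close> by (simp add: g_def field_simps)
      have "g m k \<le> (t * 2^m / T + 1) * T / 2^m"
        unfolding g_def using k(2) \<open>T > 0\<close> by (intro divide_right_mono mult_right_mono) auto
      also have "\<dots> = t + T * (1/2)^m" using \<open>T > 0\<close> by (simp add: field_simps power_divide)
      also have "\<dots> < t + e" using m \<open>T > 0\<close> by (simp add: field_simps)
      finally have g2: "g m k < min b T" by (simp add: e_def)
      have "real k < 2^m" using g2 \<open>T > 0\<close> by (auto simp: g_def field_simps)
      then have "k \<le> 2^m" by (metis less_imp_le of_nat_less_iff of_nat_numeral of_nat_power)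
      then show ?thesis using nb[of k m] b(2)[OF g1] g2 by simp
    qed
  qed
  then show ?thesis using PU by (intro bexI[of _ "\<Union>m. B m"]) auto
qed

section \<open>Cadlag paths and locally uniform series of them\<close>

lemma cadlag_step: "cadlag (\<lambda>t. c * indicator {0<..t} (s::real))"
proof -
  have "\<exists>l. ((\<lambda>t. c * indicator {0<..t} s) \<longlongrightarrow> l) (at_left t)" for t
  proof (cases "s < t")
    case True
    then have "\<forall>\<^sub>F u in at_left t. c * indicator {0<..u} s = c * of_bool (0 < s)"
      by (intro eventually_mono[OF eventually_at_left_real[OF True]]) (auto simp: indicator_def)
    then show ?thesis by (blast intro: tendsto_eventually)
  next
    case False
    then have "\<forall>\<^sub>F u in at_left t. c * indicator {0<..u} s = 0"
      by (intro eventually_mono[OF eventually_at_left_real[of "t - 1" t]]) (auto simp: indicator_def)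
    then show ?thesis by (blast intro: tendsto_eventually)
  qed
  moreover have "continuous (at_right t) (\<lambda>t. c * indicator {0<..t} s)" for t
  proof (cases "t < s")
    case True
    then have "\<forall>\<^sub>F u in at_right t. c * indicator {0<..u} s = c * indicator {0<..t} s"
      by (intro eventually_mono[OF eventually_at_right_real[OF True]]) (auto simp: indicator_def)
    then show ?thesis by (auto simp: continuous_within intro: tendsto_eventually)
  next
    case False
    then have "\<forall>\<^sub>F u in at_right t. c * indicator {0<..u} s = c * indicator {0<..t} s"
      by (intro eventually_mono[OF eventually_at_right_real[of t "t + 1"]]) (auto simp: indicator_def)
    then show ?thesis by (auto simp: continuous_within intro: tendsto_eventually)
  qed
  ultimately show ?thesis by (auto simp: cadlag_def)
qed

lemma cadlag_add: "cadlag f \<Longrightarrow> cadlag g \<Longrightarrow> cadlag (\<lambda>t. f t + g t)"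
  unfolding cadlag_def by (blast intro: continuous_add tendsto_add)

lemma cadlag_continuous: "continuous_on UNIV f \<Longrightarrow> cadlag f"
  unfolding cadlag_def
  by (metis continuous_on_eq_continuous_at continuous_at_imp_continuous_at_within continuous_within open_UNIV UNIV_I)

lemma cadlag_sum: "(\<And>i. i \<in> I \<Longrightarrow> cadlag (f i)) \<Longrightarrow> cadlag (\<lambda>t. \<Sum>i\<in>I. f i t)"
  by (induction I rule: infinite_finite_induct) (auto intro: cadlag_add cadlag_continuous)

text \<open>On a bounded interval all but finitely many terms are dominated by \<open>r\<close>, so
  the convergence there is uniform and one-sided limits pass to the sum. The left limits
  \<open>l k\<close> of the terms inherit the domination and are therefore summable.\<close>

lemma cadlag_suminf:
  fixes J :: "nat \<Rightarrow> real \<Rightarrow> real"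
  assumes cad: "\<And>k. cadlag (J k)" and "summable r"
    and bd: "\<And>T. \<exists>K. \<forall>k\<ge>K. \<forall>t\<in>{0..T}. \<bar>J k t\<bar> \<le> r k"
  shows "cadlag (\<lambda>t. \<Sum>k. J k t)" "t \<ge> 0 \<Longrightarrow> summable (\<lambda>k. J k t)"
proof -
  have ul: "uniform_limit {0..T} (\<lambda>n t. \<Sum>k<n. J k t) (\<lambda>t. \<Sum>k. J k t) sequentially" for T
  proof (rule Weierstrass_m_test_ev)
    show "\<forall>\<^sub>F k in sequentially. \<forall>t\<in>{0..T}. norm (J k t) \<le> r k"
      using bd[of T] by (auto simp: eventually_sequentially)
  qed fact
  show sm: "summable (\<lambda>k. J k t)" if "t \<ge> 0" for t
  proof -
    obtain K where K: "\<And>k s. k \<ge> K \<Longrightarrow> s \<in> {0..t} \<Longrightarrow> \<bar>J k s\<bar> \<le> r k" using bd[of t] by blast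
    show ?thesis by (rule summable_comparison_test[OF _ \<open>summable r\<close>]) (use K that in auto)
  qed
  show "cadlag (\<lambda>t. \<Sum>k. J k t)"
    unfolding cadlag_def
  proof (intro conjI allI impI)
    fix t :: real assume t: "t \<ge> 0"
    \<comment> \<open>Uniform convergence is known on bounded intervals only; the filter at
      \<open>t\<close> within \<open>{t..t+1}\<close> is the one from the right.\<close>
    have "((\<lambda>t. \<Sum>k. J k t) \<longlongrightarrow> (\<Sum>k. J k t)) (at t within {t..t+1})"
    proof (rule swap_uniform_limit)
      show "uniform_limit {t..t+1} (\<lambda>n t. \<Sum>k<n. J k t) (\<lambda>t. \<Sum>k. J k t) sequentially"
        by (rule uniform_limit_on_subset[OF ul[of "t+1"]]) (use t in auto)
      show "(\<lambda>n. \<Sum>k<n. J k t) \<longlonglongrightarrow> (\<Sum>k. J k t)"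
        using sm[OF t] by (rule summable_LIMSEQ)
      show "\<forall>\<^sub>F n in sequentially. ((\<lambda>t. \<Sum>k<n. J k t) \<longlongrightarrow> (\<Sum>k<n. J k t)) (at t within {t..t+1})"
        using cad t by (intro always_eventually allI tendsto_sum)
          (simp add: at_within_Icc_at_right cadlag_def continuous_within)
    qed simp
    then show "continuous (at_right t) (\<lambda>t. \<Sum>k. J k t)"
      by (simp add: at_within_Icc_at_right continuous_within)
  next
    fix t :: real assume t: "t > 0"
    have "\<exists>l. \<forall>k. (J k \<longlongrightarrow> l k) (at_left t)"
      using cad t by (intro choice) (auto simp: cadlag_def)
    then obtain l where l: "\<And>k. (J k \<longlongrightarrow> l k) (at_left t)" by blast
    obtain K where K: "\<And>k s. k \<ge> K \<Longrightarrow> s \<in> {0..t} \<Longrightarrow> \<bar>J k s\<bar> \<le> r k" using bd[of t] by blast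
    have lK: "\<bar>l k\<bar> \<le> r k" if "k \<ge> K" for k
    proof (rule tendsto_upperbound)
      show "((\<lambda>s. \<bar>J k s\<bar>) \<longlongrightarrow> \<bar>l k\<bar>) (at_left t)" by (intro tendsto_rabs l)
      show "\<forall>\<^sub>F s in at_left t. \<bar>J k s\<bar> \<le> r k"
        by (intro eventually_mono[OF eventually_at_left_real[OF t]]) (use K that in auto)
    qed simp
    have sl: "summable l"
      by (rule summable_comparison_test[OF _ \<open>summable r\<close>]) (use lK in auto)
    have "((\<lambda>t. \<Sum>k. J k t) \<longlongrightarrow> (\<Sum>k. l k)) (at t within {0..t})"
    proof (rule swap_uniform_limit)
      show "uniform_limit {0..t} (\<lambda>n t. \<Sum>k<n. J k t) (\<lambda>t. \<Sum>k. J k t) sequentially" by (rule ul)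
      show "(\<lambda>n. \<Sum>k<n. l k) \<longlonglongrightarrow> (\<Sum>k. l k)"
        using sl by (rule summable_LIMSEQ)
      show "\<forall>\<^sub>F n in sequentially. ((\<lambda>t. \<Sum>k<n. J k t) \<longlongrightarrow> (\<Sum>k<n. l k)) (at t within {0..t})"
        using l t by (intro always_eventually allI tendsto_sum) (simp add: at_within_Icc_at_left)
    qed simp
    then show "\<exists>l. ((\<lambda>t. \<Sum>k. J k t) \<longlongrightarrow> l) (at_left t)"
      using t by (auto simp: at_within_Icc_at_left)
  qed
qed

section \<open>Superposition of point layers\<close>

definition levy_integrand :: "real \<Rightarrow> real \<Rightarrow> complex" where
  "levy_integrand \<theta> x = iexp (\<theta> * x) - 1 - \<i> * complex_of_real (\<theta> * x) * indicator {-1..1} x"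

lemma levy_integrand_measurable[measurable]: "levy_integrand \<theta> \<in> borel_measurable borel"
  unfolding levy_integrand_def by measurable

lemma levy_integrand_0[simp]: "levy_integrand 0 x = 0"
  by (simp add: levy_integrand_def)

lemma levy_integrand_le_square:
  assumes "\<bar>x\<bar> \<le> 1"
  shows "cmod (levy_integrand \<theta> x) \<le> \<theta>\<^sup>2 * x\<^sup>2 / 2"
proof -
  have "indicator {-1..1} x = (1::complex)" using assms by (auto simp: indicator_def)
  then have "levy_integrand \<theta> x = iexp (\<theta> * x) - (\<Sum>k\<le>1. (\<i> * of_real (\<theta> * x)) ^ k / fact k)"
    unfolding levy_integrand_def by simp
  also have "cmod \<dots> \<le> \<bar>\<theta> * x\<bar> ^ Suc 1 / fact (Suc 1)" by (rule iexp_approx1)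
  also have "\<dots> = \<theta>\<^sup>2 * x\<^sup>2 / 2"
    by (simp add: power2_eq_square abs_mult_self_eq)
  finally show ?thesis .
qed

lemma levy_integrand_le: "cmod (levy_integrand \<theta> x) \<le> 2 + \<bar>\<theta>\<bar>"
proof -
  have "cmod (\<i> * complex_of_real (\<theta> * x) * indicator {-1..1} x) = \<bar>\<theta>\<bar> * (\<bar>x\<bar> * indicator {-1..1} x)"
    by (simp add: norm_mult abs_mult indicator_def)
  also have "\<dots> \<le> \<bar>\<theta>\<bar> * 1"
    by (intro mult_left_mono) (auto simp: indicator_def)
  finally have "cmod (\<i> * complex_of_real (\<theta> * x) * indicator {-1..1} x) \<le> \<bar>\<theta>\<bar>" by simp
  moreover have "cmod (iexp (\<theta> * x) - 1) \<le> 1 + 1"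
    by (rule order_trans[OF norm_triangle_ineq4]) simp
  moreover have "cmod (levy_integrand \<theta> x) \<le> cmod (iexp (\<theta> * x) - 1) + cmod (\<i> * complex_of_real (\<theta> * x) * indicator {-1..1} x)"
    unfolding levy_integrand_def by (rule norm_triangle_ineq4)
  ultimately show ?thesis by linarith
qed

text \<open>Points are pairs of a time and a jump. This is the mean of the jumps in
  \<open>{-1..1}\<close> up to time \<open>t\<close>, the compensator that produces the linear term
  of \<open>levy_integrand\<close>; jumps beyond \<open>1\<close> stay uncompensated.\<close>

definition layer_drift :: "real \<Rightarrow> (real \<times> real) measure \<Rightarrow> real \<Rightarrow> real" where
  "layer_drift \<Lambda> q t = \<Lambda> * (\<integral>p. snd p * indicator {-1..1} (snd p) * indicator {0<..t} (fst p) \<partial>q)"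

definition layer :: "real \<Rightarrow> (real \<times> real) measure \<Rightarrow> real \<Rightarrow> nat \<times> (nat \<Rightarrow> real \<times> real) \<Rightarrow> real" where
  "layer \<Lambda> q t \<omega> = (\<Sum>i<fst \<omega>. snd (snd \<omega> i) * indicator {0<..t} (fst (snd \<omega> i))) - layer_drift \<Lambda> q t"

text \<open>The last assumption bounds the intensity of the times by \<open>C\<close> per unit of
  time. It makes the drift Lipschitz, so the paths of a layer jump only at its points.\<close>

locale point_layer = prob_space q for q :: "(real \<times> real) measure" +
  fixes \<Lambda> C :: real
  assumes sets_q[measurable_cong]: "sets q = sets borel"
    and \<Lambda>: "\<Lambda> \<ge> 0"
    and no_atoms: "s \<le> t \<Longrightarrow> \<Lambda> * prob {p\<in>space q. s < fst p \<and> fst p \<le> t} \<le> C * (t - s)"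
begin

sublocale cloud: prob_space "cloud \<Lambda> q"
  by (rule prob_space_cloud) (rule prob_space_axioms)

lemma fst_q[measurable]: "fst \<in> borel_measurable q" and snd_q[measurable]: "snd \<in> borel_measurable q"
  by (simp_all add: measurable_cong_sets[OF sets_q refl] borel_prod[symmetric])

lemma layer_measurable[measurable]: "layer \<Lambda> q t \<in> borel_measurable (cloud \<Lambda> q)"
  unfolding layer_def by measurable

lemma layer_0[simp]: "layer \<Lambda> q 0 \<omega> = 0"
  by (simp add: layer_def layer_drift_def)

lemma integrable_drift: "integrable q (\<lambda>p. snd p * indicator {-1..1} (snd p) * indicator {0<..t} (fst p))"
  by (rule integrable_const_bound[where B=1]) (auto simp: indicator_def)

lemma drift_increment_le:
  assumes "s \<le> t"
  shows "\<bar>layer_drift \<Lambda> q t - layer_drift \<Lambda> q s\<bar> \<le> C * (t - s)"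
proof -
  define f where "f t p = snd p * indicator {-1..1} (snd p) * indicator {0<..t} (fst p)" for t and p :: "real \<times> real"
  define S where "S = {p\<in>space q. s < fst p \<and> fst p \<le> t}"
  have S[measurable]: "S \<in> sets q" unfolding S_def by measurable
  have f: "integrable q (f t)" for t unfolding f_def by (rule integrable_drift)
  have "norm (\<integral>p. f t p - f s p \<partial>q) \<le> (\<integral>p. indicator S p \<partial>q)"
  proof (rule Bochner_Integration.integral_norm_bound_integral)
    show "integrable q (\<lambda>p. f t p - f s p)" using f by simp
    show "integrable q (\<lambda>p. indicator S p :: real)"
      by (rule integrable_real_indicator) (auto simp: emeasure_eq_measure)
    fix p assume p: "p \<in> space q"
    have c: "\<bar>snd p * indicator {-1..1} (snd p)\<bar> \<le> (1::real)" by (cases "snd p \<in> {-1..1}") auto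
    have d: "\<bar>indicator {0<..t} (fst p) - indicator {0<..s} (fst p)\<bar> \<le> (indicator S p :: real)"
      using assms p unfolding S_def by (cases "fst p \<le> s"; cases "fst p \<le> t"; cases "0 < fst p") auto
    have "f t p - f s p = (snd p * indicator {-1..1} (snd p)) * (indicator {0<..t} (fst p) - indicator {0<..s} (fst p))"
      unfolding f_def by (rule right_diff_distrib[symmetric])
    then show "norm (f t p - f s p) \<le> indicator S p"
      using mult_mono[OF c d] by (simp only: real_norm_def abs_mult mult_1 abs_ge_zero zero_le_one)
  qed
  also have "(\<integral>p. indicator S p \<partial>q) = prob S" by simp
  finally have "\<Lambda> * \<bar>\<integral>p. f t p - f s p \<partial>q\<bar> \<le> \<Lambda> * prob S"
    by (intro mult_left_mono \<Lambda>) simp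
  also have "\<dots> \<le> C * (t - s)" unfolding S_def by (rule no_atoms[OF assms])
  finally have "\<Lambda> * \<bar>\<integral>p. f t p - f s p \<partial>q\<bar> \<le> C * (t - s)" .
  moreover have "layer_drift \<Lambda> q t - layer_drift \<Lambda> q s = \<Lambda> * (\<integral>p. f t p - f s p \<partial>q)"
    unfolding layer_drift_def f_def[symmetric] Bochner_Integration.integral_diff[OF f f]
    by (rule right_diff_distrib[symmetric])
  ultimately show ?thesis using \<Lambda> by (simp only: abs_mult abs_of_nonneg)
qed

lemma continuous_drift: "continuous_on UNIV (layer_drift \<Lambda> q)"
proof -
  have *: "dist (layer_drift \<Lambda> q t) (layer_drift \<Lambda> q s) \<le> C * dist t s" for s t
    using drift_increment_le[of s t] drift_increment_le[of t s]
    by (cases "s \<le> t") (simp_all only: dist_real_def abs_minus_commute, simp_all)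
  have "0 \<le> C * dist (1::real) 0"
    by (rule order_trans[OF zero_le_dist *])
  then have "0 \<le> C" by simp
  then have "C-lipschitz_on UNIV (layer_drift \<Lambda> q)"
    by (intro lipschitz_onI *)
  then show ?thesis by (rule lipschitz_on_continuous_on)
qed

lemma cadlag_layer: "cadlag (\<lambda>t. layer \<Lambda> q t \<omega>)"
proof -
  have "cadlag (\<lambda>t. (\<Sum>i<fst \<omega>. snd (snd \<omega> i) * indicator {0<..t} (fst (snd \<omega> i))) + (- layer_drift \<Lambda> q t))"
    by (intro cadlag_add cadlag_sum cadlag_step cadlag_continuous continuous_on_minus continuous_drift)
  then show ?thesis by (simp add: layer_def)
qed

lemma integrable_levy_integrand:
  "integrable q (\<lambda>p. indicator {s<..t} (fst p) *\<^sub>R levy_integrand \<theta> (snd p))"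
proof (rule integrable_const_bound[where B="2 + \<bar>\<theta>\<bar>"])
  have "cmod (indicator {s<..t} (fst p) *\<^sub>R levy_integrand \<theta> (snd p)) \<le> 2 + \<bar>\<theta>\<bar>" for p
    using levy_integrand_le[of \<theta> "snd p"] by (auto simp: indicator_def)
  then show "AE p in q. cmod (indicator {s<..t} (fst p) *\<^sub>R levy_integrand \<theta> (snd p)) \<le> 2 + \<bar>\<theta>\<bar>" by simp
qed measurable

text \<open>A linear combination of increments is again a sum over the cloud of one function
  \<open>g\<close>, so \<open>cloud_char\<close> applies. The time intervals are disjoint, hence
  every point contributes to at most one increment and the exponent splits into one integral per
  interval.\<close>

lemma layer_joint_char:
  assumes t: "t 0 \<ge> (0::real)" "\<And>i. i < n \<Longrightarrow> t i \<le> t (Suc i)"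
  shows "(\<integral>\<omega>. iexp (\<Sum>j<n. \<theta> j * (layer \<Lambda> q (t (Suc j)) \<omega> - layer \<Lambda> q (t j) \<omega>)) \<partial>cloud \<Lambda> q)
     = exp (of_real \<Lambda> * (\<Sum>j<n. \<integral>p. indicator {t j<..t (Suc j)} (fst p) *\<^sub>R levy_integrand (\<theta> j) (snd p) \<partial>q))"
proof -
  have mono: "t i \<le> t j" if "i \<le> j" "j \<le> n" for i j
    using that
  proof (induction j rule: dec_induct)
    case (step m)
    then show ?case using t(2)[of m] by simp
  qed simp
  define ind :: "nat \<Rightarrow> real \<times> real \<Rightarrow> real" where "ind j p = indicator {t j<..t (Suc j)} (fst p)" for j p
  have indm[measurable]: "ind j \<in> borel_measurable q" for j unfolding ind_def by measurable
  have ind_diff: "indicator {0<..t (Suc j)} (fst p) - indicator {0<..t j} (fst p) = ind j p" if "j < n" for j p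
    using mono[of 0 j] that t(2)[OF that] t(1) by (auto simp: ind_def indicator_def)
  define g where "g p = (\<Sum>j<n. \<theta> j * (snd p * ind j p))" for p
  define h where "h p = (\<Sum>j<n. \<theta> j * (snd p * indicator {-1..1} (snd p) * ind j p))" for p
  have gm[measurable]: "g \<in> borel_measurable q" unfolding g_def by measurable
  have inth: "integrable q (\<lambda>p. snd p * indicator {-1..1} (snd p) * ind j p)" for j
    by (rule integrable_const_bound[where B=1]) (auto simp: indicator_def ind_def)
  have drift: "layer_drift \<Lambda> q (t (Suc j)) - layer_drift \<Lambda> q (t j) = \<Lambda> * (\<integral>p. snd p * indicator {-1..1} (snd p) * ind j p \<partial>q)"
    if "j < n" for j
    unfolding layer_drift_def right_diff_distrib[symmetric] using integrable_drift
    by (subst Bochner_Integration.integral_diff[symmetric])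
       (auto simp: ind_diff[OF that, symmetric] right_diff_distrib)
  have intH: "integrable q h" unfolding h_def using inth by auto
  have eq: "(\<Sum>j<n. \<theta> j * (layer \<Lambda> q (t (Suc j)) \<omega> - layer \<Lambda> q (t j) \<omega>)) = (\<Sum>i<fst \<omega>. g (snd \<omega> i)) - \<Lambda> * (\<integral>p. h p \<partial>q)" for \<omega>
  proof -
    have "(\<Sum>j<n. \<theta> j * (layer \<Lambda> q (t (Suc j)) \<omega> - layer \<Lambda> q (t j) \<omega>))
       = (\<Sum>j<n. \<theta> j * ((\<Sum>i<fst \<omega>. snd (snd \<omega> i) * ind j (snd \<omega> i)) - \<Lambda> * (\<integral>p. snd p * indicator {-1..1} (snd p) * ind j p \<partial>q)))"
    proof (rule sum.cong[OF refl])
      fix j assume "j \<in> {..<n}"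
      then have j: "j < n" by simp
      have "(\<Sum>i<fst \<omega>. snd (snd \<omega> i) * ind j (snd \<omega> i)) = (\<Sum>i<fst \<omega>. snd (snd \<omega> i) * indicator {0<..t (Suc j)} (fst (snd \<omega> i))) - (\<Sum>i<fst \<omega>. snd (snd \<omega> i) * indicator {0<..t j} (fst (snd \<omega> i)))"
        by (simp add: ind_diff[OF j, symmetric] right_diff_distrib sum_subtractf)
      then show "\<theta> j * (layer \<Lambda> q (t (Suc j)) \<omega> - layer \<Lambda> q (t j) \<omega>) = \<theta> j * ((\<Sum>i<fst \<omega>. snd (snd \<omega> i) * ind j (snd \<omega> i)) - \<Lambda> * (\<integral>p. snd p * indicator {-1..1} (snd p) * ind j p \<partial>q))"
        using drift[OF j] by (simp add: layer_def)
    qed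
    also have "\<dots> = (\<Sum>i<fst \<omega>. g (snd \<omega> i)) - \<Lambda> * (\<Sum>j<n. \<theta> j * (\<integral>p. snd p * indicator {-1..1} (snd p) * ind j p \<partial>q))"
      unfolding g_def by (subst sum.swap) (simp add: right_diff_distrib sum_subtractf sum_distrib_left mult.left_commute)
    also have "(\<Sum>j<n. \<theta> j * (\<integral>p. snd p * indicator {-1..1} (snd p) * ind j p \<partial>q)) = (\<integral>p. h p \<partial>q)"
      unfolding h_def using inth by simp
    finally show ?thesis .
  qed
  have intE: "integrable q (\<lambda>p. iexp (g p))"
    by (rule integrable_const_bound[where B=1]) auto
  \<comment> \<open>At most one of the indicators \<open>ind j p\<close> is nonzero. Therefore the
    exponential of the sum, minus \<open>1\<close>, is the sum of the exponentials minus
    \<open>1\<close>.\<close>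
  have pt: "iexp (g p) - 1 - \<i> * of_real (h p) = (\<Sum>j<n. ind j p *\<^sub>R levy_integrand (\<theta> j) (snd p))" for p
  proof (cases "\<exists>j<n. fst p \<in> {t j<..t (Suc j)}")
    case True
    then obtain j where j: "j < n" "fst p \<in> {t j<..t (Suc j)}" by blast
    have ind: "ind i p = (if i = j then 1 else 0)" if "i < n" for i
    proof (cases i j rule: linorder_cases)
      case less
      then show ?thesis using j mono[of "Suc i" j] by (auto simp: ind_def indicator_def)
    next
      case greater
      then show ?thesis using j mono[of "Suc j" i] that by (auto simp: ind_def indicator_def)
    qed (use j in \<open>auto simp: ind_def\<close>)
    have "g p = (\<Sum>i<n. if i = j then \<theta> j * snd p else 0)"
      unfolding g_def by (rule sum.cong) (auto simp: ind)
    then have g: "g p = \<theta> j * snd p" using j by simp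
    have "h p = (\<Sum>i<n. if i = j then \<theta> j * (snd p * indicator {-1..1} (snd p)) else 0)"
      unfolding h_def by (rule sum.cong) (auto simp: ind)
    then have h: "h p = \<theta> j * (snd p * indicator {-1..1} (snd p))" using j by simp
    have "(\<Sum>i<n. ind i p *\<^sub>R levy_integrand (\<theta> i) (snd p)) = (\<Sum>i<n. if i = j then levy_integrand (\<theta> j) (snd p) else 0)"
      by (rule sum.cong) (auto simp: ind)
    then show ?thesis using j
      by (auto simp: g h levy_integrand_def indicator_def)
  next
    case False
    then have "ind j p = 0" if "j < n" for j using that by (auto simp: ind_def indicator_def)
    then show ?thesis by (simp add: g_def h_def)
  qed
  have "(\<integral>\<omega>. iexp (\<Sum>j<n. \<theta> j * (layer \<Lambda> q (t (Suc j)) \<omega> - layer \<Lambda> q (t j) \<omega>)) \<partial>cloud \<Lambda> q)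
     = (\<integral>\<omega>. iexp (\<Sum>i<fst \<omega>. g (snd \<omega> i)) * iexp (- (\<Lambda> * (\<integral>p. h p \<partial>q))) \<partial>cloud \<Lambda> q)"
    unfolding eq by (simp add: exp_add[symmetric] algebra_simps)
  also have "\<dots> = (\<integral>\<omega>. iexp (\<Sum>i<fst \<omega>. g (snd \<omega> i)) \<partial>cloud \<Lambda> q) * iexp (- (\<Lambda> * (\<integral>p. h p \<partial>q)))"
    by (rule integral_mult_left_zero)
  also have "(\<integral>\<omega>. iexp (\<Sum>i<fst \<omega>. g (snd \<omega> i)) \<partial>cloud \<Lambda> q) = exp (of_real \<Lambda> * ((\<integral>x. iexp (g x) \<partial>q) - 1))"
    by (rule cloud_char[OF prob_space_axioms gm \<Lambda>])
  also have "\<dots> * iexp (- (\<Lambda> * (\<integral>p. h p \<partial>q))) = exp (of_real \<Lambda> * (\<integral>p. iexp (g p) - 1 - \<i> * of_real (h p) \<partial>q))"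
    using intE intH by (simp add: prob_space exp_add[symmetric] algebra_simps)
  also have "(\<integral>p. iexp (g p) - 1 - \<i> * of_real (h p) \<partial>q) = (\<Sum>j<n. \<integral>p. ind j p *\<^sub>R levy_integrand (\<theta> j) (snd p) \<partial>q)"
    unfolding pt by (rule Bochner_Integration.integral_sum) (simp add: ind_def integrable_levy_integrand)
  finally show ?thesis unfolding ind_def .
qed

lemma layer_increments_indep:
  assumes t: "t 0 \<ge> (0::real)" "\<And>i. i < n \<Longrightarrow> t i \<le> t (Suc i)"
  shows "cloud.indep_vars (\<lambda>_. borel) (\<lambda>i \<omega>. layer \<Lambda> q (t (Suc i)) \<omega> - layer \<Lambda> q (t i) \<omega>) {..<n}"
proof (rule cloud.indep_vars_of_joint_char)
  show "(\<integral>\<omega>. iexp (\<Sum>i<n. \<theta> i * (layer \<Lambda> q (t (Suc i)) \<omega> - layer \<Lambda> q (t i) \<omega>)) \<partial>cloud \<Lambda> q)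
    = (\<Prod>i<n. exp (of_real \<Lambda> * (\<integral>p. indicator {t i<..t (Suc i)} (fst p) *\<^sub>R levy_integrand (\<theta> i) (snd p) \<partial>q)))" for \<theta>
    using layer_joint_char[of t n \<theta>, OF t] by (simp only: exp_sum[OF finite_lessThan] sum_distrib_left)
qed (auto intro!: borel_measurable_diff)

text \<open>Up to time \<open>T\<close> the jumps have size at most \<open>1\<close>, where
  \<open>levy_integrand\<close> is quadratically small. So \<open>V\<close> controls the exponent of
  every increment, Chebyshev gives \<open>V / a\<^sup>2\<close>, and this serves as the
  \<open>\<delta>\<close> of the maximal inequality.\<close>

lemma layer_sup_bound:
  assumes T: "T > 0" and small: "AE p in q. fst p \<in> {0<..T} \<longrightarrow> \<bar>snd p\<bar> \<le> 1"
    and V: "\<Lambda> * (\<integral>p. (snd p)\<^sup>2 * indicator {0<..T} (fst p) \<partial>q) \<le> V"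
    and a: "a > 0" "V / a\<^sup>2 \<le> 1/2"
  shows "\<exists>B\<in>sets (cloud \<Lambda> q). cloud.prob B \<le> 2 * (V / a\<^sup>2) \<and> (\<forall>\<omega>\<in>space (cloud \<Lambda> q) - B. \<forall>t\<in>{0..T}. \<bar>layer \<Lambda> q t \<omega>\<bar> \<le> 2 * a)"
proof (rule cloud.maximal_inequality)
  show "continuous (at_right t) (\<lambda>t. layer \<Lambda> q t \<omega>)" if "0 \<le> t" for t \<omega>
    using cadlag_layer[of \<omega>] that by (simp add: cadlag_def)
  show "cloud.indep_vars (\<lambda>_. borel) (\<lambda>i \<omega>. layer \<Lambda> q (t (Suc i)) \<omega> - layer \<Lambda> q (t i) \<omega>) {..<n}"
    if "t 0 = 0" "\<And>i. i < n \<Longrightarrow> t i < t (Suc i)" for t n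
    by (rule layer_increments_indep) (use that in \<open>auto intro: less_imp_le\<close>)
  fix s t :: real assume st: "0 \<le> s" "s \<le> t" "t \<le> T"
  show "cloud.prob {\<omega>\<in>space (cloud \<Lambda> q). \<bar>layer \<Lambda> q t \<omega> - layer \<Lambda> q s \<omega>\<bar> > a} \<le> V / a\<^sup>2"
  proof (rule cloud.chebyshev_of_char)
    fix \<theta>
    show "(\<integral>\<omega>. iexp (\<theta> * (layer \<Lambda> q t \<omega> - layer \<Lambda> q s \<omega>)) \<partial>cloud \<Lambda> q)
        = exp (of_real \<Lambda> * (\<integral>p. indicator {s<..t} (fst p) *\<^sub>R levy_integrand \<theta> (snd p) \<partial>q))"
      using layer_joint_char[of "\<lambda>i. if i = 0 then s else t" 1 "\<lambda>_. \<theta>"] st by simp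
    have ae: "AE p in q. cmod (indicator {s<..t} (fst p) *\<^sub>R levy_integrand \<theta> (snd p)) \<le> \<theta>\<^sup>2 / 2 * ((snd p)\<^sup>2 * indicator {0<..T} (fst p))"
      using small
    proof eventually_elim
      case (elim p)
      then show ?case using st levy_integrand_le_square[of "snd p" \<theta>] by (auto simp: indicator_def)
    qed
    have int: "integrable q (\<lambda>p. (snd p)\<^sup>2 * indicator {0<..T} (fst p))"
    proof (rule integrable_const_bound[where B=1])
      show "AE p in q. norm ((snd p)\<^sup>2 * indicator {0<..T} (fst p) :: real) \<le> 1"
        using small
      proof eventually_elim
        case (elim p)
        then show ?case by (auto simp: indicator_def abs_square_le_1)
      qed
    qed measurable
    have "cmod (\<integral>p. indicator {s<..t} (fst p) *\<^sub>R levy_integrand \<theta> (snd p) \<partial>q) \<le> (\<integral>p. cmod (indicator {s<..t} (fst p) *\<^sub>R levy_integrand \<theta> (snd p)) \<partial>q)"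
      by (rule integral_norm_bound)
    also have "\<dots> \<le> (\<integral>p. \<theta>\<^sup>2 / 2 * ((snd p)\<^sup>2 * indicator {0<..T} (fst p)) \<partial>q)"
      by (rule integral_mono_AE[OF integrable_norm[OF integrable_levy_integrand] _ ae]) (use int in simp)
    finally have "\<Lambda> * cmod (\<integral>p. indicator {s<..t} (fst p) *\<^sub>R levy_integrand \<theta> (snd p) \<partial>q)
       \<le> \<theta>\<^sup>2 / 2 * (\<Lambda> * (\<integral>p. (snd p)\<^sup>2 * indicator {0<..T} (fst p) \<partial>q))"
      using mult_left_mono[OF _ \<Lambda>] by (fastforce simp: mult.left_commute)
    also have "\<dots> \<le> \<theta>\<^sup>2 / 2 * V" using V by (intro mult_left_mono) auto
    finally show "cmod (of_real \<Lambda> * (\<integral>p. indicator {s<..t} (fst p) *\<^sub>R levy_integrand \<theta> (snd p) \<partial>q)) \<le> \<theta>\<^sup>2 * V / 2"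
      using \<Lambda> by (simp add: norm_mult)
  qed (use a in auto)
qed (use a T in auto)

end

text \<open>The size \<open>(1/8) ^ k\<close> is matched with the threshold
  \<open>(1/2) ^ k\<close>: dividing by the square of the threshold leaves \<open>(1/2) ^ k\<close>,
  so both the suprema of the layers and the exceptional probabilities are summable. For a given
  horizon this holds only from some layer on, since later layers may carry large jumps at later
  times.\<close>

locale point_layers =
  fixes q :: "nat \<Rightarrow> (real \<times> real) measure" and \<Lambda> C :: "nat \<Rightarrow> real"
  assumes layers: "\<And>k. point_layer (q k) (\<Lambda> k) (C k)"
    and small: "\<And>T. \<forall>\<^sub>F k in sequentially. (AE p in q k. fst p \<in> {0<..real T} \<longrightarrow> \<bar>snd p\<bar> \<le> 1) \<and>
          \<Lambda> k * (\<integral>p. (snd p)\<^sup>2 * indicator {0<..real T} (fst p) \<partial>q k) \<le> (1/8) ^ k"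
begin

sublocale L: point_layer "q k" "\<Lambda> k" "C k" for k by (rule layers)

definition clouds :: "(nat \<Rightarrow> nat \<times> (nat \<Rightarrow> real \<times> real)) measure" where
  "clouds = PiM UNIV (\<lambda>k. cloud (\<Lambda> k) (q k))"

sublocale clouds: prob_space clouds
  unfolding clouds_def by (intro prob_space_PiM L.cloud.prob_space_axioms)

lemma component_measurable: "(\<lambda>\<omega>. \<omega> k) \<in> clouds \<rightarrow>\<^sub>M cloud (\<Lambda> k) (q k)"
  unfolding clouds_def by measurable

lemma layer_component_measurable[measurable]: "(\<lambda>\<omega>. layer (\<Lambda> k) (q k) t (\<omega> k)) \<in> borel_measurable clouds"
  by (rule measurable_compose[OF component_measurable L.layer_measurable])

text \<open>Borel-Cantelli: the layer \<open>k\<close> exceeds its bound before the horizon with a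
  probability that is summable in \<open>k\<close>. Integer horizons keep the exceptional set
  null.\<close>

lemma AE_layers_small:
  "AE \<omega> in clouds. \<forall>T::nat. \<exists>K. \<forall>k\<ge>K. \<forall>t\<in>{0..real T}. \<bar>layer (\<Lambda> k) (q k) t (\<omega> k)\<bar> \<le> 2 * (1/2) ^ k"
  unfolding AE_all_countable
proof
  fix T :: nat
  \<comment> \<open>\<open>layer_sup_bound\<close> asks for a positive horizon, and \<open>T\<close>
    may be \<open>0\<close>.\<close>
  let ?T = "real (Suc T)"
  obtain K where K: "\<And>k. k \<ge> K \<Longrightarrow> AE p in q k. fst p \<in> {0<..?T} \<longrightarrow> \<bar>snd p\<bar> \<le> 1"
    "\<And>k. k \<ge> K \<Longrightarrow> \<Lambda> k * (\<integral>p. (snd p)\<^sup>2 * indicator {0<..?T} (fst p) \<partial>q k) \<le> (1/8) ^ k"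
    using small[of "Suc T"] unfolding eventually_sequentially by blast
  have "\<exists>B. B \<in> sets (cloud (\<Lambda> k) (q k)) \<and> (k \<ge> Suc K \<longrightarrow> L.cloud.prob k B \<le> 2 * (1/2) ^ k \<and>
      (\<forall>\<omega>\<in>space (cloud (\<Lambda> k) (q k)) - B. \<forall>t\<in>{0..?T}. \<bar>layer (\<Lambda> k) (q k) t \<omega>\<bar> \<le> 2 * (1/2) ^ k))" for k
  proof (cases "k \<ge> Suc K")
    case True
    have e: "(1/8) ^ k / ((1/2) ^ k)\<^sup>2 = (1/2 :: real) ^ k"
    proof -
      have "((1/2::real) ^ k)\<^sup>2 = (1/4) ^ k"
        by (simp add: power2_eq_square power_mult_distrib[symmetric])
      then show ?thesis by (simp add: power_divide[symmetric])
    qed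
    \<comment> \<open>\<open>layer_sup_bound\<close> wants a ratio of at most \<open>1/2\<close>,
      which fails for \<open>k = 0\<close>; this is why the layers are counted from
      \<open>Suc K\<close>.\<close>
    have "(1/2::real) ^ k \<le> (1/2) ^ 1" by (rule power_decreasing) (use True in auto)
    moreover have "k \<ge> K" using True by simp
    ultimately have "\<exists>B\<in>sets (cloud (\<Lambda> k) (q k)). L.cloud.prob k B \<le> 2 * ((1/8) ^ k / ((1/2) ^ k)\<^sup>2) \<and>
       (\<forall>\<omega>\<in>space (cloud (\<Lambda> k) (q k)) - B. \<forall>t\<in>{0..?T}. \<bar>layer (\<Lambda> k) (q k) t \<omega>\<bar> \<le> 2 * (1/2) ^ k)"
      by (intro L.layer_sup_bound K) (simp_all only: e, simp_all)
    then show ?thesis unfolding e by blast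
  qed auto
  then obtain B where B: "\<And>k. B k \<in> sets (cloud (\<Lambda> k) (q k))"
     "\<And>k. k \<ge> Suc K \<Longrightarrow> L.cloud.prob k (B k) \<le> 2 * (1/2) ^ k"
     "\<And>k \<omega> t. k \<ge> Suc K \<Longrightarrow> \<omega> \<in> space (cloud (\<Lambda> k) (q k)) - B k \<Longrightarrow> t \<in> {0..?T} \<Longrightarrow> \<bar>layer (\<Lambda> k) (q k) t \<omega>\<bar> \<le> 2 * (1/2) ^ k"
    by metis
  define D where "D k = (\<lambda>\<omega>. \<omega> k) -` B k \<inter> space clouds" for k
  have D: "D k \<in> sets clouds" for k
    unfolding D_def by (rule measurable_sets[OF component_measurable B(1)])
  have PD: "clouds.prob (D k) = L.cloud.prob k (B k)" for k
  proof -
    have "L.cloud.prob k (B k) = measure (distr clouds (cloud (\<Lambda> k) (q k)) (\<lambda>\<omega>. \<omega> k)) (B k)"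
      unfolding clouds_def by (subst distr_PiM_component) (auto intro: L.cloud.prob_space_axioms)
    also have "\<dots> = clouds.prob (D k)"
      unfolding D_def by (rule measure_distr[OF component_measurable B(1)])
    finally show ?thesis ..
  qed
  have "AE \<omega> in clouds. eventually (\<lambda>k. \<omega> \<in> space clouds - D k) sequentially"
  proof (rule borel_cantelli_AE1)
    show "D k \<in> sets clouds" for k by (rule D)
    show "summable (\<lambda>k. clouds.prob (D k))"
    proof (rule summable_comparison_test[where g="\<lambda>k. 2 * (1/2::real)^k"])
      show "\<exists>N. \<forall>n\<ge>N. norm (clouds.prob (D n)) \<le> 2 * (1/2) ^ n"
        using B(2) by (auto simp: PD)
      show "summable (\<lambda>k. 2 * (1/2::real)^k)" by (intro summable_mult summable_geometric) auto
    qed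
  qed (simp add: clouds.emeasure_eq_measure)
  then show "AE \<omega> in clouds. \<exists>K. \<forall>k\<ge>K. \<forall>t\<in>{0..real T}. \<bar>layer (\<Lambda> k) (q k) t (\<omega> k)\<bar> \<le> 2 * (1/2) ^ k"
  proof eventually_elim
    case (elim \<omega>)
    then obtain K' where K': "\<And>k. k \<ge> K' \<Longrightarrow> \<omega> \<in> space clouds - D k" by (auto simp: eventually_sequentially)
    have "\<bar>layer (\<Lambda> k) (q k) t (\<omega> k)\<bar> \<le> 2 * (1/2) ^ k" if "k \<ge> max K' (Suc K)" "t \<in> {0..real T}" for k t
    proof (rule B(3))
      show "\<omega> k \<in> space (cloud (\<Lambda> k) (q k)) - B k"
        using K'[of k] that measurable_space[OF component_measurable, of \<omega> k] by (auto simp: D_def)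
    qed (use that in auto)
    then show ?case by blast
  qed
qed

text \<open>The layers are summed on the almost sure event of \<open>AE_layers_small\<close>, where
  \<open>cadlag_suminf\<close> applies. Independence of the layers makes the joint characteristic
  function a limit of products of exponentials, so its exponent is the sum \<open>A\<close> of a
  series, whose value depends on how the layers exhaust the intensity.\<close>

lemma exists_cadlag_process:
  "\<exists>X. (\<forall>t. X t \<in> borel_measurable clouds) \<and> (\<forall>\<omega>. cadlag (\<lambda>t. X t \<omega>)) \<and> (\<forall>\<omega>. X 0 \<omega> = 0) \<and>
    (\<forall>n t \<theta> A. t 0 = 0 \<longrightarrow> (\<forall>i<n. t i < t (Suc i)) \<longrightarrow>
       (\<lambda>k. of_real (\<Lambda> k) * (\<Sum>j<n. \<integral>p. indicator {t j<..t (Suc j)} (fst p) *\<^sub>R levy_integrand (\<theta> j) (snd p) \<partial>q k)) sums A \<longrightarrow>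
       (\<integral>\<omega>. iexp (\<Sum>j<n. \<theta> j * (X (t (Suc j)) \<omega> - X (t j) \<omega>)) \<partial>clouds) = exp A)"
proof -
  obtain N where N: "{\<omega>\<in>space clouds. \<not> (\<forall>T::nat. \<exists>K. \<forall>k\<ge>K. \<forall>t\<in>{0..real T}. \<bar>layer (\<Lambda> k) (q k) t (\<omega> k)\<bar> \<le> 2 * (1/2) ^ k)} \<subseteq> N"
    and N0: "N \<in> null_sets clouds"
    using AE_layers_small by (auto simp: eventually_ae_filter)
  define G where "G = space clouds - N"
  have [measurable]: "G \<in> sets clouds" using N0 by (auto simp: G_def)
  have G: "\<exists>K. \<forall>k\<ge>K. \<forall>t\<in>{0..T}. \<bar>layer (\<Lambda> k) (q k) t (\<omega> k)\<bar> \<le> 2 * (1/2) ^ k" if "\<omega> \<in> G" for \<omega> T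
  proof -
    have "\<forall>T::nat. \<exists>K. \<forall>k\<ge>K. \<forall>t\<in>{0..real T}. \<bar>layer (\<Lambda> k) (q k) t (\<omega> k)\<bar> \<le> 2 * (1/2) ^ k"
      using that N unfolding G_def by blast
    from spec[OF this, of "nat \<lceil>T\<rceil>"]
    obtain K where "\<forall>k\<ge>K. \<forall>t\<in>{0..real (nat \<lceil>T\<rceil>)}. \<bar>layer (\<Lambda> k) (q k) t (\<omega> k)\<bar> \<le> 2 * (1/2) ^ k" ..
    then have "\<forall>k\<ge>K. \<forall>t\<in>{0..T}. \<bar>layer (\<Lambda> k) (q k) t (\<omega> k)\<bar> \<le> 2 * (1/2) ^ k"
      using le_of_int_ceiling[of T] by (metis atLeastAtMost_iff order_trans real_nat_ceiling_ge)
    then show ?thesis by blast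
  qed
  have AEG: "AE \<omega> in clouds. \<omega> \<in> G"
    using AE_not_in[OF N0] by (rule AE_mp) (auto simp: G_def)
  have sm: "summable (\<lambda>k. 2 * (1/2::real)^k)" by (intro summable_mult summable_geometric) auto
  \<comment> \<open>Every path has to be cadlag and to start at \<open>0\<close>, not only almost
    every one; the exceptional paths are replaced by the zero path.\<close>
  define X where "X t \<omega> = (if \<omega> \<in> G then (\<Sum>k. layer (\<Lambda> k) (q k) t (\<omega> k)) else 0)" for t \<omega>
  have Xm[measurable]: "X t \<in> borel_measurable clouds" for t unfolding X_def by measurable
  have Xc: "cadlag (\<lambda>t. X t \<omega>)" for \<omega>
  proof (cases "\<omega> \<in> G")
    case True
    then show ?thesis
      unfolding X_def using cadlag_suminf(1)[where J="\<lambda>k t. layer (\<Lambda> k) (q k) t (\<omega> k)", OF L.cadlag_layer sm G[OF True]] by simp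
  qed (simp add: X_def cadlag_continuous)
  have lim: "(\<lambda>n. \<Sum>k<n. layer (\<Lambda> k) (q k) t (\<omega> k)) \<longlonglongrightarrow> X t \<omega>" if "\<omega> \<in> G" "t \<ge> 0" for t \<omega>
    using cadlag_suminf(2)[where J="\<lambda>k t. layer (\<Lambda> k) (q k) t (\<omega> k)", OF L.cadlag_layer sm G[OF that(1)] that(2)] that(1)
    by (simp add: X_def summable_LIMSEQ)
  have "(\<integral>\<omega>. iexp (\<Sum>j<n. \<theta> j * (X (t (Suc j)) \<omega> - X (t j) \<omega>)) \<partial>clouds) = exp A"
    if t: "t 0 = 0" "\<And>i. i < n \<Longrightarrow> t i < t (Suc i)" and
       A: "(\<lambda>k. of_real (\<Lambda> k) * (\<Sum>j<n. \<integral>p. indicator {t j<..t (Suc j)} (fst p) *\<^sub>R levy_integrand (\<theta> j) (snd p) \<partial>q k)) sums A"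
    for n t \<theta> A
  proof -
    define W where "W k \<omega> = (\<Sum>j<n. \<theta> j * (layer (\<Lambda> k) (q k) (t (Suc j)) \<omega> - layer (\<Lambda> k) (q k) (t j) \<omega>))" for k \<omega>
    have Wm[measurable]: "W k \<in> borel_measurable (cloud (\<Lambda> k) (q k))" for k unfolding W_def by measurable
    have Wc[measurable]: "(\<lambda>\<omega>. W k (\<omega> k)) \<in> borel_measurable clouds" for k
      by (rule measurable_compose[OF component_measurable Wm])
    have tm: "t i \<ge> 0" if "i \<le> n" for i
      using that
    proof (induction i)
      case (Suc i)
      then show ?case using t(2)[of i] by simp
    qed (simp add: t)
    have "(\<lambda>m. \<integral>\<omega>. iexp (\<Sum>k<m. W k (\<omega> k)) \<partial>clouds) \<longlonglongrightarrow> (\<integral>\<omega>. iexp (\<Sum>j<n. \<theta> j * (X (t (Suc j)) \<omega> - X (t j) \<omega>)) \<partial>clouds)"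
    proof (rule integral_dominated_convergence[where w="\<lambda>_. 1"])
      show "AE \<omega> in clouds. (\<lambda>m. iexp (\<Sum>k<m. W k (\<omega> k))) \<longlonglongrightarrow> iexp (\<Sum>j<n. \<theta> j * (X (t (Suc j)) \<omega> - X (t j) \<omega>))"
        using AEG
      proof eventually_elim
        case (elim \<omega>)
        have "(\<lambda>m. \<Sum>j<n. \<theta> j * ((\<Sum>k<m. layer (\<Lambda> k) (q k) (t (Suc j)) (\<omega> k)) - (\<Sum>k<m. layer (\<Lambda> k) (q k) (t j) (\<omega> k)))) \<longlonglongrightarrow> (\<Sum>j<n. \<theta> j * (X (t (Suc j)) \<omega> - X (t j) \<omega>))"
          by (intro tendsto_intros lim elim tm) auto
        moreover have "(\<lambda>m. \<Sum>j<n. \<theta> j * ((\<Sum>k<m. layer (\<Lambda> k) (q k) (t (Suc j)) (\<omega> k)) - (\<Sum>k<m. layer (\<Lambda> k) (q k) (t j) (\<omega> k)))) = (\<lambda>m. \<Sum>k<m. W k (\<omega> k))"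
          unfolding W_def by (subst sum.swap) (simp only: sum_subtractf[symmetric] sum_distrib_left)
        ultimately show ?case by (intro tendsto_intros) simp
      qed
    qed auto
    moreover have "(\<integral>\<omega>. iexp (\<Sum>k<m. W k (\<omega> k)) \<partial>clouds) = exp (\<Sum>k<m. of_real (\<Lambda> k) * (\<Sum>j<n. \<integral>p. indicator {t j<..t (Suc j)} (fst p) *\<^sub>R levy_integrand (\<theta> j) (snd p) \<partial>q k))" for m
    proof -
      have "(\<integral>\<omega>. iexp (\<Sum>k<m. W k (\<omega> k)) \<partial>clouds) = (\<integral>\<omega>. (\<Prod>k<m. iexp (W k (\<omega> k))) \<partial>clouds)"
        by (simp add: exp_sum sum_distrib_left)
      also have "\<dots> = (\<Prod>k<m. \<integral>\<omega>. iexp (W k \<omega>) \<partial>cloud (\<Lambda> k) (q k))"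
        unfolding clouds_def
      proof (rule integral_PiM_prod)
        show "integrable (cloud (\<Lambda> k) (q k)) (\<lambda>\<omega>. iexp (W k \<omega>))" for k
          by (rule L.cloud.integrable_const_bound[where B=1]) auto
      qed (rule L.cloud.prob_space_axioms)
      also have "\<dots> = (\<Prod>k<m. exp (of_real (\<Lambda> k) * (\<Sum>j<n. \<integral>p. indicator {t j<..t (Suc j)} (fst p) *\<^sub>R levy_integrand (\<theta> j) (snd p) \<partial>q k)))"
        unfolding W_def by (intro prod.cong refl L.layer_joint_char) (use t in \<open>auto intro: less_imp_le\<close>)
      finally show ?thesis by (simp add: exp_sum)
    qed
    moreover have "(\<lambda>m. exp (\<Sum>k<m. of_real (\<Lambda> k) * (\<Sum>j<n. \<integral>p. indicator {t j<..t (Suc j)} (fst p) *\<^sub>R levy_integrand (\<theta> j) (snd p) \<partial>q k))) \<longlonglongrightarrow> exp A"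
      using A unfolding sums_def by (rule tendsto_exp)
    ultimately show ?thesis by (simp add: LIMSEQ_unique)
  qed
  then show ?thesis using Xm Xc by (intro exI[of _ X]) (auto simp: X_def)
qed

end

section \<open>Existence of the Levy process\<close>

lemma levy_measure_sets: "levy_measure \<nu> \<Longrightarrow> sets \<nu> = sets borel"
  by (simp add: levy_measure_def)

lemma levy_measure_tail_finite:
  assumes "levy_measure \<nu>" "c > 0"
  shows "emeasure \<nu> {x. \<bar>x\<bar> > c} < \<infinity>"
proof -
  note [measurable_cong] = levy_measure_sets[OF assms(1)]
  have [measurable]: "{x. \<bar>x\<bar> > c} \<in> sets \<nu>"
    using levy_measure_sets[OF assms(1)] by simp
  define d where "d = min 1 (c\<^sup>2)"
  have d: "d > 0" using assms by (simp add: d_def)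
  have "ennreal d * emeasure \<nu> {x. \<bar>x\<bar> > c} = (\<integral>\<^sup>+x. ennreal d * indicator {x. \<bar>x\<bar> > c} x \<partial>\<nu>)"
    by (rule nn_integral_cmult_indicator[symmetric]) simp
  also have "\<dots> \<le> (\<integral>\<^sup>+x. ennreal (min 1 (x\<^sup>2)) \<partial>\<nu>)"
  proof (rule nn_integral_mono)
    fix x :: real
    show "ennreal d * indicator {x. \<bar>x\<bar> > c} x \<le> ennreal (min 1 (x\<^sup>2))"
    proof (cases "\<bar>x\<bar> > c")
      case True
      then have "c\<^sup>2 \<le> x\<^sup>2" using assms(2) by (metis abs_le_square_iff abs_of_pos less_imp_le)
      then show ?thesis using True by (auto simp: d_def intro!: ennreal_leI)
    qed simp
  qed
  also have "\<dots> < \<infinity>" using assms by (simp add: levy_measure_def)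
  finally show ?thesis using d by (auto simp: ennreal_mult_less_top less_top)
qed

lemma levy_measure_sigma_finite:
  assumes "levy_measure \<nu>"
  shows "sigma_finite_measure \<nu>"
proof (rule sigma_finite_measure.intro, rule exI[of _ "insert {0} (range (\<lambda>n. {x. \<bar>x\<bar> > 1 / real (Suc n)}))"], intro conjI ballI)
  have sp: "space \<nu> = UNIV" using sets_eq_imp_space_eq[OF levy_measure_sets[OF assms(1)]] by simp
  have "x \<in> \<Union> (insert {0} (range (\<lambda>n. {x. \<bar>x\<bar> > 1 / real (Suc n)})))" for x :: real
  proof (cases "x = 0")
    case False
    then obtain n where "1 / real (Suc n) < \<bar>x\<bar>" using reals_Archimedean[of "\<bar>x\<bar>"] by (auto simp: inverse_eq_divide)
    then show ?thesis by blast
  qed simp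
  then show "\<Union> (insert {0} (range (\<lambda>n. {x. \<bar>x\<bar> > 1 / real (Suc n)}))) = space \<nu>" by (auto simp: sp)
  fix a assume "a \<in> insert {0} (range (\<lambda>n. {x. \<bar>x\<bar> > 1 / real (Suc n)}))"
  then show "emeasure \<nu> a \<noteq> \<infinity>"
  proof (elim insertE rangeE)
    fix n assume "a = {x. \<bar>x\<bar> > 1 / real (Suc n)}"
    then show ?thesis using levy_measure_tail_finite[OF assms, of "1 / real (Suc n)"] by auto
  qed (use assms in \<open>simp_all add: levy_measure_def\<close>)
next
  show "countable (insert {0::real} (range (\<lambda>n. {x. \<bar>x\<bar> > 1 / real (Suc n)})))" by simp
  show "insert {0} (range (\<lambda>n. {x. \<bar>x\<bar> > 1 / real (Suc n)})) \<subseteq> sets \<nu>"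
    unfolding levy_measure_sets[OF assms] by (intro insert_subsetI image_subsetI) simp_all
qed

lemma levy_integrand_le_min: "cmod (levy_integrand \<theta> x) \<le> (\<theta>\<^sup>2 + 2 + \<bar>\<theta>\<bar>) * min 1 (x\<^sup>2)"
proof (cases "\<bar>x\<bar> \<le> 1")
  case True
  then have "cmod (levy_integrand \<theta> x) \<le> \<theta>\<^sup>2 * x\<^sup>2 / 2" by (rule levy_integrand_le_square)
  also have "\<dots> = (\<theta>\<^sup>2 / 2) * x\<^sup>2" by simp
  also have "\<dots> \<le> (\<theta>\<^sup>2 + 2 + \<bar>\<theta>\<bar>) * x\<^sup>2" by (rule mult_right_mono) auto
  also have "x\<^sup>2 = min 1 (x\<^sup>2)" using True abs_square_le_1[of x] by simp
  finally show ?thesis .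
next
  case False
  then have "1 \<le> x\<^sup>2" using one_le_power[of "\<bar>x\<bar>" 2] by simp
  then have "min 1 (x\<^sup>2) = 1" by simp
  then show ?thesis using levy_integrand_le[of \<theta> x] zero_le_power2[of \<theta>]
    by (simp only: mult_1_right)
qed

lemma levy_integrand_integrable:
  assumes "levy_measure \<nu>"
  shows "integrable \<nu> (levy_integrand \<theta>)"
proof (rule Bochner_Integration.integrable_bound)
  note [measurable_cong] = levy_measure_sets[OF assms(1)]
  have "integrable \<nu> (\<lambda>x. min 1 (x\<^sup>2))"
    using assms by (intro integrableI_nonneg) (auto simp: levy_measure_def)
  then show "integrable \<nu> (\<lambda>x. (\<theta>\<^sup>2 + 2 + \<bar>\<theta>\<bar>) * min 1 (x\<^sup>2))" by simp
  show "AE x in \<nu>. cmod (levy_integrand \<theta> x) \<le> norm ((\<theta>\<^sup>2 + 2 + \<bar>\<theta>\<bar>) * min 1 (x\<^sup>2))"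
    using levy_integrand_le_min by (intro AE_I2) (auto intro: order_trans[OF _ abs_ge_self])
  show "levy_integrand \<theta> \<in> borel_measurable \<nu>" by measurable
qed

lemma levy_measure_small_jumps:
  assumes "levy_measure \<nu>" "\<epsilon> > 0" "\<delta> > 0"
  shows "\<exists>c>0. c \<le> \<epsilon> \<and> (\<integral>\<^sup>+x. ennreal (x\<^sup>2) * indicator {x. \<bar>x\<bar> \<le> c} x \<partial>\<nu>) \<le> ennreal \<delta>"
proof -
  note [measurable_cong] = levy_measure_sets[OF assms(1)]
  have "(\<lambda>n. \<integral>\<^sup>+x. ennreal (x\<^sup>2) * indicator {x. \<bar>x\<bar> \<le> 1 / real (Suc n)} x \<partial>\<nu>) \<longlonglongrightarrow> (\<integral>\<^sup>+x. 0 \<partial>\<nu>)"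
  proof (rule nn_integral_dominated_convergence[where w="\<lambda>x. ennreal (min 1 (x\<^sup>2))"])
    show "AE x in \<nu>. ennreal (x\<^sup>2) * indicator {x. \<bar>x\<bar> \<le> 1 / real (Suc n)} x \<le> ennreal (min 1 (x\<^sup>2))" for n
    proof (rule AE_I2)
      fix x :: real
      show "ennreal (x\<^sup>2) * indicator {x. \<bar>x\<bar> \<le> 1 / real (Suc n)} x \<le> ennreal (min 1 (x\<^sup>2))"
      proof (cases "\<bar>x\<bar> \<le> 1 / real (Suc n)")
        case True
        then have "\<bar>x\<bar> \<le> 1" by (rule order_trans) simp
        then show ?thesis using abs_square_le_1[of x] by (auto simp: min_def indicator_def)
      qed simp
    qed
    show "AE x in \<nu>. (\<lambda>n. ennreal (x\<^sup>2) * indicator {x. \<bar>x\<bar> \<le> 1 / real (Suc n)} x) \<longlonglongrightarrow> 0"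
    proof (rule AE_I2)
      fix x :: real
      show "(\<lambda>n. ennreal (x\<^sup>2) * indicator {x. \<bar>x\<bar> \<le> 1 / real (Suc n)} x) \<longlonglongrightarrow> 0"
      proof (cases "x = 0")
        case False
        then obtain n where n: "1 / real (Suc n) < \<bar>x\<bar>" using reals_Archimedean[of "\<bar>x\<bar>"] by (auto simp: inverse_eq_divide)
        have "ennreal (x\<^sup>2) * indicator {x. \<bar>x\<bar> \<le> 1 / real (Suc m)} x = 0" if "m \<ge> n" for m
        proof -
          have "1 / real (Suc m) \<le> 1 / real (Suc n)" using that by (intro divide_left_mono) auto
          then show ?thesis using n by simp
        qed
        then show ?thesis by (intro tendsto_eventually) (auto simp: eventually_sequentially)
      qed simp
    qed
  qed (use assms in \<open>auto simp: levy_measure_def\<close>)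
  then have "(\<lambda>n. \<integral>\<^sup>+x. ennreal (x\<^sup>2) * indicator {x. \<bar>x\<bar> \<le> 1 / real (Suc n)} x \<partial>\<nu>) \<longlonglongrightarrow> 0" by simp
  then have "\<forall>\<^sub>F n in sequentially. (\<integral>\<^sup>+x. ennreal (x\<^sup>2) * indicator {x. \<bar>x\<bar> \<le> 1 / real (Suc n)} x \<partial>\<nu>) < ennreal \<delta>"
    by (rule order_tendstoD) (use assms in simp)
  moreover have "\<forall>\<^sub>F n in sequentially. 1 / real (Suc n) < \<epsilon>"
    by (rule order_tendstoD(2)[OF LIMSEQ_Suc[OF lim_1_over_n] \<open>\<epsilon> > 0\<close>])
  ultimately have "\<forall>\<^sub>F n in sequentially. (\<integral>\<^sup>+x. ennreal (x\<^sup>2) * indicator {x. \<bar>x\<bar> \<le> 1 / real (Suc n)} x \<partial>\<nu>) < ennreal \<delta> \<and> 1 / real (Suc n) < \<epsilon>"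
    by eventually_elim simp
  then obtain n where "(\<integral>\<^sup>+x. ennreal (x\<^sup>2) * indicator {x. \<bar>x\<bar> \<le> 1 / real (Suc n)} x \<partial>\<nu>) < ennreal \<delta> \<and> 1 / real (Suc n) < \<epsilon>"
    by (auto simp: eventually_sequentially)
  then show ?thesis by (intro exI[of _ "1 / real (Suc n)"]) auto
qed

text \<open>The bound \<open>(1/16) ^ n\<close> leaves room for a time horizon:
  \<open>real T * (1/16) ^ n\<close> is at most \<open>(1/8) ^ n\<close> once
  \<open>T \<le> n\<close>, because \<open>real n \<le> 2 ^ n\<close>.\<close>

lemma levy_cutoffs:
  assumes "levy_measure \<nu>"
  obtains c :: "nat \<Rightarrow> real" where "\<And>n. c n > 0" "\<And>n. c n \<le> 1 / real (Suc n)" "\<And>n. c (Suc n) \<le> c n"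
    "\<And>n. (\<integral>\<^sup>+x. ennreal (x\<^sup>2) * indicator {x. \<bar>x\<bar> \<le> c n} x \<partial>\<nu>) \<le> ennreal ((1/16) ^ n)"
proof -
  define P where "P n c \<longleftrightarrow> c > 0 \<and> c \<le> 1 / real (Suc n) \<and> (\<integral>\<^sup>+x. ennreal (x\<^sup>2) * indicator {x. \<bar>x\<bar> \<le> c} x \<partial>\<nu>) \<le> ennreal ((1/16) ^ n)" for n and c :: real
  have "\<exists>c. \<forall>n. P n (c n) \<and> c (Suc n) \<le> c n"
  proof (rule dependent_nat_choice)
    show "\<exists>x. P 0 x" using levy_measure_small_jumps[OF assms, of 1 1] by (auto simp: P_def)
  next
    fix x n assume "P n x"
    then have "min x (1 / real (Suc (Suc n))) > 0" by (simp add: P_def)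
    from levy_measure_small_jumps[OF assms this, of "(1/16) ^ Suc n"]
    show "\<exists>y. P (Suc n) y \<and> y \<le> x" by (auto simp: P_def)
  qed
  then show ?thesis using that unfolding P_def by blast
qed

text \<open>Off the null set of points with mark \<open>0\<close>, the regions
  \<open>{0<..n} \<times> {x. \<bar>x\<bar> > c n}\<close> exhaust \<open>{0<..} \<times> UNIV\<close>; the layers carry their successive differences.\<close>

locale levy_layers =
  fixes \<nu> :: "real measure" and c :: "nat \<Rightarrow> real"
  assumes levy: "levy_measure \<nu>"
    and c0: "\<And>n. c n > 0" and c1: "\<And>n. c n \<le> 1 / real (Suc n)" and c_dec: "\<And>n. c (Suc n) \<le> c n"
    and c_small: "\<And>n. (\<integral>\<^sup>+x. ennreal (x\<^sup>2) * indicator {x. \<bar>x\<bar> \<le> c n} x \<partial>\<nu>) \<le> ennreal ((1/16) ^ n)"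
begin

sublocale sigma_finite_measure \<nu> by (rule levy_measure_sigma_finite[OF levy])
sublocale pair_sigma_finite lborel \<nu> ..

lemma sets_nu[measurable_cong]: "sets \<nu> = sets borel" by (rule levy_measure_sets[OF levy])

lemma space_nu[simp]: "space \<nu> = UNIV" using sets_eq_imp_space_eq[OF sets_nu] by simp

definition m :: "(real \<times> real) measure" where "m = lborel \<Otimes>\<^sub>M \<nu>"

lemma sets_m[measurable_cong]: "sets m = sets borel"
  unfolding m_def borel_prod[symmetric] by (rule sets_pair_measure_cong[OF sets_lborel sets_nu])

lemma measurable_fst_snd_borel[measurable]:
  "fst \<in> borel_measurable (borel :: (real \<times> real) measure)"
  "snd \<in> borel_measurable (borel :: (real \<times> real) measure)"
  unfolding borel_prod[symmetric] by simp_all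

lemma emeasure_m_Times: "A \<in> sets borel \<Longrightarrow> B \<in> sets borel \<Longrightarrow> emeasure m (A \<times> B) = emeasure lborel A * emeasure \<nu> B"
  unfolding m_def by (rule sigma_finite_measure.emeasure_pair_measure_Times[OF levy_measure_sigma_finite[OF levy]]) (auto simp: sets_nu)

lemma space_m[simp]: "space m = UNIV" using sets_eq_imp_space_eq[OF sets_m] by simp

definition tail :: "nat \<Rightarrow> real set" where "tail n = {x. \<bar>x\<bar> > c n}"
definition E :: "nat \<Rightarrow> (real \<times> real) set" where "E n = {0<..real n} \<times> tail n"
definition D :: "nat \<Rightarrow> (real \<times> real) set" where "D n = E (Suc n) - E n"
definition rate :: "nat \<Rightarrow> real" where "rate n = measure m (D n)"
text \<open>A layer of rate \<open>0\<close> still needs a probability law for its points. The point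
  \<open>(0, 0)\<close> has time \<open>0\<close> and hence lies in none of the intervals
  \<open>{0<..t}\<close>.\<close>

definition q :: "nat \<Rightarrow> (real \<times> real) measure" where
  "q n = (if rate n > 0 then uniform_measure m (D n) else return borel (0, 0))"

lemma tail_sets[measurable]: "tail n \<in> sets borel" "tail n \<in> sets \<nu>"
  unfolding sets_nu by (simp_all add: tail_def)

lemma tail_finite: "emeasure \<nu> (tail n) < \<infinity>"
  unfolding tail_def by (rule levy_measure_tail_finite[OF levy c0])

lemma E_sets[measurable]: "E n \<in> sets m" unfolding E_def sets_m by (intro borel_Times) auto
lemma D_sets[measurable]: "D n \<in> sets m" unfolding D_def by measurable

lemma E_mono: "E n \<subseteq> E (Suc n)"
  using c_dec[of n] by (auto simp: E_def tail_def)

lemma emeasure_E: "emeasure m (E n) < \<infinity>"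
proof -
  have "emeasure m (E n) = emeasure lborel {0<..real n} * emeasure \<nu> (tail n)"
    unfolding E_def by (rule emeasure_m_Times) auto
  also have "\<dots> < \<infinity>" using tail_finite[of n] by (simp add: ennreal_mult_less_top)
  finally show ?thesis .
qed

lemma emeasure_D: "emeasure m (D n) < \<infinity>"
  by (rule le_less_trans[OF emeasure_mono emeasure_E[of "Suc n"]]) (auto simp: D_def)

lemma rate_nonneg: "rate n \<ge> 0" by (simp add: rate_def)

lemma emeasure_D_eq: "emeasure m (D n) = ennreal (rate n)"
  unfolding rate_def using emeasure_D[of n] by (intro emeasure_eq_ennreal_measure) auto

lemma sets_q: "sets (q n) = sets borel"
  by (simp add: q_def sets_m)

lemma prob_q: "prob_space (q n)"
proof (cases "rate n > 0")
  case True
  then show ?thesis unfolding q_def using emeasure_D[of n]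
    by (simp add: prob_space_uniform_measure emeasure_D_eq)
next
  case False
  then show ?thesis unfolding q_def by (simp add: prob_space_return)
qed

lemma rate_times_integral:
  fixes f :: "real \<times> real \<Rightarrow> 'b::{banach, second_countable_topology}"
  assumes [measurable]: "f \<in> borel_measurable m"
  shows "rate n *\<^sub>R (\<integral>p. f p \<partial>q n) = (\<integral>p. indicator (D n) p *\<^sub>R f p \<partial>m)"
proof (cases "rate n > 0")
  case True
  have "(\<integral>p. f p \<partial>q n) = (\<integral>p. f p \<partial>density m (\<lambda>p. ennreal (indicator (D n) p / rate n)))"
    unfolding q_def uniform_measure_def using True
    by (simp add: emeasure_D_eq divide_ennreal[symmetric] ennreal_indicator)
  also have "\<dots> = (\<integral>p. (indicator (D n) p / rate n) *\<^sub>R f p \<partial>m)"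
    by (rule integral_density) (use True in auto)
  also have "\<dots> = (\<integral>p. (1 / rate n) *\<^sub>R (indicator (D n) p *\<^sub>R f p) \<partial>m)"
    by (intro Bochner_Integration.integral_cong) auto
  also have "\<dots> = (1 / rate n) *\<^sub>R (\<integral>p. indicator (D n) p *\<^sub>R f p \<partial>m)"
    by (rule integral_scaleR_right)
  finally show ?thesis using True by simp
next
  case False
  then have r: "rate n = 0" using rate_nonneg[of n] by simp
  then have "D n \<in> null_sets m" using emeasure_D_eq[of n] by (simp add: null_setsI)
  then have "AE p in m. indicator (D n) p *\<^sub>R f p = 0"
    using AE_not_in[of "D n" m] by (auto elim: eventually_mono simp: indicator_def)
  then have "(\<integral>p. indicator (D n) p *\<^sub>R f p \<partial>m) = (\<integral>p. 0 \<partial>m)"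
    by (intro integral_cong_AE) auto
  then show ?thesis using r by simp
qed

lemma q_support: "AE p in q n. rate n > 0 \<longrightarrow> p \<in> D n"
proof (cases "rate n > 0")
  case True
  then have "q n = uniform_measure m (D n)" by (simp add: q_def)
  then have "AE p in q n. p \<in> D n"
    by (simp only:) (rule AE_uniform_measureI; simp)
  then show ?thesis by (rule eventually_mono) simp
qed simp

text \<open>A point of \<open>D n\<close> whose time is at most \<open>n\<close> can be outside
  \<open>E n\<close> only because its jump is at most \<open>c n\<close>. The default point at rate
  \<open>0\<close> has no positive time.\<close>

lemma q_support_small: "T \<le> n \<Longrightarrow> AE p in q n. fst p \<in> {0<..real T} \<longrightarrow> \<bar>snd p\<bar> \<le> c n"
proof (cases "rate n > 0")
  case True
  assume "T \<le> n"
  with q_support[of n] show ?thesis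
    by (elim eventually_mono) (use True in \<open>auto simp: D_def E_def tail_def not_less intro: order_trans\<close>)
next
  case False
  have "AE p in return borel (0::real, 0::real). fst p \<in> {0<..real T} \<longrightarrow> \<bar>snd p\<bar> \<le> c n"
    by (subst AE_return) auto
  moreover have "q n = return borel (0, 0)" using False by (simp add: q_def)
  ultimately show ?thesis by (simp only:)
qed

lemma point_layer_q: "point_layer (q n) (rate n) (measure \<nu> (tail (Suc n)))"
proof (intro point_layer.intro point_layer_axioms.intro)
  show "rate n * measure (q n) {p \<in> space (q n). s < fst p \<and> fst p \<le> t} \<le> measure \<nu> (tail (Suc n)) * (t - s)"
    if "s \<le> t" for s t
  proof -
    have sp: "space (q n) = UNIV" using sets_eq_imp_space_eq[OF sets_q[of n]] by simp
    have mm: "{s<..t} \<times> UNIV \<in> sets m" unfolding sets_m by (intro borel_Times) auto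
    have mq: "{s<..t} \<times> UNIV \<in> sets (q n)" using mm by (simp add: sets_q sets_m)
    interpret q: prob_space "q n" by (rule prob_q)
    have "{p \<in> space (q n). s < fst p \<and> fst p \<le> t} = {s<..t} \<times> UNIV" by (auto simp: sp)
    then have "rate n * measure (q n) {p \<in> space (q n). s < fst p \<and> fst p \<le> t} = rate n *\<^sub>R (\<integral>p. indicator ({s<..t} \<times> UNIV) p \<partial>q n)"
      using mq by simp
    also have "\<dots> = (\<integral>p. indicator (D n) p *\<^sub>R indicator ({s<..t} \<times> UNIV) p \<partial>m)"
      by (rule rate_times_integral) (use mm in simp)
    also have "\<dots> = (\<integral>p. indicator (D n \<inter> {s<..t} \<times> UNIV) p \<partial>m)"
      by (intro Bochner_Integration.integral_cong) (auto simp: indicator_def)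
    also have "\<dots> = measure m (D n \<inter> {s<..t} \<times> UNIV)" using mm by simp
    also have "\<dots> \<le> measure m ({s<..t} \<times> tail (Suc n))"
    proof (rule measure_mono_fmeasurable)
      show "D n \<inter> {s<..t} \<times> UNIV \<subseteq> {s<..t} \<times> tail (Suc n)" by (auto simp: D_def E_def)
      have "emeasure m ({s<..t} \<times> tail (Suc n)) = emeasure lborel {s<..t} * emeasure \<nu> (tail (Suc n))"
        by (rule emeasure_m_Times) auto
      also have "\<dots> < \<infinity>" using tail_finite[of "Suc n"] that by (simp add: ennreal_mult_less_top)
      finally show "{s<..t} \<times> tail (Suc n) \<in> fmeasurable m"
        by (intro fmeasurableI) (auto simp: sets_m intro!: borel_Times)
    qed (use mm in auto)
    also have "measure m ({s<..t} \<times> tail (Suc n)) = measure lborel {s<..t} * measure \<nu> (tail (Suc n))"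
      unfolding measure_def by (subst emeasure_m_Times) (auto simp: enn2real_mult)
    finally show ?thesis using that by (simp add: mult.commute)
  qed
qed (simp_all add: prob_q sets_q rate_nonneg)

lemma variance_small:
  assumes "T \<le> n"
  shows "rate n * (\<integral>p. (snd p)\<^sup>2 * indicator {0<..real T} (fst p) \<partial>q n) \<le> real T * (1/16) ^ n"
proof -
  \<comment> \<open>The extra indicator is \<open>1\<close> almost everywhere on the points that
    count. It allows the integral over \<open>D n\<close> to be enlarged to a full strip, where
    \<open>c_small\<close> applies.\<close>
  define f :: "real \<times> real \<Rightarrow> real" where "f p = (snd p)\<^sup>2 * indicator {0<..real T} (fst p) * indicator {x. \<bar>x\<bar> \<le> c n} (snd p)" for p
  have [measurable]: "f \<in> borel_measurable m" unfolding f_def by measurable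
  have fq[measurable]: "f \<in> borel_measurable (q n)" 
    using \<open>f \<in> borel_measurable m\<close> by (simp add: measurable_cong_sets[OF sets_q refl] measurable_cong_sets[OF sets_m refl])
  have gq: "(\<lambda>p. (snd p)\<^sup>2 * indicator {0<..real T} (fst p) :: real) \<in> borel_measurable (q n)"
    unfolding measurable_cong_sets[OF sets_q refl] by measurable
  have "(\<integral>p. (snd p)\<^sup>2 * indicator {0<..real T} (fst p) \<partial>q n) = (\<integral>p. f p \<partial>q n)"
  proof (rule integral_cong_AE[OF gq fq])
    show "AE p in q n. (snd p)\<^sup>2 * indicator {0<..real T} (fst p) = f p"
      using q_support_small[OF assms] by (elim eventually_mono) (auto simp: f_def indicator_def)
  qed
  then have "rate n * (\<integral>p. (snd p)\<^sup>2 * indicator {0<..real T} (fst p) \<partial>q n) = (\<integral>p. indicator (D n) p *\<^sub>R f p \<partial>m)"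
    using rate_times_integral[of f n] by simp
  also have "\<dots> = enn2real (\<integral>\<^sup>+p. ennreal (indicator (D n) p *\<^sub>R f p) \<partial>m)"
    by (rule integral_eq_nn_integral) (auto simp: f_def)
  also have "\<dots> \<le> real T * (1/16) ^ n"
  proof (rule enn2real_leI)
    have "(\<integral>\<^sup>+p. ennreal (indicator (D n) p *\<^sub>R f p) \<partial>m)
        \<le> (\<integral>\<^sup>+p. indicator {0<..real T} (fst p) * (ennreal ((snd p)\<^sup>2) * indicator {x. \<bar>x\<bar> \<le> c n} (snd p)) \<partial>m)"
      by (rule nn_integral_mono) (auto simp: f_def indicator_def)
    also have "\<dots> = (\<integral>\<^sup>+t. \<integral>\<^sup>+x. indicator {0<..real T} t * (ennreal (x\<^sup>2) * indicator {x. \<bar>x\<bar> \<le> c n} x) \<partial>\<nu> \<partial>lborel)"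
      unfolding m_def by (rule trans[OF sigma_finite_measure.nn_integral_fst[OF levy_measure_sigma_finite[OF levy], symmetric]]) simp_all
    also have "\<dots> = (\<integral>\<^sup>+t. (\<integral>\<^sup>+x. ennreal (x\<^sup>2) * indicator {x. \<bar>x\<bar> \<le> c n} x \<partial>\<nu>) * indicator {0<..real T} t \<partial>lborel)"
      by (subst nn_integral_cmult) (simp_all add: mult.commute)
    also have "\<dots> = (\<integral>\<^sup>+x. ennreal (x\<^sup>2) * indicator {x. \<bar>x\<bar> \<le> c n} x \<partial>\<nu>) * ennreal (real T)"
      by (subst nn_integral_cmult_indicator) auto
    also have "\<dots> \<le> ennreal ((1/16)^n) * ennreal (real T)"
      by (intro mult_right_mono c_small) simp
    also have "\<dots> = ennreal (real T * (1/16)^n)"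
      by (simp add: ennreal_mult[symmetric] mult.commute)
    finally show "(\<integral>\<^sup>+p. ennreal (indicator (D n) p *\<^sub>R f p) \<partial>m) \<le> ennreal (real T * (1/16)^n)" .
  qed simp
  finally show ?thesis .
qed

sublocale point_layers q rate "\<lambda>n. measure \<nu> (tail (Suc n))"
proof (rule point_layers.intro)
  show "point_layer (q n) (rate n) (measure \<nu> (tail (Suc n)))" for n by (rule point_layer_q)
  fix T
  show "\<forall>\<^sub>F k in sequentially. (AE p in q k. fst p \<in> {0<..real T} \<longrightarrow> \<bar>snd p\<bar> \<le> 1) \<and>
          rate k * (\<integral>p. (snd p)\<^sup>2 * indicator {0<..real T} (fst p) \<partial>q k) \<le> (1/8) ^ k"
    using eventually_ge_at_top[of T]
  proof eventually_elim
    case (elim k)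
    have "c k \<le> 1" by (rule order_trans[OF c1]) simp
    then have "AE p in q k. fst p \<in> {0<..real T} \<longrightarrow> \<bar>snd p\<bar> \<le> 1"
      using q_support_small[OF elim] by (elim eventually_mono) auto
    moreover have "real T * (1/16) ^ k \<le> 2 ^ k * (1/16) ^ k"
    proof (rule mult_right_mono)
      have "real T \<le> real k" using elim by simp
      also have "real k \<le> 2 ^ k" using less_exp[of k] by (metis less_imp_le of_nat_le_iff of_nat_numeral of_nat_power)
      finally show "real T \<le> 2 ^ k" .
    qed simp
    moreover have "2 ^ k * (1/16) ^ k = (1/8 :: real) ^ k"
      by (subst power_mult_distrib[symmetric]) simp
    ultimately show ?case using variance_small[OF elim] by simp
  qed
qed

lemma integrable_increment: "integrable m (\<lambda>p. indicator {s<..t} (fst p) *\<^sub>R levy_integrand \<theta> (snd p))"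
  and integral_increment: "s \<le> t \<Longrightarrow> (\<integral>p. indicator {s<..t} (fst p) *\<^sub>R levy_integrand \<theta> (snd p) \<partial>m) = of_real (t - s) * levy_exponent \<nu> \<theta>"
proof -
  let ?f = "\<lambda>p. indicator {s<..t} (fst p) *\<^sub>R levy_integrand \<theta> (snd p)"
  have i: "integrable \<nu> (levy_integrand \<theta>)" by (rule levy_integrand_integrable[OF levy])
  have fin: "emeasure lborel {s<..t} < \<infinity>"
    by (cases "s \<le> t") auto
  show int: "integrable m ?f"
    unfolding m_def
  proof (rule Fubini_integrable)
    show "?f \<in> borel_measurable (lborel \<Otimes>\<^sub>M \<nu>)" unfolding m_def[symmetric] by measurable
    have "integrable lborel (\<lambda>u. indicator {s<..t} u * (\<integral>y. norm (levy_integrand \<theta> y) \<partial>\<nu>))"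
      using fin by (intro integrable_mult_left integrable_real_indicator) auto
    then show "integrable lborel (\<lambda>x. \<integral>y. norm (?f (x, y)) \<partial>\<nu>)" by simp
    show "AE x in lborel. integrable \<nu> (\<lambda>y. ?f (x, y))" using i by simp
  qed
  assume "s \<le> t"
  have "(\<integral>p. ?f p \<partial>m) = (\<integral>u. \<integral>y. ?f (u, y) \<partial>\<nu> \<partial>lborel)"
    using integral_fst'[OF int[unfolded m_def]] by (simp add: m_def)
  also have "\<dots> = (\<integral>u. indicator {s<..t} u *\<^sub>R (\<integral>y. levy_integrand \<theta> y \<partial>\<nu>) \<partial>lborel)" by simp
  also have "\<dots> = measure lborel {s<..t} *\<^sub>R (\<integral>y. levy_integrand \<theta> y \<partial>\<nu>)"
    using fin \<open>s \<le> t\<close> by (subst integral_scaleR_left) auto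
  also have "\<dots> = of_real (t - s) * levy_exponent \<nu> \<theta>"
    using \<open>s \<le> t\<close> by (simp add: levy_exponent_def levy_integrand_def scaleR_conv_of_real)
  finally show "(\<integral>p. ?f p \<partial>m) = of_real (t - s) * levy_exponent \<nu> \<theta>" .
qed

text \<open>The integrals over the \<open>D k\<close> telescope to an integral over
  \<open>E N\<close>, and dominated convergence lets \<open>E N\<close> exhaust the half plane of
  positive times.\<close>

lemma layers_sum:
  assumes t: "t 0 = 0" "\<And>i. i < n \<Longrightarrow> t i < t (Suc i)"
  shows "(\<lambda>k. of_real (rate k) * (\<Sum>j<n. \<integral>p. indicator {t j<..t (Suc j)} (fst p) *\<^sub>R levy_integrand (\<theta> j) (snd p) \<partial>q k))
    sums (\<Sum>j<n. of_real (t (Suc j) - t j) * levy_exponent \<nu> (\<theta> j))"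
proof -
  define F where "F j p = indicator {t j<..t (Suc j)} (fst p) *\<^sub>R levy_integrand (\<theta> j) (snd p)" for j p
  have Fm[measurable]: "F j \<in> borel_measurable m" for j unfolding F_def by measurable
  have iF: "integrable m (F j)" for j unfolding F_def by (rule integrable_increment)
  have tm: "t i \<ge> 0" if "i \<le> n" for i
    using that
  proof (induction i)
    case (Suc i)
    then show ?case using t(2)[of i] by simp
  qed (simp add: t)
  have iD: "integrable m (\<lambda>p. indicator (D k) p *\<^sub>R F j p)" "integrable m (\<lambda>p. indicator (E k) p *\<^sub>R F j p)" for k j
    by (intro integrable_mult_indicator iF D_sets E_sets)+
  have "(\<lambda>k. \<integral>p. indicator (D k) p *\<^sub>R F j p \<partial>m) sums (of_real (t (Suc j) - t j) * levy_exponent \<nu> (\<theta> j))" if j: "j < n" for j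
    unfolding sums_def
  proof -
    have part: "(\<Sum>k<N. \<integral>p. indicator (D k) p *\<^sub>R F j p \<partial>m) = (\<integral>p. indicator (E N) p *\<^sub>R F j p \<partial>m)" for N
    proof (induction N)
      case 0
      have "E 0 = {}" by (simp add: E_def)
      then show ?case by simp
    next
      case (Suc N)
      have "(\<integral>p. indicator (E N) p *\<^sub>R F j p \<partial>m) + (\<integral>p. indicator (D N) p *\<^sub>R F j p \<partial>m) = (\<integral>p. indicator (E N) p *\<^sub>R F j p + indicator (D N) p *\<^sub>R F j p \<partial>m)"
        by (rule Bochner_Integration.integral_add[symmetric]) (rule iD)+
      also have "\<dots> = (\<integral>p. indicator (E (Suc N)) p *\<^sub>R F j p \<partial>m)"
        using E_mono[of N] by (intro Bochner_Integration.integral_cong) (auto simp: D_def indicator_def)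
      finally show ?case using Suc by simp
    qed
    have "(\<lambda>N. \<integral>p. indicator (E N) p *\<^sub>R F j p \<partial>m) \<longlonglongrightarrow> (\<integral>p. F j p \<partial>m)"
    proof (rule integral_dominated_convergence[where w="\<lambda>p. norm (F j p)"])
      show "AE p in m. (\<lambda>N. indicator (E N) p *\<^sub>R F j p) \<longlonglongrightarrow> F j p"
      proof (rule AE_I2)
        fix p :: "real \<times> real"
        show "(\<lambda>N. indicator (E N) p *\<^sub>R F j p) \<longlonglongrightarrow> F j p"
        \<comment> \<open>The sets \<open>E N\<close> never reach the marks equal to
          \<open>0\<close>, but \<open>levy_integrand\<close> vanishes there, so the limit is right
          at every point.\<close>
        proof (cases "fst p \<in> {t j<..t (Suc j)} \<and> snd p \<noteq> 0")
          case True
          obtain N1 where N1: "fst p \<le> real N1" using real_arch_simple by blast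
          obtain N2 where N2: "1 / real (Suc N2) < \<bar>snd p\<bar>"
            using reals_Archimedean[of "\<bar>snd p\<bar>"] True by (auto simp: inverse_eq_divide)
          have "p \<in> E N" if "N \<ge> max N1 N2" for N
          proof -
            have "c N \<le> 1 / real (Suc N2)"
              using that by (intro order_trans[OF c1] divide_left_mono) auto
            then show ?thesis
              using N1 N2 that True tm[of j] j by (cases p) (auto simp: E_def tail_def)
          qed
          then have "indicator (E N) p *\<^sub>R F j p = F j p" if "N \<ge> max N1 N2" for N using that by simp
          then show ?thesis by (intro tendsto_eventually) (auto simp: eventually_sequentially simp del: max.bounded_iff)
        next
          case False
          then have "F j p = 0" by (auto simp: F_def levy_integrand_def indicator_def)
          then show ?thesis by simp
        qed
      qed
    qed (use iF[of j] in \<open>auto simp: indicator_def\<close>)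
    also have "(\<integral>p. F j p \<partial>m) = of_real (t (Suc j) - t j) * levy_exponent \<nu> (\<theta> j)"
      unfolding F_def by (rule integral_increment) (use t(2)[OF j] in simp)
    finally show "(\<lambda>N. \<Sum>k<N. \<integral>p. indicator (D k) p *\<^sub>R F j p \<partial>m) \<longlonglongrightarrow> of_real (t (Suc j) - t j) * levy_exponent \<nu> (\<theta> j)"
      unfolding part .
  qed
  then have "(\<lambda>k. \<Sum>j<n. \<integral>p. indicator (D k) p *\<^sub>R F j p \<partial>m) sums (\<Sum>j<n. of_real (t (Suc j) - t j) * levy_exponent \<nu> (\<theta> j))"
    by (intro sums_sum) simp
  moreover have "of_real (rate k) * (\<Sum>j<n. \<integral>p. F j p \<partial>q k) = (\<Sum>j<n. \<integral>p. indicator (D k) p *\<^sub>R F j p \<partial>m)" for k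
    by (subst sum_distrib_left, rule sum.cong[OF refl], subst rate_times_integral[OF Fm, symmetric])
       (rule scaleR_conv_of_real[symmetric])
  ultimately show ?thesis unfolding F_def by simp
qed

lemma exists_levy_process:
  "\<exists>X. (\<forall>t. X t \<in> borel_measurable clouds) \<and> (\<forall>\<omega>. cadlag (\<lambda>t. X t \<omega>)) \<and> (\<forall>\<omega>. X 0 \<omega> = 0) \<and>
    (\<forall>n t \<theta>. t 0 = 0 \<longrightarrow> (\<forall>i<n. t i < t (Suc i)) \<longrightarrow>
       (\<integral>\<omega>. iexp (\<Sum>j<n. \<theta> j * (X (t (Suc j)) \<omega> - X (t j) \<omega>)) \<partial>clouds) =
       exp (\<Sum>j<n. of_real (t (Suc j) - t j) * levy_exponent \<nu> (\<theta> j)))"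
proof -
  from exists_cadlag_process obtain X where X: "(\<forall>t. X t \<in> borel_measurable clouds) \<and> (\<forall>\<omega>. cadlag (\<lambda>t. X t \<omega>)) \<and> (\<forall>\<omega>. X 0 \<omega> = 0) \<and>
    (\<forall>n t \<theta> A. t 0 = 0 \<longrightarrow> (\<forall>i<n. t i < t (Suc i)) \<longrightarrow>
       (\<lambda>k. of_real (rate k) * (\<Sum>j<n. \<integral>p. indicator {t j<..t (Suc j)} (fst p) *\<^sub>R levy_integrand (\<theta> j) (snd p) \<partial>q k)) sums A \<longrightarrow>
       (\<integral>\<omega>. iexp (\<Sum>j<n. \<theta> j * (X (t (Suc j)) \<omega> - X (t j) \<omega>)) \<partial>clouds) = exp A)"
    ..
  have "(\<integral>\<omega>. iexp (\<Sum>j<n. \<theta> j * (X (t (Suc j)) \<omega> - X (t j) \<omega>)) \<partial>clouds) =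
       exp (\<Sum>j<n. of_real (t (Suc j) - t j) * levy_exponent \<nu> (\<theta> j))"
    if t: "t 0 = 0" "\<forall>i<n. t i < t (Suc i)" for n t \<theta>
  proof -
    have "(\<lambda>k. of_real (rate k) * (\<Sum>j<n. \<integral>p. indicator {t j<..t (Suc j)} (fst p) *\<^sub>R levy_integrand (\<theta> j) (snd p) \<partial>q k))
      sums (\<Sum>j<n. of_real (t (Suc j) - t j) * levy_exponent \<nu> (\<theta> j))"
      by (rule layers_sum) (use t in auto)
    with X t show ?thesis by blast
  qed
  then have joint: "\<forall>n t \<theta>. t 0 = 0 \<longrightarrow> (\<forall>i<n. t i < t (Suc i)) \<longrightarrow>
      (\<integral>\<omega>. iexp (\<Sum>j<n. \<theta> j * (X (t (Suc j)) \<omega> - X (t j) \<omega>)) \<partial>clouds) =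
       exp (\<Sum>j<n. of_real (t (Suc j) - t j) * levy_exponent \<nu> (\<theta> j))"
    by (intro allI impI)
  show ?thesis
    by (rule exI[of _ X], intro conjI joint conjunct1[OF X] conjunct1[OF conjunct2[OF X]] conjunct1[OF conjunct2[OF conjunct2[OF X]]])
qed

end

section \<open>Coding by a real number\<close>

text \<open>A substitute for standard Borel spaces: \<open>M\<close> is a measurable retract of the
  line by a code in a bounded interval. The bound \<open>2\<close> fits both the expansions in base
  \<open>4\<close> and the range of levels over which quantiles are formed.\<close>

definition coded :: "'a measure \<Rightarrow> bool" where
  "coded M \<longleftrightarrow> (\<exists>c d. c \<in> borel_measurable M \<and> d \<in> (borel :: real measure) \<rightarrow>\<^sub>M M \<and>
     (\<forall>\<omega>\<in>space M. 0 \<le> c \<omega> \<and> c \<omega> < 2 \<and> d (c \<omega>) = \<omega>))"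

lemma coded_retract:
  assumes "coded N" and f: "f \<in> M \<rightarrow>\<^sub>M N" and g: "g \<in> N \<rightarrow>\<^sub>M M" and gf: "\<And>\<omega>. \<omega> \<in> space M \<Longrightarrow> g (f \<omega>) = \<omega>"
  shows "coded M"
proof -
  obtain c d where c: "c \<in> borel_measurable N" and d: "d \<in> (borel :: real measure) \<rightarrow>\<^sub>M N"
    and cd: "\<And>\<omega>. \<omega> \<in> space N \<Longrightarrow> 0 \<le> c \<omega> \<and> c \<omega> < 2 \<and> d (c \<omega>) = \<omega>"
    using \<open>coded N\<close> unfolding coded_def by blast
  show ?thesis unfolding coded_def
  proof (intro exI conjI ballI)
    show "(\<lambda>\<omega>. c (f \<omega>)) \<in> borel_measurable M" by (rule measurable_compose[OF f c])
    show "(\<lambda>x. g (d x)) \<in> borel \<rightarrow>\<^sub>M M" by (rule measurable_compose[OF d g])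
    fix \<omega> assume "\<omega> \<in> space M"
    with cd[of "f \<omega>"] gf[of \<omega>] measurable_space[OF f, of \<omega>]
    show "0 \<le> c (f \<omega>)" "c (f \<omega>) < 2" "g (d (c (f \<omega>))) = \<omega>" by simp_all
  qed
qed

text \<open>Base \<open>4\<close> digits \<open>0\<close> and \<open>1\<close>: the tail after a digit stays below \<open>1\<close>, so the floor recovers the digit.\<close>

lemma digit_of_sum:
  fixes b :: "nat \<Rightarrow> bool"
  shows "odd \<lfloor>4 ^ n * (\<Sum>m. of_bool (b m) / (4::real) ^ m)\<rfloor> \<longleftrightarrow> b n"
    and "0 \<le> (\<Sum>m. of_bool (b m) / (4::real) ^ m)" "(\<Sum>m. of_bool (b m) / (4::real) ^ m) < 2"
proof -
  have bound: "summable (\<lambda>m. of_bool (b m) / (4::real) ^ m) \<and> 0 \<le> (\<Sum>m. of_bool (b m) / (4::real) ^ m) \<and> (\<Sum>m. of_bool (b m) / (4::real) ^ m) \<le> 4/3" for b :: "nat \<Rightarrow> bool"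
  proof -
    have g: "(\<lambda>m. (1/4::real) ^ m) sums (4/3)" using geometric_sums[of "1/4::real"] by simp
    have le: "of_bool (b m) / (4::real) ^ m \<le> (1/4) ^ m" for m by (simp add: power_divide)
    have s: "summable (\<lambda>m. of_bool (b m) / (4::real) ^ m)"
      by (rule summable_comparison_test[OF _ sums_summable[OF g]]) (use le in auto)
    then show ?thesis
      using suminf_le[OF le s sums_summable[OF g]] sums_unique[OF g] suminf_nonneg[OF s] by simp
  qed
  show "0 \<le> (\<Sum>m. of_bool (b m) / (4::real) ^ m)" "(\<Sum>m. of_bool (b m) / (4::real) ^ m) < 2"
    using bound[of b] by auto
  have eq: "4 ^ n * (of_bool (b m) / (4::real) ^ m) = of_int (4 * (of_bool (b m) * 4 ^ (n - Suc m)))" if "m < n" for m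
  proof -
    have "(4::real) ^ n = 4 ^ m * (4 * 4 ^ (n - Suc m))"
      using that by (metis Suc_diff_Suc add_diff_inverse_nat not_less_iff_gr_or_eq order_less_imp_not_less power_Suc power_add)
    then show ?thesis by simp
  qed
  have "4 ^ n * (\<Sum>m. of_bool (b m) / (4::real) ^ m) = 4 ^ n * (\<Sum>m<Suc n. of_bool (b m) / (4::real) ^ m) + 4 ^ n * (\<Sum>m. of_bool (b (m + Suc n)) / (4::real) ^ (m + Suc n))"
    using bound[of b] by (subst suminf_split_initial_segment[where k="Suc n"]) (auto simp: distrib_left)
  also have "4 ^ n * (\<Sum>m<Suc n. of_bool (b m) / (4::real) ^ m) = of_int (4 * (\<Sum>m<n. of_bool (b m) * 4 ^ (n - Suc m)) + of_bool (b n))"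
  proof -
    have "4 ^ n * (\<Sum>m<Suc n. of_bool (b m) / (4::real) ^ m) = (\<Sum>m<n. 4 ^ n * (of_bool (b m) / (4::real) ^ m)) + 4 ^ n * (of_bool (b n) / (4::real) ^ n)"
      by (simp only: sum.lessThan_Suc distrib_left sum_distrib_left)
    also have "(\<Sum>m<n. 4 ^ n * (of_bool (b m) / (4::real) ^ m)) = (\<Sum>m<n. of_int (4 * (of_bool (b m) * 4 ^ (n - Suc m))))"
      by (rule sum.cong) (simp_all only: eq lessThan_iff)
    also have "\<dots> = of_int (4 * (\<Sum>m<n. of_bool (b m) * 4 ^ (n - Suc m)))"
      by (simp only: sum_distrib_left of_int_sum)
    finally show ?thesis by simp
  qed
  also have "4 ^ n * (\<Sum>m. of_bool (b (m + Suc n)) / (4::real) ^ (m + Suc n)) = (\<Sum>m. of_bool (b (m + Suc n)) / (4::real) ^ m) / 4"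
  proof -
    have "of_bool (b (m + Suc n)) / (4::real) ^ (m + Suc n) = (1 / (4 * 4 ^ n)) * (of_bool (b (m + Suc n)) / 4 ^ m)" for m
      by (simp add: power_add)
    then have "(\<Sum>m. of_bool (b (m + Suc n)) / (4::real) ^ (m + Suc n)) = (1 / (4 * 4 ^ n)) * (\<Sum>m. of_bool (b (m + Suc n)) / 4 ^ m)"
      using bound[of "\<lambda>m. b (m + Suc n)"] by (simp only: suminf_mult)
    then show ?thesis by simp
  qed
  finally have fl: "\<lfloor>4 ^ n * (\<Sum>m. of_bool (b m) / (4::real) ^ m)\<rfloor> = 4 * (\<Sum>m<n. of_bool (b m) * 4 ^ (n - Suc m)) + of_bool (b n)"
    using bound[of "\<lambda>m. b (m + Suc n)"] by linarith
  show "odd \<lfloor>4 ^ n * (\<Sum>m. of_bool (b m) / (4::real) ^ m)\<rfloor> \<longleftrightarrow> b n"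
    unfolding fl by simp
qed

text \<open>A real number is determined by its Dedekind cut, the bits telling which rationals lie
  below it. The bits of all members of the sequence are interleaved by \<open>prod_encode\<close>
  and become the digits of one number; decoding takes the supremum of the marked rationals.\<close>

lemma coded_real_sequences: "coded (PiM UNIV (\<lambda>_::nat. borel :: real measure))"
proof -
  let ?M = "PiM UNIV (\<lambda>_::nat. borel :: real measure)"
  define r :: "nat \<Rightarrow> real" where "r m = of_rat (from_nat m)" for m
  define b where "b w n \<longleftrightarrow> r (snd (prod_decode n)) < w (fst (prod_decode n))" for w :: "nat \<Rightarrow> real" and n
  define c where "c w = (\<Sum>n. of_bool (b w n) / (4::real) ^ n)" for w
  \<comment> \<open>The supremum is formed in the extended reals with \<open>-\<infinity>\<close>
    for the rationals that are not marked, so \<open>d\<close> is defined and measurable for every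
    \<open>v\<close>, also for those that are no code.\<close>
  define d where "d v i = real_of_ereal (SUP m. if odd \<lfloor>4 ^ (prod_encode (i, m)) * v\<rfloor> then ereal (r m) else -\<infinity>)" for v :: real and i
  have "(\<lambda>w. of_bool (b w n) / (4::real) ^ n) \<in> borel_measurable ?M" for n
  proof -
    have "Measurable.pred ?M (\<lambda>w. b w n)" unfolding b_def by measurable
    then have "(\<lambda>w. if b w n then 1 / (4::real) ^ n else 0) \<in> borel_measurable ?M" by measurable
    also have "(\<lambda>w. if b w n then 1 / (4::real) ^ n else 0) = (\<lambda>w. of_bool (b w n) / (4::real) ^ n)" by auto
    finally show ?thesis .
  qed
  then have cm: "c \<in> borel_measurable ?M" unfolding c_def by measurable
  have dm: "d \<in> borel \<rightarrow>\<^sub>M ?M"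
  proof (rule measurable_PiM_single')
    fix i :: nat
    have "Measurable.pred borel (\<lambda>v::real. odd \<lfloor>4 ^ n * v\<rfloor>)" for n :: nat by measurable
    then show "(\<lambda>v. d v i) \<in> borel_measurable borel" unfolding d_def by measurable
  qed (auto simp: d_def)
  have "d (c w) i = w i" for w i
  proof -
    have "(SUP m. if odd \<lfloor>4 ^ (prod_encode (i, m)) * c w\<rfloor> then ereal (r m) else -\<infinity>) = (SUP m. if r m < w i then ereal (r m) else -\<infinity>)"
      unfolding c_def digit_of_sum(1) b_def by simp
    also have "\<dots> = ereal (w i)"
    proof (rule SUP_eqI)
      fix y assume y: "\<And>m. m \<in> UNIV \<Longrightarrow> (if r m < w i then ereal (r m) else -\<infinity>) \<le> y"
      show "ereal (w i) \<le> y"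
      proof (rule ccontr)
        assume "\<not> ereal (w i) \<le> y"
        then have "y < ereal (w i)" by simp
        then obtain z where z: "y < ereal z" "ereal z < ereal (w i)" using ereal_dense2 by blast
        then obtain p :: rat where p: "z < of_rat p" "of_rat p < w i" using of_rat_dense[of z "w i"] by auto
        have "r (to_nat p) = of_rat p" by (simp add: r_def)
        then have "ereal (of_rat p) \<le> y" using y[of "to_nat p"] p by simp
        moreover have "y < ereal (of_rat p)" using z(1) p(1) by (meson less_ereal.simps(1) less_trans)
        ultimately show False by simp
      qed
    qed auto
    finally show ?thesis by (simp add: d_def)
  qed
  then have "d (c w) = w" for w by blast
  moreover have "0 \<le> c w" "c w < 2" for w unfolding c_def by (rule digit_of_sum)+
  ultimately show ?thesis unfolding coded_def using cm dm by (intro exI[of _ c] exI[of _ d]) auto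
qed

text \<open>The sample space has countably many real coordinates, addressed by layer, kind and
  index: kind \<open>0\<close> is the count, kind \<open>1\<close> the times, kind \<open>2\<close>
  the jumps. The floor restores the count.\<close>

lemma (in point_layers) coded_clouds: "coded clouds"
proof (rule coded_retract[OF coded_real_sequences])
  define f :: "(nat \<Rightarrow> nat \<times> (nat \<Rightarrow> real \<times> real)) \<Rightarrow> nat \<Rightarrow> real" where
    "f \<omega> n = (let k = fst (prod_decode n); a = fst (prod_decode (snd (prod_decode n))); i = snd (prod_decode (snd (prod_decode n)))
      in if a = 0 then real (fst (\<omega> k)) else if a = 1 then fst (snd (\<omega> k) i) else snd (snd (\<omega> k) i))" for \<omega> n
  define g :: "(nat \<Rightarrow> real) \<Rightarrow> nat \<Rightarrow> nat \<times> (nat \<Rightarrow> real \<times> real)" where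
    "g z k = (nat \<lfloor>z (prod_encode (k, prod_encode (0, 0)))\<rfloor>,
       \<lambda>i. (z (prod_encode (k, prod_encode (1, i))), z (prod_encode (k, prod_encode (2, i)))))" for z k
  have c1: "(\<lambda>\<omega>. fst (\<omega> k)) \<in> clouds \<rightarrow>\<^sub>M count_space UNIV" for k
    by (rule measurable_compose[OF component_measurable measurable_cloud_fst])
  have c2: "(\<lambda>\<omega>. snd (\<omega> k) i) \<in> clouds \<rightarrow>\<^sub>M q k" for k i
    by (rule measurable_compose[OF measurable_compose[OF component_measurable measurable_cloud_snd] measurable_component_singleton]) simp
  show "f \<in> clouds \<rightarrow>\<^sub>M PiM UNIV (\<lambda>_::nat. borel :: real measure)"
  proof (rule measurable_PiM_single')
    fix n :: nat
    define k a i where "k = fst (prod_decode n)" and "a = fst (prod_decode (snd (prod_decode n)))" and "i = snd (prod_decode (snd (prod_decode n)))"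
    have "(\<lambda>\<omega>. real (fst (\<omega> k))) \<in> borel_measurable clouds"
      by (rule measurable_compose[OF c1]) simp
    moreover have "(\<lambda>\<omega>. fst (snd (\<omega> k) i)) \<in> borel_measurable clouds"
      by (rule measurable_compose[OF c2 L.fst_q])
    moreover have "(\<lambda>\<omega>. snd (snd (\<omega> k) i)) \<in> borel_measurable clouds"
      by (rule measurable_compose[OF c2 L.snd_q])
    ultimately show "(\<lambda>\<omega>. f \<omega> n) \<in> borel_measurable clouds"
      unfolding f_def Let_def k_def[symmetric] a_def[symmetric] i_def[symmetric]
      by (cases "a = 0"; cases "a = 1") simp_all
  qed auto
  show "g \<in> PiM UNIV (\<lambda>_::nat. borel :: real measure) \<rightarrow>\<^sub>M clouds"
    unfolding clouds_def
  proof (rule measurable_PiM_single')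
    fix k :: nat
    have "(\<lambda>z. nat \<lfloor>z (prod_encode (k, prod_encode (0, 0)))\<rfloor>) \<in> PiM UNIV (\<lambda>_::nat. borel :: real measure) \<rightarrow>\<^sub>M measure_pmf (pois (\<Lambda> k))"
      unfolding measurable_cong_sets[OF refl sets_measure_pmf_count_space] by measurable
    moreover have "(\<lambda>z i. (z (prod_encode (k, prod_encode (1, i))), z (prod_encode (k, prod_encode (2, i))))) \<in> PiM UNIV (\<lambda>_::nat. borel :: real measure) \<rightarrow>\<^sub>M PiM UNIV (\<lambda>_. q k)"
    proof (rule measurable_PiM_single')
      fix i :: nat
      have "(\<lambda>z. (z (prod_encode (k, prod_encode (1, i))), z (prod_encode (k, prod_encode (2, i))))) \<in> PiM UNIV (\<lambda>_::nat. borel :: real measure) \<rightarrow>\<^sub>M (borel \<Otimes>\<^sub>M borel)"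
        by measurable
      then show "(\<lambda>z. (z (prod_encode (k, prod_encode (1, i))), z (prod_encode (k, prod_encode (2, i))))) \<in> PiM UNIV (\<lambda>_::nat. borel :: real measure) \<rightarrow>\<^sub>M q k"
        by (simp add: measurable_cong_sets[OF refl L.sets_q] borel_prod)
    next
      have "space (q k) = UNIV" using sets_eq_imp_space_eq[OF L.sets_q[of k]] by simp
      then show "(\<lambda>z i. (z (prod_encode (k, prod_encode (1, i))), z (prod_encode (k, prod_encode (2, i))))) \<in> space (PiM UNIV (\<lambda>_::nat. borel :: real measure)) \<rightarrow> (\<Pi>\<^sub>E i\<in>UNIV. space (q k))"
        by auto
    qed
    ultimately show "(\<lambda>z. g z k) \<in> PiM UNIV (\<lambda>_::nat. borel :: real measure) \<rightarrow>\<^sub>M cloud (\<Lambda> k) (q k)"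
      unfolding g_def cloud_def by (rule measurable_Pair)
  next
    have "space (q k) = UNIV" for k using sets_eq_imp_space_eq[OF L.sets_q[of k]] by simp
    then have "space (cloud (\<Lambda> k) (q k)) = UNIV" for k
      unfolding cloud_def by (simp add: space_pair_measure space_PiM)
    then show "g \<in> space (PiM UNIV (\<lambda>_::nat. borel :: real measure)) \<rightarrow> (\<Pi>\<^sub>E k\<in>UNIV. space (cloud (\<Lambda> k) (q k)))"
      by auto
  qed
  show "g (f \<omega>) = \<omega>" for \<omega>
  proof
    fix k
    show "g (f \<omega>) k = \<omega> k" by (cases "\<omega> k") (simp add: g_def f_def)
  qed
qed

section \<open>Regular conditional distributions\<close>

lemma AE_le_of_set_integral_le:
  assumes f[measurable]: "f \<in> borel_measurable M" and g[measurable]: "g \<in> borel_measurable M"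
    and le: "\<And>A. A \<in> sets M \<Longrightarrow> (\<integral>\<^sup>+x. f x * indicator A x \<partial>M) \<le> (\<integral>\<^sup>+x. g x * indicator A x \<partial>M)"
    and fin: "(\<integral>\<^sup>+x. g x \<partial>M) < \<infinity>"
  shows "AE x in M. f x \<le> g x"
proof -
  define A where "A = {x\<in>space M. g x < f x}"
  have A[measurable]: "A \<in> sets M" unfolding A_def by measurable
  have finA: "(\<integral>\<^sup>+x. g x * indicator A x \<partial>M) < \<infinity>"
    by (rule le_less_trans[OF nn_integral_mono fin]) (auto simp: indicator_def)
  have "(\<integral>\<^sup>+x. f x * indicator A x - g x * indicator A x \<partial>M) = (\<integral>\<^sup>+x. f x * indicator A x \<partial>M) - (\<integral>\<^sup>+x. g x * indicator A x \<partial>M)"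
    using finA by (intro nn_integral_diff AE_I2) (auto simp: A_def indicator_def)
  also have "\<dots> = 0" by (rule diff_eq_0_ennreal) (use le[OF A] finA in auto)
  finally have "AE x in M. f x * indicator A x - g x * indicator A x = 0"
    by (subst (asm) nn_integral_0_iff_AE) auto
  then show ?thesis
  proof (rule AE_mp, intro AE_I2 impI)
    fix x assume x: "x \<in> space M" "f x * indicator A x - g x * indicator A x = 0"
    show "f x \<le> g x"
    proof (rule ccontr)
      assume "\<not> f x \<le> g x"
      then have "x \<in> A" "g x < f x" using x(1) by (auto simp: A_def)
      then show False using x(2) by (auto simp: diff_eq_0_iff_ennreal not_le[symmetric])
    qed
  qed
qed

text \<open>The Radon-Nikodym density is at most \<open>1\<close> almost everywhere and is cut at
  \<open>1\<close>, so the bounds hold at every point. This matters where the density serves as a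
  probability to be compared with a uniform variable.\<close>

lemma density_between:
  assumes "finite_measure M" "sets N = sets M" and le: "\<And>A. A \<in> sets M \<Longrightarrow> emeasure N A \<le> emeasure M A"
  obtains f :: "'a \<Rightarrow> real" where "f \<in> borel_measurable M" "\<And>x. 0 \<le> f x" "\<And>x. f x \<le> 1" "N = density M (\<lambda>x. ennreal (f x))"
proof -
  interpret finite_measure M by fact
  have "absolutely_continuous M N"
    unfolding absolutely_continuous_def using le \<open>sets N = sets M\<close> by (force simp: null_sets_def)
  then obtain g where g[measurable]: "g \<in> borel_measurable M" and N: "density M g = N"
    using Radon_Nikodym \<open>sets N = sets M\<close> by blast
  have "AE x in M. g x \<le> 1"
  proof (rule AE_le_of_set_integral_le)
    fix A assume A: "A \<in> sets M"
    have "(\<integral>\<^sup>+x. g x * indicator A x \<partial>M) = emeasure N A"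
      unfolding N[symmetric] using A by (simp add: emeasure_density)
    also have "\<dots> \<le> emeasure M A" by (rule le[OF A])
    also have "\<dots> = (\<integral>\<^sup>+x. 1 * indicator A x \<partial>M)" using A by simp
    finally show "(\<integral>\<^sup>+x. g x * indicator A x \<partial>M) \<le> (\<integral>\<^sup>+x. 1 * indicator A x \<partial>M)" .
  qed (auto simp: emeasure_eq_measure)
  then have ae: "AE x in M. g x = ennreal (enn2real (min 1 (g x)))"
    by eventually_elim (simp add: min_absorb2 le_less_trans)
  have "N = density M (\<lambda>x. ennreal (enn2real (min 1 (g x))))"
    unfolding N[symmetric] by (rule density_cong) (use ae in auto)
  moreover have "enn2real (min 1 (g x)) \<le> 1" for x
    by (rule enn2real_leI) auto
  ultimately show ?thesis by (intro that[of "\<lambda>x. enn2real (min 1 (g x))"]) auto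
qed

lemma measure_eqI_Times_greaterThan:
  fixes \<mu>1 \<mu>2 :: "('a \<times> real) measure"
  assumes sets: "sets \<mu>1 = sets (M \<Otimes>\<^sub>M borel)" "sets \<mu>2 = sets (M \<Otimes>\<^sub>M borel)"
    and fin: "finite_measure \<mu>1"
    and eq: "\<And>A a. A \<in> sets M \<Longrightarrow> emeasure \<mu>1 (A \<times> {a<..}) = emeasure \<mu>2 (A \<times> {a<..})"
  shows "\<mu>1 = \<mu>2"
proof -
  interpret finite_measure \<mu>1 by fact
  let ?E = "{A \<times> B |A B. A \<in> sets M \<and> B \<in> range (greaterThan :: real \<Rightarrow> real set)}"
  have gen: "sets (M \<Otimes>\<^sub>M (borel :: real measure)) = sigma_sets (space M \<times> UNIV) ?E"
  proof -
    have "sets (M \<Otimes>\<^sub>M (borel :: real measure)) = sets (sigma (space M \<times> space (borel :: real measure)) {A \<times> B |A B. A \<in> sets M \<and> B \<in> range greaterThan})"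
    proof (rule sets_pair_eq[where Ca="{space M}" and Cb="range (\<lambda>n::nat. {- real n<..})"])
      show "sets M \<subseteq> Pow (space M)" by (rule sets.space_closed)
      show "sets M = sigma_sets (space M) (sets M)" by (rule sets.sigma_sets_eq[symmetric])
      show "range (\<lambda>n::nat. {- real n<..}) \<subseteq> range greaterThan" by blast
      show "sets (borel :: real measure) = sigma_sets (space borel) (range greaterThan)"
        by (subst borel_Ioi) (simp add: sets_measure_of)
      show "countable (range (\<lambda>n::nat. {- real n<..}))" by simp
      show "\<Union> (range (\<lambda>n::nat. {- real n<..})) = space borel"
      proof -
        have "x \<in> \<Union> (range (\<lambda>n::nat. {- real n<..}))" for x
          using reals_Archimedean2[of "- x"] by (auto simp: minus_less_iff)
        then show ?thesis by auto
      qed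
    qed simp_all
    also have "\<dots> = sigma_sets (space M \<times> UNIV) ?E"
      using sets.sets_into_space by (subst sets_measure_of) auto
    finally show ?thesis .
  qed
  show ?thesis
  proof (rule measure_eqI_generator_eq)
    show "Int_stable ?E"
    proof (rule Int_stableI)
      fix X Y assume "X \<in> ?E" "Y \<in> ?E"
      then obtain A B a b where "X = A \<times> {a<..}" "Y = B \<times> {b<..}" "A \<in> sets M" "B \<in> sets M" by auto
      then have "X \<inter> Y = (A \<inter> B) \<times> {max a b<..}" "A \<inter> B \<in> sets M" by auto
      then show "X \<inter> Y \<in> ?E" by blast
    qed
    show "?E \<subseteq> Pow (space M \<times> UNIV)" using sets.sets_into_space by auto
    show "sets \<mu>1 = sigma_sets (space M \<times> UNIV) ?E" "sets \<mu>2 = sigma_sets (space M \<times> UNIV) ?E"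
      by (simp_all only: sets gen)
    show "range (\<lambda>n::nat. space M \<times> {- real n<..}) \<subseteq> ?E" by blast
    show "(\<Union>n. space M \<times> {- real n<..}) = space M \<times> UNIV"
    proof -
      have "\<exists>n. - real n < x" for x
        using reals_Archimedean2[of "- x"] by (auto simp: minus_less_iff)
      then show ?thesis by auto
    qed
    show "emeasure \<mu>1 (space M \<times> {- real n<..}) \<noteq> \<infinity>" for n by (simp add: emeasure_eq_measure)
    fix X assume "X \<in> ?E"
    then show "emeasure \<mu>1 X = emeasure \<mu>2 X" using eq by auto
  qed
qed

section \<open>Randomization by an independent uniform variable\<close>

abbreviation unif :: "real measure" where
  "unif \<equiv> uniform_measure lborel {0..1}"

lemma prob_space_unif: "prob_space unif"
  by (intro prob_space_uniform_measure) auto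

lemma emeasure_unif: "S \<in> sets borel \<Longrightarrow> emeasure unif S = emeasure lborel ({0..1} \<inter> S)"
  by (subst emeasure_uniform_measure) (simp_all add: divide_ennreal_def)

lemma emeasure_unif_greater:
  assumes "0 \<le> x" "x \<le> 1"
  shows "emeasure unif {s. x < s} = ennreal (1 - x)"
proof -
  have "{0..1} \<inter> {s. x < s} = {x<..1}" using assms by auto
  then show ?thesis using assms by (subst emeasure_unif) simp_all
qed

lemma emeasure_unif_le:
  assumes "0 \<le> x" "x \<le> 1"
  shows "emeasure unif {s. s \<le> x} = ennreal x"
proof -
  have "{0..1} \<inter> {s. s \<le> x} = {0..x}" using assms by auto
  then show ?thesis using assms by (subst emeasure_unif) simp_all
qed

text \<open>A regular conditional distribution given \<open>e\<close>, in disguise: \<open>T (u, \<cdot>)\<close> is the quantile function of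
  the conditional law of the code given \<open>e = u\<close>.\<close>

lemma (in prob_space) randomization:
  assumes "coded M" and e[measurable]: "e \<in> borel_measurable M"
  obtains G where "G \<in> (borel \<Otimes>\<^sub>M borel) \<rightarrow>\<^sub>M M"
    "distr (distr M borel e \<Otimes>\<^sub>M unif) (borel \<Otimes>\<^sub>M M) (\<lambda>p. (fst p, G p)) = distr M (borel \<Otimes>\<^sub>M M) (\<lambda>\<omega>. (e \<omega> :: real, \<omega>))"
proof -
  obtain c d where c[measurable]: "c \<in> borel_measurable M" and d[measurable]: "d \<in> (borel :: real measure) \<rightarrow>\<^sub>M M"
    and cd: "\<And>\<omega>. \<omega> \<in> space M \<Longrightarrow> 0 \<le> c \<omega> \<and> c \<omega> < 2 \<and> d (c \<omega>) = \<omega>"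
    using \<open>coded M\<close> unfolding coded_def by blast
  define \<alpha> where "\<alpha> = distr M borel e"
  interpret \<alpha>: prob_space \<alpha> unfolding \<alpha>_def by (rule prob_space_distr) simp
  interpret U: prob_space unif by (rule prob_space_unif)
  interpret \<alpha>U: pair_prob_space \<alpha> unif ..
  have sets_\<alpha>[measurable_cong]: "sets \<alpha> = sets borel" by (simp add: \<alpha>_def)
  have space_\<alpha>[simp]: "space \<alpha> = UNIV" by (simp add: \<alpha>_def)
  \<comment> \<open>\<open>N a\<close> is the law of \<open>e\<close> on the event that the code is
    at most \<open>a\<close>. Its density with respect to the law of \<open>e\<close> is the
    conditional distribution function of the code at the level \<open>a\<close>.\<close>
  define N where "N a = distr (density M (indicator {\<omega>\<in>space M. c \<omega> \<le> a})) borel e" for a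
  have sets_N: "sets (N a) = sets \<alpha>" for a by (simp add: N_def \<alpha>_def)
  have N: "emeasure (N a) A = emeasure M {\<omega>\<in>space M. e \<omega> \<in> A \<and> c \<omega> \<le> a}" if "A \<in> sets borel" for a A
  proof -
    note [measurable] = that
    have "emeasure (N a) A = emeasure (density M (indicator {\<omega>\<in>space M. c \<omega> \<le> a})) (e -` A \<inter> space M)"
      unfolding N_def using that by (simp add: emeasure_distr)
    also have "\<dots> = (\<integral>\<^sup>+\<omega>. indicator {\<omega>\<in>space M. c \<omega> \<le> a} \<omega> * indicator (e -` A \<inter> space M) \<omega> \<partial>M)"
      using that by (subst emeasure_density) (auto intro!: measurable_sets[OF e])
    also have "\<dots> = (\<integral>\<^sup>+\<omega>. indicator {\<omega>\<in>space M. e \<omega> \<in> A \<and> c \<omega> \<le> a} \<omega> \<partial>M)"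
      by (intro nn_integral_cong) (auto simp: indicator_def)
    also have "\<dots> = emeasure M {\<omega>\<in>space M. e \<omega> \<in> A \<and> c \<omega> \<le> a}"
      by (rule nn_integral_indicator) measurable
    finally show ?thesis .
  qed
  have \<alpha>: "emeasure \<alpha> A = emeasure M {\<omega>\<in>space M. e \<omega> \<in> A}" if "A \<in> sets borel" for A
    unfolding \<alpha>_def using that by (subst emeasure_distr) (auto intro!: arg_cong[where f="emeasure M"])
  have "\<exists>f::real \<Rightarrow> real. f \<in> borel_measurable \<alpha> \<and> (\<forall>u. 0 \<le> f u \<and> f u \<le> 1) \<and> N a = density \<alpha> (\<lambda>u. ennreal (f u))" for a
  proof -
    have "emeasure (N a) A \<le> emeasure \<alpha> A" if "A \<in> sets \<alpha>" for A
      using that e by (simp add: sets_\<alpha> N \<alpha>) (intro emeasure_mono; measurable; auto)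
    then show ?thesis
      by (rule density_between[OF \<alpha>.finite_measure_axioms sets_N]) blast+
  qed
  then obtain f where fm: "\<And>a. f a \<in> borel_measurable \<alpha>" and f01: "\<And>a u. 0 \<le> f a u \<and> f a u \<le> (1::real)"
    and f: "\<And>a. N a = density \<alpha> (\<lambda>u. ennreal (f a u))" by metis
  have fm[measurable]: "f a \<in> borel_measurable borel" for a using fm[of a] by (simp add: measurable_cong_sets[OF sets_\<alpha> refl])
  have f_int: "(\<integral>\<^sup>+u. ennreal (f a u) * indicator A u \<partial>\<alpha>) = emeasure (N a) A" if "A \<in> sets borel" for a A
    unfolding f using that by (subst emeasure_density) (auto simp: sets_\<alpha>)
  have fin: "(\<integral>\<^sup>+u. ennreal (f a u) \<partial>\<alpha>) < \<infinity>" for a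
  proof -
    have "(\<integral>\<^sup>+u. ennreal (f a u) \<partial>\<alpha>) \<le> (\<integral>\<^sup>+u. 1 \<partial>\<alpha>)"
      by (rule nn_integral_mono) (use f01 in auto)
    also have "\<dots> < \<infinity>" by (simp add: \<alpha>.emeasure_eq_measure)
    finally show ?thesis .
  qed
  have N_mono: "emeasure (N a) A \<le> emeasure (N b) A" if "a \<le> b" "A \<in> sets borel" for a b A
    unfolding N[OF that(2)] using that by (intro emeasure_mono) (auto, measurable)
  have f_mono: "AE u in \<alpha>. f a u \<le> f b u" if "a \<le> b" for a b
  proof -
    have "AE u in \<alpha>. ennreal (f a u) \<le> ennreal (f b u)"
      by (rule AE_le_of_set_integral_le) (use that fin in \<open>auto simp: sets_\<alpha> f_int N_mono\<close>)
    then show ?thesis using f01 by (auto simp: ennreal_le_iff)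
  qed
  \<comment> \<open>Countably many levels keep the supremum in \<open>T\<close> measurable and the
    exceptional sets null. The level \<open>0\<close> makes the index set nonempty, and the default
    \<open>0\<close> in \<open>T\<close> does no harm since codes are nonnegative.\<close>
  define I :: "real set" where "I = \<rat> \<inter> {0..2}"
  have I: "countable I" "0 \<in> I" unfolding I_def using countable_rat by auto
  define T where "T p = (SUP r\<in>I. if f r (fst p) < snd p then r else 0)" for p
  have bdd: "bdd_above ((\<lambda>r. if f r u < s then r else 0) ` I)" for u s
    by (rule bdd_aboveI[of _ 2]) (auto simp: I_def)
  have Tm[measurable]: "T \<in> borel_measurable (borel \<Otimes>\<^sub>M borel)"
    unfolding T_def
  proof (rule borel_measurable_cSUP[OF I(1)])
    fix r
    show "(\<lambda>p. if f r (fst p) < snd p then r else 0) \<in> borel_measurable (borel \<Otimes>\<^sub>M borel)" by measurable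
  qed (use bdd in auto)
  have T0: "0 \<le> T p" for p
    unfolding T_def by (rule cSUP_upper2[OF bdd I(2)]) auto
  have T2: "T p \<le> 2" for p
    unfolding T_def by (rule cSUP_least) (use I in \<open>auto simp: I_def\<close>)
  have T_gt: "a < T (u, s) \<longleftrightarrow> (\<exists>r\<in>I \<inter> {a<..}. f r u < s)" if "0 \<le> a" for a u s
    unfolding T_def using that I bdd[of u s] by (subst less_cSUP_iff) auto
  have pair_sets: "sets (\<alpha> \<Otimes>\<^sub>M unif) = sets (borel \<Otimes>\<^sub>M borel)"
    by (rule sets_pair_measure_cong) (simp_all add: sets_\<alpha>)
  have Tm'[measurable]: "T \<in> borel_measurable (\<alpha> \<Otimes>\<^sub>M unif)"
    using Tm by (simp only: measurable_cong_sets[OF pair_sets refl])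
  define \<mu>1 where "\<mu>1 = distr (\<alpha> \<Otimes>\<^sub>M unif) (borel \<Otimes>\<^sub>M borel) (\<lambda>p. (fst p, T p))"
  define \<mu>2 where "\<mu>2 = distr M (borel \<Otimes>\<^sub>M borel) (\<lambda>\<omega>. (e \<omega>, c \<omega>))"
  have main: "emeasure \<mu>1 (A \<times> {a<..}) = emeasure \<mu>2 (A \<times> {a<..})" if A[measurable]: "A \<in> sets borel" for A a
  proof -
    have m2: "emeasure \<mu>2 (A \<times> {a<..}) = emeasure M {\<omega>\<in>space M. e \<omega> \<in> A \<and> a < c \<omega>}"
      unfolding \<mu>2_def by (subst emeasure_distr) (auto intro!: arg_cong[where f="emeasure M"])
    have set1: "{p\<in>space (\<alpha> \<Otimes>\<^sub>M unif). fst p \<in> A \<and> a < T p} \<in> sets (\<alpha> \<Otimes>\<^sub>M unif)"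
      by measurable
    have "emeasure \<mu>1 (A \<times> {a<..}) = emeasure (\<alpha> \<Otimes>\<^sub>M unif) {p\<in>space (\<alpha> \<Otimes>\<^sub>M unif). fst p \<in> A \<and> a < T p}"
      unfolding \<mu>1_def by (subst emeasure_distr) (auto intro!: arg_cong[where f="emeasure (\<alpha> \<Otimes>\<^sub>M unif)"])
    also have "\<dots> = (\<integral>\<^sup>+u. emeasure unif (Pair u -` {p\<in>space (\<alpha> \<Otimes>\<^sub>M unif). fst p \<in> A \<and> a < T p}) \<partial>\<alpha>)"
      by (rule U.emeasure_pair_measure_alt[OF set1])
    also have "\<dots> = (\<integral>\<^sup>+u. emeasure unif {s. a < T (u, s)} * indicator A u \<partial>\<alpha>)"
      by (rule nn_integral_cong) (auto simp: indicator_def space_pair_measure intro!: arg_cong[where f="emeasure unif"])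
    finally have m1: "emeasure \<mu>1 (A \<times> {a<..}) = (\<integral>\<^sup>+u. emeasure unif {s. a < T (u, s)} * indicator A u \<partial>\<alpha>)" .
    consider "a < 0" | "0 \<le> a" "a < 2" | "2 \<le> a" by linarith
    then show ?thesis
    proof cases
      case 1
      then have "{s. a < T (u, s)} = space unif" for u using T0[of "(u, _)"] by (auto intro: less_le_trans)
      then have "emeasure \<mu>1 (A \<times> {a<..}) = emeasure \<alpha> A"
        unfolding m1 by (simp only: U.emeasure_space_1) (simp add: sets_\<alpha>)
      moreover have "{\<omega>\<in>space M. e \<omega> \<in> A \<and> a < c \<omega>} = {\<omega>\<in>space M. e \<omega> \<in> A}"
        using 1 cd by fastforce
      ultimately show ?thesis by (simp add: m2 \<alpha>)
    next
      case 3
      then have e1: "{s. a < T (u, s)} = {}" for u using T2[of "(u, _)"] by (auto simp: not_less intro: order_trans)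
      have e2: "{\<omega>\<in>space M. e \<omega> \<in> A \<and> a < c \<omega>} = {}"
        using 3 cd by fastforce
      show ?thesis unfolding m1 m2 e1 e2 by simp
    next
      case 2
      define J where "J = I \<inter> {a<..}"
      have J: "countable J" "J \<noteq> {}"
        using I(1) 2 Rats_dense_in_real[OF \<open>a < 2\<close>] by (auto simp: J_def I_def intro: countable_subset)
      \<comment> \<open>In the level, the densities \<open>f\<close> are monotone and right
        continuous only up to null sets. The infimum over the rational levels above \<open>a\<close>
        satisfies \<open>a < T (u, s)\<close> iff \<open>g u < s\<close> without exception, and it
        remains to see that \<open>g\<close> and \<open>f a\<close> agree almost everywhere.\<close>
      define g where "g u = (INF r\<in>J. f r u)" for u
      have bb: "bdd_below ((\<lambda>r. f r u) ` J)" for u by (rule bdd_belowI[of _ 0]) (use f01 in auto)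
      have g01: "0 \<le> g u" "g u \<le> 1" for u
      proof -
        show "0 \<le> g u" unfolding g_def using J f01 by (intro cINF_greatest) auto
        obtain r where "r \<in> J" using J by auto
        then show "g u \<le> 1" unfolding g_def using f01 by (intro cINF_lower2[OF bb]) auto
      qed
      have gm[measurable]: "g \<in> borel_measurable borel"
        unfolding g_def by (rule borel_measurable_cINF[OF J(1)]) (use bb in auto)
      have Tg: "{s. a < T (u, s)} = {s. g u < s}" for u
        using 2 J bb[of u] by (auto simp: T_gt g_def cINF_less_iff J_def[symmetric])
      have m1': "emeasure \<mu>1 (A \<times> {a<..}) = (\<integral>\<^sup>+u. ennreal (1 - g u) * indicator A u \<partial>\<alpha>)"
        unfolding m1 Tg by (simp only: emeasure_unif_greater g01)
      have ge: "AE u in \<alpha>. f a u \<le> g u"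
      proof -
        have "AE u in \<alpha>. \<forall>r\<in>J. f a u \<le> f r u"
          using J(1) by (subst AE_ball_countable) (auto simp: J_def intro!: f_mono)
        then show ?thesis by eventually_elim (use J in \<open>auto simp: g_def intro!: cINF_greatest\<close>)
      qed
      \<comment> \<open>Right continuity in integrated form: the events that the code is at most
        \<open>a + 1 / real (Suc n)\<close> decrease to the event for \<open>a\<close>, and
        \<open>g\<close> is below some \<open>f r\<close> with \<open>r\<close> between these
        levels.\<close>
      have le: "AE u in \<alpha>. ennreal (g u) \<le> ennreal (f a u)"
      proof (rule AE_le_of_set_integral_le)
        fix B assume "B \<in> sets \<alpha>"
        then have B[measurable]: "B \<in> sets borel" by (simp add: sets_\<alpha>)
        define S where "S n = {\<omega>\<in>space M. e \<omega> \<in> B \<and> c \<omega> \<le> a + 1 / real (Suc n)}" for n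
        have lim: "(\<lambda>n. emeasure M (S n)) \<longlonglongrightarrow> emeasure M (\<Inter>n. S n)"
        proof (rule Lim_emeasure_decseq)
          show "decseq S"
            unfolding S_def decseq_def
          proof safe
            fix i j :: nat and \<omega> assume "i \<le> j" "c \<omega> \<le> a + 1 / real (Suc j)"
            moreover have "1 / real (Suc j) \<le> 1 / real (Suc i)" using \<open>i \<le> j\<close> by (intro divide_left_mono) auto
            ultimately show "c \<omega> \<le> a + 1 / real (Suc i)" by linarith
          qed
        qed (auto simp: S_def)
        have "(\<Inter>n. S n) = {\<omega>\<in>space M. e \<omega> \<in> B \<and> c \<omega> \<le> a}"
        proof safe
          fix \<omega> assume \<omega>: "\<omega> \<in> (\<Inter>n. S n)"
          then have "c \<omega> \<le> a + 1 / real (Suc n)" for n by (auto simp: S_def)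
          then have "c \<omega> \<le> a + 0"
            by (intro LIMSEQ_le_const[OF tendsto_add[OF tendsto_const LIMSEQ_Suc[OF lim_1_over_n]]]) auto
          then show "c \<omega> \<le> a" by simp
          show "\<omega> \<in> space M" "e \<omega> \<in> B" using \<omega> by (auto simp: S_def)
        qed (auto simp: S_def add_increasing2)
        then have lim: "(\<lambda>n. emeasure M (S n)) \<longlonglongrightarrow> emeasure (N a) B" using lim by (simp add: N)
        have "(\<integral>\<^sup>+u. ennreal (g u) * indicator B u \<partial>\<alpha>) \<le> emeasure M (S n)" for n
        proof -
          have "a < min 2 (a + 1 / real (Suc n))" using 2 by simp
          from Rats_dense_in_real[OF this] obtain r where r: "r \<in> \<rat>" "a < r" "r < 2" "r < a + 1 / real (Suc n)" by auto
          then have rJ: "r \<in> J" using 2 by (auto simp: J_def I_def)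
          have "(\<integral>\<^sup>+u. ennreal (g u) * indicator B u \<partial>\<alpha>) \<le> (\<integral>\<^sup>+u. ennreal (f r u) * indicator B u \<partial>\<alpha>)"
            unfolding g_def by (intro nn_integral_mono mult_right_mono ennreal_leI cINF_lower[OF bb rJ]) simp
          also have "\<dots> = emeasure (N r) B" by (rule f_int[OF B])
          also have "\<dots> \<le> emeasure (N (a + 1 / real (Suc n))) B" using r by (intro N_mono) auto
          also have "\<dots> = emeasure M (S n)" unfolding S_def by (rule N[OF B])
          finally show ?thesis .
        qed
        then have "(\<integral>\<^sup>+u. ennreal (g u) * indicator B u \<partial>\<alpha>) \<le> emeasure (N a) B"
          by (intro LIMSEQ_le_const[OF lim]) auto
        then show "(\<integral>\<^sup>+u. ennreal (g u) * indicator B u \<partial>\<alpha>) \<le> (\<integral>\<^sup>+u. ennreal (f a u) * indicator B u \<partial>\<alpha>)"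
          by (simp add: f_int)
      qed (use fin in auto)
      have "AE u in \<alpha>. g u = f a u"
        using ge le by eventually_elim (use f01 in \<open>auto simp: ennreal_le_iff\<close>)
      then have "emeasure \<mu>1 (A \<times> {a<..}) = (\<integral>\<^sup>+u. ennreal (1 - f a u) * indicator A u \<partial>\<alpha>)"
        unfolding m1' by (intro nn_integral_cong_AE) auto
      moreover have "(\<integral>\<^sup>+u. ennreal (1 - f a u) * indicator A u \<partial>\<alpha>) + emeasure (N a) A = emeasure \<alpha> A"
      proof -
        have "(\<integral>\<^sup>+u. ennreal (1 - f a u) * indicator A u \<partial>\<alpha>) + emeasure (N a) A
          = (\<integral>\<^sup>+u. ennreal (1 - f a u) * indicator A u + ennreal (f a u) * indicator A u \<partial>\<alpha>)"
          unfolding f_int[OF A, symmetric] by (rule nn_integral_add[symmetric]) auto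
        also have "\<dots> = (\<integral>\<^sup>+u. indicator A u \<partial>\<alpha>)"
          using f01 by (intro nn_integral_cong) (auto simp: indicator_def ennreal_plus[symmetric] simp del: ennreal_plus)
        finally show ?thesis by (simp add: sets_\<alpha>)
      qed
      moreover have "emeasure \<mu>2 (A \<times> {a<..}) + emeasure (N a) A = emeasure \<alpha> A"
        unfolding m2 N[OF A] \<alpha>[OF A]
        by (subst plus_emeasure) (auto intro!: arg_cong[where f="emeasure M"])
      \<comment> \<open>On both sides the part with code at most \<open>a\<close> completes the
        measure to that of \<open>A\<close> under the law of \<open>e\<close>, and this part is
        finite, so it cancels.\<close>
      ultimately have "emeasure \<mu>1 (A \<times> {a<..}) + emeasure (N a) A = emeasure \<mu>2 (A \<times> {a<..}) + emeasure (N a) A" by simp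
      moreover have "emeasure (N a) A \<noteq> \<infinity>" by (simp add: N emeasure_eq_measure)
      ultimately show ?thesis by (metis add.commute ennreal_add_left_cancel)
    qed
  qed
  have "\<mu>1 = \<mu>2"
  proof (rule measure_eqI_Times_greaterThan)
    show "finite_measure \<mu>1"
      unfolding \<mu>1_def by (intro \<alpha>U.finite_measure_distr) simp
  qed (use main in \<open>auto simp: \<mu>1_def \<mu>2_def\<close>)
  define G where "G p = d (T p)" for p
  have Gm[measurable]: "G \<in> (borel \<Otimes>\<^sub>M borel) \<rightarrow>\<^sub>M M" unfolding G_def by measurable
  have h[measurable]: "(\<lambda>p. (fst p, d (snd p))) \<in> (borel \<Otimes>\<^sub>M borel) \<rightarrow>\<^sub>M (borel \<Otimes>\<^sub>M M)" by measurable
  have "distr (\<alpha> \<Otimes>\<^sub>M unif) (borel \<Otimes>\<^sub>M M) (\<lambda>p. (fst p, G p)) = distr \<mu>1 (borel \<Otimes>\<^sub>M M) (\<lambda>p. (fst p, d (snd p)))"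
    unfolding \<mu>1_def G_def by (subst distr_distr) (auto simp: comp_def)
  also have "\<dots> = distr M (borel \<Otimes>\<^sub>M M) (\<lambda>\<omega>. (e \<omega>, d (c \<omega>)))"
    unfolding \<open>\<mu>1 = \<mu>2\<close> \<mu>2_def by (subst distr_distr) (auto simp: comp_def)
  also have "\<dots> = distr M (borel \<Otimes>\<^sub>M M) (\<lambda>\<omega>. (e \<omega>, \<omega>))"
    by (rule distr_cong) (use cd in auto)
  finally show ?thesis using that[OF Gm] unfolding \<alpha>_def by blast
qed

section \<open>Maximal couplings and gluing\<close>

text \<open>The minimum of two finite measures, by a Hahn decomposition: on \<open>Y\<close> it is
  \<open>N\<close>, off \<open>Y\<close> it is \<open>M\<close>. It has densities bounded by
  \<open>1\<close> with respect to both measures. The inequality for arbitrary \<open>B\<close>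
  expresses that the splitting along \<open>Y\<close> attains the infimum in the definition of the
  minimum.\<close>

lemma overlap_densities:
  assumes "finite_measure M" "finite_measure N" and sets: "sets N = sets M"
  shows "\<exists>a b Y. a \<in> borel_measurable M \<and> b \<in> borel_measurable N \<and>
    (\<forall>x. 0 \<le> a x \<and> a x \<le> 1 \<and> 0 \<le> b x \<and> b x \<le> (1::real)) \<and>
    density M (\<lambda>x. ennreal (a x)) = density N (\<lambda>x. ennreal (b x)) \<and>
    (\<forall>A\<in>sets M. \<forall>B\<in>sets M. emeasure (density M (\<lambda>x. ennreal (a x))) A \<le> emeasure N (A \<inter> B) + emeasure M (A - B)) \<and>
    Y \<in> sets M \<and> (\<forall>A\<in>sets M. emeasure (density M (\<lambda>x. ennreal (a x))) A = emeasure N (A \<inter> Y) + emeasure M (A - Y))"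
proof -
  interpret M: finite_measure M by fact
  interpret N: finite_measure N by fact
  obtain Y where Y[measurable]: "Y \<in> sets M" and le1: "\<And>X. X \<in> sets M \<Longrightarrow> X \<subseteq> Y \<Longrightarrow> emeasure N X \<le> emeasure M X"
    and le2: "\<And>X. X \<in> sets M \<Longrightarrow> X \<inter> Y = {} \<Longrightarrow> emeasure M X \<le> emeasure N X"
    using finite_unsigned_Hahn_decomposition[OF assms] by blast
  have YN[measurable]: "Y \<in> sets N" by (simp add: sets)
  have spN: "space N = space M" by (rule sets_eq_imp_space_eq[OF sets])
  have d: "emeasure (density K (indicator Z)) A = emeasure K (A \<inter> Z)" if "A \<in> sets K" "Z \<in> sets K" for K and A Z :: "'a set"
  proof -
    have "emeasure (density K (indicator Z)) A = (\<integral>\<^sup>+x. indicator Z x * indicator A x \<partial>K)"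
      using that by (intro emeasure_density) auto
    also have "\<dots> = (\<integral>\<^sup>+x. indicator (A \<inter> Z) x \<partial>K)"
      by (intro nn_integral_cong) (auto simp: indicator_def)
    also have "\<dots> = emeasure K (A \<inter> Z)" using that by (intro nn_integral_indicator) auto
    finally show ?thesis .
  qed
  have d1: "emeasure (density N (indicator Y)) A = emeasure N (A \<inter> Y)" if "A \<in> sets M" for A
    by (rule d) (use that sets in auto)
  have d2: "emeasure (density M (indicator (space M - Y))) A = emeasure M (A - Y)" if "A \<in> sets M" for A
  proof -
    have "A \<inter> (space M - Y) = A - Y" using sets.sets_into_space[OF that] by auto
    then show ?thesis using d[of A M "space M - Y"] that by simp
  qed
  have "emeasure (density N (indicator Y)) A \<le> emeasure M A" if "A \<in> sets M" for A
  proof -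
    have "emeasure N (A \<inter> Y) \<le> emeasure M (A \<inter> Y)" using that by (intro le1) auto
    also have "\<dots> \<le> emeasure M A" using that by (intro emeasure_mono) auto
    finally show ?thesis using that by (simp add: d1)
  qed
  then obtain p1 :: "'a \<Rightarrow> real" where p1[measurable]: "p1 \<in> borel_measurable M" "\<And>x. 0 \<le> p1 x" "\<And>x. p1 x \<le> 1"
    and p1d: "density N (indicator Y) = density M (\<lambda>x. ennreal (p1 x))"
    using density_between[OF assms(1), of "density N (indicator Y)"] sets by (metis sets_density)
  have "emeasure (density M (indicator (space M - Y))) A \<le> emeasure N A" if "A \<in> sets N" for A
  proof -
    have "emeasure M (A - Y) \<le> emeasure N (A - Y)" using that sets by (intro le2) auto
    also have "\<dots> \<le> emeasure N A" using that by (intro emeasure_mono) auto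
    finally show ?thesis using that sets by (simp add: d2)
  qed
  then obtain p2 :: "'a \<Rightarrow> real" where p2[measurable]: "p2 \<in> borel_measurable N" "\<And>x. 0 \<le> p2 x" "\<And>x. p2 x \<le> 1"
    and p2d: "density M (indicator (space M - Y)) = density N (\<lambda>x. ennreal (p2 x))"
    using density_between[OF assms(2), of "density M (indicator (space M - Y))"] sets by (metis sets_density)
  \<comment> \<open>Where the minimum equals one of the two measures, the density with respect to
    that measure is \<open>1\<close>; the other density comes from
    \<open>density_between\<close>.\<close>
  define a where "a x = (if x \<in> Y then p1 x else 1)" for x
  define b where "b x = (if x \<in> Y then 1 else p2 x)" for x
  have am[measurable]: "a \<in> borel_measurable M" unfolding a_def by measurable
  have bm[measurable]: "b \<in> borel_measurable N" unfolding b_def by measurable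
  have A: "emeasure (density M (\<lambda>x. ennreal (a x))) A = emeasure N (A \<inter> Y) + emeasure M (A - Y)" if A[measurable]: "A \<in> sets M" for A
  proof -
    have "emeasure (density M (\<lambda>x. ennreal (a x))) A = (\<integral>\<^sup>+x. ennreal (p1 x) * indicator (A \<inter> Y) x + indicator (A - Y) x \<partial>M)"
      by (subst emeasure_density) (auto simp: a_def indicator_def intro!: nn_integral_cong)
    also have "\<dots> = (\<integral>\<^sup>+x. ennreal (p1 x) * indicator (A \<inter> Y) x \<partial>M) + emeasure M (A - Y)"
      by (subst nn_integral_add) auto
    also have "(\<integral>\<^sup>+x. ennreal (p1 x) * indicator (A \<inter> Y) x \<partial>M) = emeasure (density N (indicator Y)) (A \<inter> Y)"
      unfolding p1d by (subst emeasure_density) auto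
    finally show ?thesis by (simp add: d1 Int_assoc)
  qed
  have B: "emeasure (density N (\<lambda>x. ennreal (b x))) A = emeasure N (A \<inter> Y) + emeasure M (A - Y)" if A: "A \<in> sets M" for A
  proof -
    have [measurable]: "A \<in> sets N" using A sets by simp
    have "emeasure (density N (\<lambda>x. ennreal (b x))) A = (\<integral>\<^sup>+x. indicator (A \<inter> Y) x + ennreal (p2 x) * indicator (A - Y) x \<partial>N)"
      by (subst emeasure_density) (auto simp: b_def indicator_def intro!: nn_integral_cong)
    also have "\<dots> = emeasure N (A \<inter> Y) + (\<integral>\<^sup>+x. ennreal (p2 x) * indicator (A - Y) x \<partial>N)"
      by (subst nn_integral_add) auto
    also have "(\<integral>\<^sup>+x. ennreal (p2 x) * indicator (A - Y) x \<partial>N) = emeasure (density M (indicator (space M - Y))) (A - Y)"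
      unfolding p2d by (subst emeasure_density) auto
    also have "\<dots> = emeasure M (A - Y)" using A by (subst d2) (auto intro!: arg_cong[where f="emeasure M"])
    finally show ?thesis .
  qed
  have eq: "density M (\<lambda>x. ennreal (a x)) = density N (\<lambda>x. ennreal (b x))"
    by (rule measure_eqI) (use A B sets in auto)
  have min: "emeasure (density M (\<lambda>x. ennreal (a x))) A \<le> emeasure N (A \<inter> B) + emeasure M (A - B)"
    if AB[measurable]: "A \<in> sets M" "B \<in> sets M" for A B
  proof -
    have AB'[measurable]: "A \<in> sets N" "B \<in> sets N" using AB sets by simp_all
    have "emeasure N (A \<inter> Y) = emeasure N (A \<inter> Y \<inter> B) + emeasure N (A \<inter> Y - B)"
      by (subst plus_emeasure) (auto intro!: arg_cong[where f="emeasure N"])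
    also have "\<dots> \<le> emeasure N (A \<inter> Y \<inter> B) + emeasure M (A \<inter> Y - B)"
      by (intro add_left_mono le1) auto
    finally have 1: "emeasure N (A \<inter> Y) \<le> emeasure N (A \<inter> Y \<inter> B) + emeasure M (A \<inter> Y - B)" .
    have "emeasure M (A - Y) = emeasure M ((A - Y) \<inter> B) + emeasure M (A - Y - B)"
      by (subst plus_emeasure) (auto intro!: arg_cong[where f="emeasure M"])
    also have "\<dots> \<le> emeasure N ((A - Y) \<inter> B) + emeasure M (A - Y - B)"
      by (intro add_right_mono le2) auto
    finally have 2: "emeasure M (A - Y) \<le> emeasure N ((A - Y) \<inter> B) + emeasure M (A - Y - B)" .
    have 3: "emeasure N (A \<inter> Y \<inter> B) + emeasure N ((A - Y) \<inter> B) = emeasure N (A \<inter> B)"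
      by (subst plus_emeasure) (auto intro!: arg_cong[where f="emeasure N"])
    have 4: "emeasure M (A \<inter> Y - B) + emeasure M (A - Y - B) = emeasure M (A - B)"
      by (subst plus_emeasure) (auto intro!: arg_cong[where f="emeasure M"])
    have "emeasure N (A \<inter> Y) + emeasure M (A - Y) \<le> (emeasure N (A \<inter> Y \<inter> B) + emeasure M (A \<inter> Y - B)) + (emeasure N ((A - Y) \<inter> B) + emeasure M (A - Y - B))"
      by (intro add_mono 1 2)
    also have "\<dots> = (emeasure N (A \<inter> Y \<inter> B) + emeasure N ((A - Y) \<inter> B)) + (emeasure M (A \<inter> Y - B) + emeasure M (A - Y - B))"
      by (simp only: ac_simps)
    finally show ?thesis unfolding A[OF AB(1)] 3 4 .
  qed
  show ?thesis
    by (intro exI[of _ a] exI[of _ b] exI[of _ Y] conjI am bm eq Y ballI min A allI)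
       (use p1 p2 in \<open>auto simp: a_def b_def\<close>)
qed

text \<open>Rejection sampling: a value \<open>u\<close> with law \<open>\<alpha>1\<close> is kept
  if the uniform variable is at most \<open>a u\<close>, and otherwise replaced by an independent
  draw from the normalized excess of \<open>\<alpha>2\<close> over the minimum. The kept part has
  exactly the mass of the minimum, so the values differ with probability at most the total variation
  distance.\<close>

lemma maximal_coupling:
  fixes \<alpha>1 \<alpha>2 :: "real measure"
  assumes "prob_space \<alpha>1" "prob_space \<alpha>2" and s1: "sets \<alpha>1 = sets borel" and s2: "sets \<alpha>2 = sets borel"
    and close: "\<And>A. A \<in> sets borel \<Longrightarrow> measure \<alpha>1 A - measure \<alpha>2 A \<le> d"
  shows "\<exists>\<beta> v. prob_space \<beta> \<and> sets \<beta> = sets (borel :: real measure) \<and> v \<in> borel_measurable ((\<alpha>1 \<Otimes>\<^sub>M unif) \<Otimes>\<^sub>M \<beta>) \<and>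
    distr ((\<alpha>1 \<Otimes>\<^sub>M unif) \<Otimes>\<^sub>M \<beta>) borel v = \<alpha>2 \<and>
    measure ((\<alpha>1 \<Otimes>\<^sub>M unif) \<Otimes>\<^sub>M \<beta>) {p\<in>space ((\<alpha>1 \<Otimes>\<^sub>M unif) \<Otimes>\<^sub>M \<beta>). v p \<noteq> fst (fst p)} \<le> d"
proof -
  interpret \<alpha>1: prob_space \<alpha>1 by fact
  interpret \<alpha>2: prob_space \<alpha>2 by fact
  interpret U: prob_space unif by (rule prob_space_unif)
  interpret \<alpha>U: pair_prob_space \<alpha>1 unif ..
  have ss: "sets \<alpha>2 = sets \<alpha>1" by (simp add: s1 s2)
  have sp1[simp]: "space \<alpha>1 = UNIV" and sp2[simp]: "space \<alpha>2 = UNIV"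
    using sets_eq_imp_space_eq[OF s1] sets_eq_imp_space_eq[OF s2] by simp_all
  note [measurable_cong] = s1 s2
  from overlap_densities[OF \<alpha>1.finite_measure_axioms \<alpha>2.finite_measure_axioms ss]
  obtain a b Y where *: "a \<in> borel_measurable \<alpha>1 \<and> b \<in> borel_measurable \<alpha>2 \<and>
    (\<forall>x. 0 \<le> a x \<and> a x \<le> 1 \<and> 0 \<le> b x \<and> b x \<le> (1::real)) \<and>
    density \<alpha>1 (\<lambda>x. ennreal (a x)) = density \<alpha>2 (\<lambda>x. ennreal (b x)) \<and>
    (\<forall>A\<in>sets \<alpha>1. \<forall>B\<in>sets \<alpha>1. emeasure (density \<alpha>1 (\<lambda>x. ennreal (a x))) A \<le> emeasure \<alpha>2 (A \<inter> B) + emeasure \<alpha>1 (A - B)) \<and>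
    Y \<in> sets \<alpha>1 \<and> (\<forall>A\<in>sets \<alpha>1. emeasure (density \<alpha>1 (\<lambda>x. ennreal (a x))) A = emeasure \<alpha>2 (A \<inter> Y) + emeasure \<alpha>1 (A - Y))"
    by (elim exE)
  then have a: "a \<in> borel_measurable \<alpha>1" and b: "b \<in> borel_measurable \<alpha>2"
    and a01: "\<And>x. 0 \<le> a x" "\<And>x. a x \<le> 1" and b01: "\<And>x. 0 \<le> b x" "\<And>x. b x \<le> 1"
    and ab: "density \<alpha>1 (\<lambda>x. ennreal (a x)) = density \<alpha>2 (\<lambda>x. ennreal (b x))"
    and Y: "Y \<in> sets \<alpha>1" by simp_all
  from * have split: "emeasure (density \<alpha>1 (\<lambda>x. ennreal (a x))) A = emeasure \<alpha>2 (A \<inter> Y) + emeasure \<alpha>1 (A - Y)" if "A \<in> sets \<alpha>1" for A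
    using that by (elim conjE) (erule bspec)
  have [measurable]: "a \<in> borel_measurable borel" "b \<in> borel_measurable borel" using a b by simp_all
  have Yb[measurable]: "Y \<in> sets borel" using Y s1 by simp
  define \<gamma> where "\<gamma> A = emeasure (density \<alpha>1 (\<lambda>x. ennreal (a x))) A" for A
  have \<gamma>1: "\<gamma> A = (\<integral>\<^sup>+x. ennreal (a x) * indicator A x \<partial>\<alpha>1)" if "A \<in> sets borel" for A
    unfolding \<gamma>_def using that by (subst emeasure_density) (auto simp: s1)
  have \<gamma>2: "\<gamma> A = (\<integral>\<^sup>+x. ennreal (b x) * indicator A x \<partial>\<alpha>2)" if "A \<in> sets borel" for A
    unfolding \<gamma>_def ab using that by (subst emeasure_density) (auto simp: s2)
  \<comment> \<open>The mass of \<open>\<alpha>1\<close> missing from the minimum; as a difference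
    of probabilities of the Hahn set it is at most \<open>d\<close>.\<close>
  define \<kappa> where "\<kappa> = \<alpha>1.prob Y - \<alpha>2.prob Y"
  have \<gamma>U: "\<gamma> UNIV = ennreal (1 - \<kappa>)"
  proof -
    have "\<gamma> UNIV = emeasure \<alpha>2 Y + emeasure \<alpha>1 (UNIV - Y)"
      unfolding \<gamma>_def using split[of UNIV] by (simp add: s1)
    also have "\<dots> = ennreal (\<alpha>2.prob Y) + ennreal (1 - \<alpha>1.prob Y)"
      using \<alpha>1.prob_compl[OF Y] by (simp add: \<alpha>1.emeasure_eq_measure \<alpha>2.emeasure_eq_measure)
    also have "\<dots> = ennreal (1 - \<kappa>)"
      using \<alpha>1.prob_le_1[of Y]
      by (subst ennreal_plus[symmetric]) (simp_all add: \<kappa>_def algebra_simps del: ennreal_plus)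
    finally show ?thesis .
  qed
  have \<kappa>1: "\<kappa> \<le> 1" unfolding \<kappa>_def using \<alpha>1.prob_le_1[of Y] measure_nonneg[of \<alpha>2 Y] by linarith
  have compl1: "\<gamma> A + (\<integral>\<^sup>+x. ennreal (1 - a x) * indicator A x \<partial>\<alpha>1) = emeasure \<alpha>1 A" if [measurable]: "A \<in> sets borel" for A
  proof -
    have "\<gamma> A + (\<integral>\<^sup>+x. ennreal (1 - a x) * indicator A x \<partial>\<alpha>1) = (\<integral>\<^sup>+x. ennreal (a x) * indicator A x + ennreal (1 - a x) * indicator A x \<partial>\<alpha>1)"
      unfolding \<gamma>1[OF that] by (rule nn_integral_add[symmetric]) auto
    also have "\<dots> = (\<integral>\<^sup>+x. indicator A x \<partial>\<alpha>1)"
      using a01 by (intro nn_integral_cong) (auto simp: indicator_def ennreal_plus[symmetric] simp del: ennreal_plus)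
    finally show ?thesis using that by (simp add: s1)
  qed
  have compl2: "\<gamma> A + (\<integral>\<^sup>+x. ennreal (1 - b x) * indicator A x \<partial>\<alpha>2) = emeasure \<alpha>2 A" if [measurable]: "A \<in> sets borel" for A
  proof -
    have "\<gamma> A + (\<integral>\<^sup>+x. ennreal (1 - b x) * indicator A x \<partial>\<alpha>2) = (\<integral>\<^sup>+x. ennreal (b x) * indicator A x + ennreal (1 - b x) * indicator A x \<partial>\<alpha>2)"
      unfolding \<gamma>2[OF that] by (rule nn_integral_add[symmetric]) auto
    also have "\<dots> = (\<integral>\<^sup>+x. indicator A x \<partial>\<alpha>2)"
      using b01 by (intro nn_integral_cong) (auto simp: indicator_def ennreal_plus[symmetric] simp del: ennreal_plus)
    finally show ?thesis using that by (simp add: s2)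
  qed
  have \<kappa>0: "\<kappa> \<ge> 0"
  proof -
    have "ennreal (1 - \<kappa>) \<le> ennreal 1"
      unfolding \<gamma>U[symmetric] using compl1[of UNIV] \<alpha>1.emeasure_space_1
      by (metis add_increasing2 ennreal_1 order_refl sets.top space_borel sp1 zero_le le_iff_add)
    then show ?thesis by simp
  qed
  have cancel: "x = ennreal \<kappa>" if "ennreal (1 - \<kappa>) + x = 1" for x
  proof -
    have "ennreal (1 - \<kappa>) + x = ennreal (1 - \<kappa>) + ennreal \<kappa>"
      unfolding that using \<kappa>0 \<kappa>1 by (subst ennreal_plus[symmetric]) auto
    then show ?thesis by (simp add: ennreal_add_left_cancel)
  qed
  have ia: "(\<integral>\<^sup>+x. ennreal (1 - a x) \<partial>\<alpha>1) = ennreal \<kappa>"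
    using compl1[of UNIV] \<alpha>1.emeasure_space_1 by (intro cancel) (simp add: \<gamma>U)
  have ib: "(\<integral>\<^sup>+x. ennreal (1 - b x) \<partial>\<alpha>2) = ennreal \<kappa>"
    using compl2[of UNIV] \<alpha>2.emeasure_space_1 by (intro cancel) (simp add: \<gamma>U)
  \<comment> \<open>For \<open>\<kappa> = 0\<close> the rejection has probability \<open>0\<close>,
    so any probability measure may be drawn from; otherwise the excess has total mass
    \<open>\<kappa>\<close>.\<close>
  define \<beta> where "\<beta> = (if \<kappa> = 0 then \<alpha>2 else density \<alpha>2 (\<lambda>x. ennreal (1 / \<kappa>) * ennreal (1 - b x)))"
  have s\<beta>[measurable_cong]: "sets \<beta> = sets borel" by (simp add: \<beta>_def s2)
  have sp\<beta>[simp]: "space \<beta> = UNIV" using sets_eq_imp_space_eq[OF s\<beta>] by simp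
  have \<beta>: "ennreal \<kappa> * emeasure \<beta> A = (\<integral>\<^sup>+x. ennreal (1 - b x) * indicator A x \<partial>\<alpha>2)" if [measurable]: "A \<in> sets borel" for A
  proof (cases "\<kappa> = 0")
    case True
    have "(\<integral>\<^sup>+x. ennreal (1 - b x) * indicator A x \<partial>\<alpha>2) \<le> (\<integral>\<^sup>+x. ennreal (1 - b x) \<partial>\<alpha>2)"
      by (rule nn_integral_mono) (auto simp: indicator_def)
    then show ?thesis using ib True by simp
  next
    case False
    have "emeasure \<beta> A = (\<integral>\<^sup>+x. ennreal (1 / \<kappa>) * (ennreal (1 - b x) * indicator A x) \<partial>\<alpha>2)"
      using False that unfolding \<beta>_def by (simp add: emeasure_density s2 mult.assoc)
    also have "\<dots> = ennreal (1 / \<kappa>) * (\<integral>\<^sup>+x. ennreal (1 - b x) * indicator A x \<partial>\<alpha>2)"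
      by (rule nn_integral_cmult) measurable
    finally have "ennreal \<kappa> * emeasure \<beta> A = (ennreal \<kappa> * ennreal (1 / \<kappa>)) * (\<integral>\<^sup>+x. ennreal (1 - b x) * indicator A x \<partial>\<alpha>2)"
      by (simp add: mult.assoc)
    also have "ennreal \<kappa> * ennreal (1 / \<kappa>) = 1" using False \<kappa>0 by (subst ennreal_mult[symmetric]) auto
    finally show ?thesis by simp
  qed
  have "prob_space \<beta>"
  proof (cases "\<kappa> = 0")
    case True then show ?thesis by (simp add: \<beta>_def \<alpha>2.prob_space_axioms)
  next
    case False
    have "ennreal \<kappa> * emeasure \<beta> UNIV = ennreal \<kappa> * 1"
      using \<beta>[of UNIV] ib by simp
    then have "emeasure \<beta> UNIV = 1" using False \<kappa>0 by (subst (asm) ennreal_mult_cancel_left) auto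
    then show ?thesis by (intro prob_spaceI) simp
  qed
  then interpret \<beta>: prob_space \<beta> .
  interpret R: pair_prob_space "\<alpha>1 \<Otimes>\<^sub>M unif" \<beta> ..
  define v where "v p = (if snd (fst p) \<le> a (fst (fst p)) then fst (fst p) else snd p)" for p :: "(real \<times> real) \<times> real"
  have vm[measurable]: "v \<in> borel_measurable ((\<alpha>1 \<Otimes>\<^sub>M unif) \<Otimes>\<^sub>M \<beta>)" unfolding v_def by measurable
  define L where "L A = {q\<in>space (\<alpha>1 \<Otimes>\<^sub>M unif). snd q \<le> a (fst q) \<and> fst q \<in> A}" for A
  define K where "K = {q\<in>space (\<alpha>1 \<Otimes>\<^sub>M unif). \<not> snd q \<le> a (fst q)}"
  have Lm: "L A \<in> sets (\<alpha>1 \<Otimes>\<^sub>M unif)" if [measurable]: "A \<in> sets borel" for A unfolding L_def by measurable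
  have Km: "K \<in> sets (\<alpha>1 \<Otimes>\<^sub>M unif)" unfolding K_def by measurable
  have eL: "emeasure (\<alpha>1 \<Otimes>\<^sub>M unif) (L A) = \<gamma> A" if A: "A \<in> sets borel" for A
  proof -
    have "emeasure (\<alpha>1 \<Otimes>\<^sub>M unif) (L A) = (\<integral>\<^sup>+u. emeasure unif (Pair u -` L A) \<partial>\<alpha>1)"
      by (rule U.emeasure_pair_measure_alt[OF Lm[OF A]])
    also have "\<dots> = (\<integral>\<^sup>+u. emeasure unif {s. s \<le> a u} * indicator A u \<partial>\<alpha>1)"
      by (rule nn_integral_cong) (auto simp: indicator_def L_def space_pair_measure intro!: arg_cong[where f="emeasure unif"])
    finally show ?thesis unfolding \<gamma>1[OF A] by (simp only: emeasure_unif_le a01)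
  qed
  have eK: "emeasure (\<alpha>1 \<Otimes>\<^sub>M unif) K = ennreal \<kappa>"
  proof -
    have "emeasure (\<alpha>1 \<Otimes>\<^sub>M unif) K = (\<integral>\<^sup>+u. emeasure unif (Pair u -` K) \<partial>\<alpha>1)"
      by (rule U.emeasure_pair_measure_alt[OF Km])
    also have "\<dots> = (\<integral>\<^sup>+u. emeasure unif {s. a u < s} \<partial>\<alpha>1)"
      by (rule nn_integral_cong) (auto simp: K_def space_pair_measure not_le intro!: arg_cong[where f="emeasure unif"])
    finally show ?thesis unfolding ia[symmetric] by (simp only: emeasure_unif_greater a01)
  qed
  have dv: "distr ((\<alpha>1 \<Otimes>\<^sub>M unif) \<Otimes>\<^sub>M \<beta>) borel v = \<alpha>2"
  proof (rule measure_eqI)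
    fix A assume "A \<in> sets (distr ((\<alpha>1 \<Otimes>\<^sub>M unif) \<Otimes>\<^sub>M \<beta>) borel v)"
    then have A: "A \<in> sets borel" by simp
    then have A\<beta>: "A \<in> sets \<beta>" by (simp add: s\<beta>)
    have "emeasure (distr ((\<alpha>1 \<Otimes>\<^sub>M unif) \<Otimes>\<^sub>M \<beta>) borel v) A = emeasure ((\<alpha>1 \<Otimes>\<^sub>M unif) \<Otimes>\<^sub>M \<beta>) (v -` A \<inter> space ((\<alpha>1 \<Otimes>\<^sub>M unif) \<Otimes>\<^sub>M \<beta>))"
      by (rule emeasure_distr[OF vm A])
    also have "v -` A \<inter> space ((\<alpha>1 \<Otimes>\<^sub>M unif) \<Otimes>\<^sub>M \<beta>) = L A \<times> space \<beta> \<union> K \<times> A"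
    proof (rule set_eqI)
      fix p :: "(real \<times> real) \<times> real"
      obtain u s w where p: "p = ((u, s), w)" by (metis prod.collapse)
      show "p \<in> v -` A \<inter> space ((\<alpha>1 \<Otimes>\<^sub>M unif) \<Otimes>\<^sub>M \<beta>) \<longleftrightarrow> p \<in> L A \<times> space \<beta> \<union> K \<times> A"
        unfolding p by (cases "s \<le> a u") (simp_all add: v_def L_def K_def space_pair_measure)
    qed
    also have "emeasure ((\<alpha>1 \<Otimes>\<^sub>M unif) \<Otimes>\<^sub>M \<beta>) (L A \<times> space \<beta> \<union> K \<times> A) = emeasure ((\<alpha>1 \<Otimes>\<^sub>M unif) \<Otimes>\<^sub>M \<beta>) (L A \<times> space \<beta>) + emeasure ((\<alpha>1 \<Otimes>\<^sub>M unif) \<Otimes>\<^sub>M \<beta>) (K \<times> A)"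
      by (rule plus_emeasure[symmetric]) (use Lm[OF A] Km A\<beta> in \<open>auto simp: L_def K_def\<close>)
    also have "\<dots> = \<gamma> A + ennreal \<kappa> * emeasure \<beta> A"
      using Lm[OF A] Km A\<beta> by (simp add: \<beta>.emeasure_pair_measure_Times eL[OF A] eK \<beta>.emeasure_space_1[simplified])
    also have "\<dots> = emeasure \<alpha>2 A" unfolding \<beta>[OF A] by (rule compl2[OF A])
    finally show "emeasure (distr ((\<alpha>1 \<Otimes>\<^sub>M unif) \<Otimes>\<^sub>M \<beta>) borel v) A = emeasure \<alpha>2 A" .
  qed (simp add: s2)
  have "emeasure ((\<alpha>1 \<Otimes>\<^sub>M unif) \<Otimes>\<^sub>M \<beta>) {p\<in>space ((\<alpha>1 \<Otimes>\<^sub>M unif) \<Otimes>\<^sub>M \<beta>). v p \<noteq> fst (fst p)}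
     \<le> emeasure ((\<alpha>1 \<Otimes>\<^sub>M unif) \<Otimes>\<^sub>M \<beta>) (K \<times> space \<beta>)"
    by (rule emeasure_mono) (use Km in \<open>auto simp: v_def K_def space_pair_measure\<close>)
  also have "\<dots> = ennreal \<kappa>"
    using Km by (simp add: \<beta>.emeasure_pair_measure_Times eK \<beta>.emeasure_space_1[simplified])
  finally have "measure ((\<alpha>1 \<Otimes>\<^sub>M unif) \<Otimes>\<^sub>M \<beta>) {p\<in>space ((\<alpha>1 \<Otimes>\<^sub>M unif) \<Otimes>\<^sub>M \<beta>). v p \<noteq> fst (fst p)} \<le> \<kappa>"
    using \<kappa>0 by (simp add: R.emeasure_eq_measure)
  also have "\<kappa> \<le> d" unfolding \<kappa>_def by (rule close[OF Yb])
  finally have ne: "measure ((\<alpha>1 \<Otimes>\<^sub>M unif) \<Otimes>\<^sub>M \<beta>) {p\<in>space ((\<alpha>1 \<Otimes>\<^sub>M unif) \<Otimes>\<^sub>M \<beta>). v p \<noteq> fst (fst p)} \<le> d" .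
  show ?thesis
    by (intro exI[of _ \<beta>] exI[of _ v] conjI \<open>prob_space \<beta>\<close> s\<beta> vm dv ne)
qed

text \<open>The maximal coupling produces two values with the laws of \<open>e1\<close> and
  \<open>e2\<close>. Two further uniform variables, independent of everything else, extend each
  value to a point of \<open>M\<close> sampled from the conditional law given that value. Each
  extension alone has law \<open>M\<close>, and the coincidence of the two values survives.\<close>

lemma (in prob_space) exists_gluing:
  fixes e1 e2 :: "'a \<Rightarrow> real"
  assumes "coded M" and e1[measurable]: "e1 \<in> borel_measurable M" and e2[measurable]: "e2 \<in> borel_measurable M"
    and close: "\<And>A. A \<in> sets borel \<Longrightarrow> prob {\<omega>\<in>space M. e1 \<omega> \<in> A} - prob {\<omega>\<in>space M. e2 \<omega> \<in> A} \<le> d"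
  shows "\<exists>(R :: (((real \<times> real) \<times> real) \<times> (real \<times> real)) measure) \<Phi>1 \<Phi>2. prob_space R \<and> \<Phi>1 \<in> R \<rightarrow>\<^sub>M M \<and> \<Phi>2 \<in> R \<rightarrow>\<^sub>M M \<and>
     distr R M \<Phi>1 = M \<and> distr R M \<Phi>2 = M \<and> measure R {x\<in>space R. e1 (\<Phi>1 x) \<noteq> e2 (\<Phi>2 x)} \<le> (d :: real)"
proof -
  define \<alpha>1 where "\<alpha>1 = distr M borel e1"
  define \<alpha>2 where "\<alpha>2 = distr M borel e2"
  interpret U: prob_space unif by (rule prob_space_unif)
  interpret \<alpha>1: prob_space \<alpha>1 unfolding \<alpha>1_def by (rule prob_space_distr) simp
  interpret \<alpha>2: prob_space \<alpha>2 unfolding \<alpha>2_def by (rule prob_space_distr) simp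
  have s\<alpha>1: "sets \<alpha>1 = sets borel" and s\<alpha>2: "sets \<alpha>2 = sets borel" by (simp_all add: \<alpha>1_def \<alpha>2_def)
  have cl: "measure \<alpha>1 A - measure \<alpha>2 A \<le> d" if "A \<in> sets borel" for A
  proof -
    have "e1 -` A \<inter> space M = {\<omega>\<in>space M. e1 \<omega> \<in> A}" "e2 -` A \<inter> space M = {\<omega>\<in>space M. e2 \<omega> \<in> A}" by auto
    then show ?thesis using close[OF that] that by (simp add: \<alpha>1_def \<alpha>2_def measure_distr)
  qed
  have "\<exists>\<beta> v. prob_space \<beta> \<and> sets \<beta> = sets (borel :: real measure) \<and> v \<in> borel_measurable ((\<alpha>1 \<Otimes>\<^sub>M unif) \<Otimes>\<^sub>M \<beta>) \<and>
    distr ((\<alpha>1 \<Otimes>\<^sub>M unif) \<Otimes>\<^sub>M \<beta>) borel v = \<alpha>2 \<and>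
    measure ((\<alpha>1 \<Otimes>\<^sub>M unif) \<Otimes>\<^sub>M \<beta>) {p\<in>space ((\<alpha>1 \<Otimes>\<^sub>M unif) \<Otimes>\<^sub>M \<beta>). v p \<noteq> fst (fst p)} \<le> d"
    by (rule maximal_coupling[OF \<alpha>1.prob_space_axioms \<alpha>2.prob_space_axioms s\<alpha>1 s\<alpha>2]) (rule cl)
  then obtain \<beta> v where \<beta>v: "prob_space \<beta> \<and> sets \<beta> = sets (borel :: real measure) \<and> v \<in> borel_measurable ((\<alpha>1 \<Otimes>\<^sub>M unif) \<Otimes>\<^sub>M \<beta>) \<and>
    distr ((\<alpha>1 \<Otimes>\<^sub>M unif) \<Otimes>\<^sub>M \<beta>) borel v = \<alpha>2 \<and>
    measure ((\<alpha>1 \<Otimes>\<^sub>M unif) \<Otimes>\<^sub>M \<beta>) {p\<in>space ((\<alpha>1 \<Otimes>\<^sub>M unif) \<Otimes>\<^sub>M \<beta>). v p \<noteq> fst (fst p)} \<le> d"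
    by (elim exE)
  note \<beta> = conjunct1[OF \<beta>v] and v[measurable] = conjunct1[OF conjunct2[OF conjunct2[OF \<beta>v]]]
    and dv = conjunct1[OF conjunct2[OF conjunct2[OF conjunct2[OF \<beta>v]]]]
    and ne = conjunct2[OF conjunct2[OF conjunct2[OF conjunct2[OF \<beta>v]]]]
  interpret \<beta>: prob_space \<beta> by (rule \<beta>)
  interpret \<alpha>U: pair_prob_space \<alpha>1 unif ..
  define R0 where "R0 = (\<alpha>1 \<Otimes>\<^sub>M unif) \<Otimes>\<^sub>M \<beta>"
  have "prob_space R0" unfolding R0_def by (intro prob_space_pair \<alpha>1.prob_space_axioms U.prob_space_axioms \<beta>.prob_space_axioms)
  then interpret R0: prob_space R0 .
  define UU where "UU = unif \<Otimes>\<^sub>M unif"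
  have "prob_space UU" unfolding UU_def by (intro prob_space_pair U.prob_space_axioms)
  then interpret UU: prob_space UU .
  define R where "R = R0 \<Otimes>\<^sub>M UU"
  interpret R': pair_prob_space R0 UU ..
  have Rp: "prob_space R" unfolding R_def by (rule prob_space_pair) (rule R0.prob_space_axioms UU.prob_space_axioms)+
  interpret R: prob_space R by (rule Rp)
  have Rfst[measurable]: "fst \<in> R \<rightarrow>\<^sub>M R0" and Rsnd[measurable]: "snd \<in> R \<rightarrow>\<^sub>M UU" by (simp_all add: R_def)
  have u0[measurable]: "(\<lambda>p. fst (fst p)) \<in> borel_measurable R0"
  proof -
    have "(\<lambda>p. fst (fst p)) \<in> R0 \<rightarrow>\<^sub>M \<alpha>1" unfolding R0_def by measurable
    then show ?thesis by (simp add: measurable_cong_sets[OF refl s\<alpha>1])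
  qed
  have v0[measurable]: "v \<in> borel_measurable R0" using v by (simp add: R0_def)
  have du: "distr R0 borel (\<lambda>p. fst (fst p)) = \<alpha>1"
  proof -
    have "distr R0 borel (\<lambda>p. fst (fst p)) = distr R0 \<alpha>1 (\<lambda>p. fst (fst p))"
      by (rule distr_cong) (simp_all add: s\<alpha>1)
    also have "\<dots> = distr (distr R0 (\<alpha>1 \<Otimes>\<^sub>M unif) fst) \<alpha>1 fst"
      unfolding R0_def by (subst distr_distr) (auto simp: comp_def)
    also have "\<dots> = \<alpha>1" unfolding R0_def \<beta>.distr_pair_fst U.distr_pair_fst ..
    finally show ?thesis .
  qed
  have w1: "fst \<in> UU \<rightarrow>\<^sub>M unif" "distr UU unif fst = unif" unfolding UU_def by (simp_all add: U.distr_pair_fst)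
  have w2: "snd \<in> UU \<rightarrow>\<^sub>M unif" "distr UU unif snd = unif"
  proof -
    show "snd \<in> UU \<rightarrow>\<^sub>M unif" unfolding UU_def by simp
    interpret PU: pair_prob_space unif unif ..
    have "distr UU unif snd = distr (distr UU UU (\<lambda>(x, y). (y, x))) unif fst"
      unfolding UU_def by (subst distr_distr) (auto simp: comp_def case_prod_beta)
    also have "distr UU UU (\<lambda>(x, y). (y, x)) = UU"
      unfolding UU_def by (rule PU.distr_pair_swap[symmetric])
    finally show "distr UU unif snd = unif" using w1 by simp
  qed
  \<comment> \<open>If \<open>V\<close> has the law of \<open>e\<close> and the uniform variable is
    independent of it, then \<open>V\<close> together with the sampled point has the joint law of
    \<open>e \<omega>\<close> and \<open>\<omega>\<close>. Its second marginal is \<open>M\<close>,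
    and it is carried by the graph of \<open>e\<close>.\<close>
  have lift: "\<exists>\<Phi>. \<Phi> \<in> R \<rightarrow>\<^sub>M M \<and> distr R M \<Phi> = M \<and> (AE x in R. V (fst x) = e (\<Phi> x))"
    if V[measurable]: "V \<in> borel_measurable R0" and e[measurable]: "e \<in> borel_measurable M" and Ve: "distr R0 borel V = distr M borel e"
      and w: "w \<in> UU \<rightarrow>\<^sub>M unif" "distr UU unif w = unif" for V w and e :: "_ \<Rightarrow> real"
  proof -
    obtain G where G: "G \<in> (borel \<Otimes>\<^sub>M borel) \<rightarrow>\<^sub>M M"
      and GG: "distr (distr M borel e \<Otimes>\<^sub>M unif) (borel \<Otimes>\<^sub>M M) (\<lambda>p. (fst p, G p)) = distr M (borel \<Otimes>\<^sub>M M) (\<lambda>\<omega>. (e \<omega>, \<omega>))"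
      by (rule randomization[OF \<open>coded M\<close> e])
    have sU: "sets ((borel :: real measure) \<Otimes>\<^sub>M unif) = sets (borel \<Otimes>\<^sub>M borel)"
      by (rule sets_pair_measure_cong) simp_all
    have G'[measurable]: "G \<in> (borel \<Otimes>\<^sub>M unif) \<rightarrow>\<^sub>M M" using G by (simp only: measurable_cong_sets[OF sU refl])
    note w(1)[measurable]
    define \<Phi> where "\<Phi> x = G (V (fst x), w (snd x))" for x
    have \<Phi>m[measurable]: "\<Phi> \<in> R \<rightarrow>\<^sub>M M" unfolding \<Phi>_def by measurable
    have "distr R0 borel V \<Otimes>\<^sub>M distr UU unif w = distr R (borel \<Otimes>\<^sub>M unif) (\<lambda>(x, y). (V x, w y))"
      unfolding R_def
    proof (rule pair_measure_distr[OF V w(1)])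
      show "sigma_finite_measure (distr UU unif w)" unfolding w(2) by (rule U.sigma_finite_measure_axioms)
    qed
    then have J: "distr M borel e \<Otimes>\<^sub>M unif = distr R (borel \<Otimes>\<^sub>M unif) (\<lambda>(x, y). (V x, w y))" by (simp only: Ve w(2))
    have law: "distr R (borel \<Otimes>\<^sub>M M) (\<lambda>x. (V (fst x), \<Phi> x)) = distr M (borel \<Otimes>\<^sub>M M) (\<lambda>\<omega>. (e \<omega>, \<omega>))"
      unfolding GG[symmetric] J \<Phi>_def
      by (subst distr_distr) (auto simp: comp_def case_prod_beta)
    have "distr R M \<Phi> = distr (distr R (borel \<Otimes>\<^sub>M M) (\<lambda>x. (V (fst x), \<Phi> x))) M snd"
      by (subst distr_distr) (auto simp: comp_def)
    also have "\<dots> = distr M M (\<lambda>x. x)"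
      unfolding law by (subst distr_distr) (auto simp: comp_def)
    finally have dM: "distr R M \<Phi> = M" by (simp add: distr_id)
    have "AE p in distr M (borel \<Otimes>\<^sub>M M) (\<lambda>\<omega>. (e \<omega>, \<omega>)). fst p = e (snd p)"
      by (subst AE_distr_iff) auto
    then have "AE x in R. V (fst x) = e (\<Phi> x)"
      unfolding law[symmetric] by (subst (asm) AE_distr_iff) auto
    then show ?thesis using dM \<Phi>m by blast
  qed
  obtain \<Phi>1 where \<Phi>1: "\<Phi>1 \<in> R \<rightarrow>\<^sub>M M" "distr R M \<Phi>1 = M" "AE x in R. fst (fst (fst x)) = e1 (\<Phi>1 x)"
    using lift[OF u0 e1 _ w1] du unfolding \<alpha>1_def by blast
  obtain \<Phi>2 where \<Phi>2: "\<Phi>2 \<in> R \<rightarrow>\<^sub>M M" "distr R M \<Phi>2 = M" "AE x in R. v (fst x) = e2 (\<Phi>2 x)"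
    using lift[OF v0 e2 _ w2] dv unfolding \<alpha>2_def R0_def by blast
  note [measurable] = \<Phi>1(1) \<Phi>2(1)
  define S where "S = {p\<in>space R0. v p \<noteq> fst (fst p)}"
  have Sm[measurable]: "S \<in> sets R0" unfolding S_def by measurable
  have "measure R {x\<in>space R. e1 (\<Phi>1 x) \<noteq> e2 (\<Phi>2 x)} \<le> measure R (S \<times> space UU)"
  proof (rule R.finite_measure_mono_AE)
    show "AE x in R. x \<in> {x\<in>space R. e1 (\<Phi>1 x) \<noteq> e2 (\<Phi>2 x)} \<longrightarrow> x \<in> S \<times> space UU"
      using \<Phi>1(3) \<Phi>2(3) by eventually_elim (auto simp: S_def R_def space_pair_measure)
    show "S \<times> space UU \<in> sets R" unfolding R_def by simp
  qed
  also have "measure R (S \<times> space UU) = measure R0 S"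
    unfolding R_def measure_def by (simp add: UU.emeasure_pair_measure_Times UU.emeasure_space_1)
  also have "\<dots> \<le> d" using ne unfolding S_def R0_def by simp
  finally show ?thesis using Rp \<Phi>1 \<Phi>2 by blast
qed

section \<open>Reflected random walks\<close>

text \<open>\<open>p\<close> is the density of a symmetric part of the step law:
  \<open>reflect\<close> is its invariance under \<open>uminus\<close>. \<open>drop\<close> is a
  Lyapunov condition: from a distance between \<open>r\<close> and \<open>1\<close>, one reflected
  step lowers the mean of \<open>w\<close> by at least \<open>\<kappa>\<close>. Below
  \<open>r\<close> the Lipschitz bound on \<open>h\<close> takes over, above \<open>1\<close> the
  bound \<open>2 * z\<close> is trivial.\<close>

locale reflected_walk = prob_space q for q :: "real measure" +
  fixes p w h :: "real \<Rightarrow> real" and W \<kappa> r L :: real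
  assumes sets_q[measurable_cong]: "sets q = sets borel"
    and p_meas[measurable]: "p \<in> borel_measurable borel" and p01: "\<And>x. 0 \<le> p x" "\<And>x. p x \<le> 1"
    and reflect: "\<And>g B. g \<in> borel_measurable borel \<Longrightarrow> (\<And>x. \<bar>g x\<bar> \<le> B) \<Longrightarrow> (\<integral>x. p x * g x \<partial>q) = (\<integral>x. p x * g (- x) \<partial>q)"
    and w_meas[measurable]: "w \<in> borel_measurable borel" and w_bounds: "\<And>z. 0 \<le> w z" "\<And>z. w z \<le> W"
    and \<kappa>: "\<kappa> > 0"
    and drop: "\<And>z. r < z \<Longrightarrow> z < 1 \<Longrightarrow> (\<integral>a. p a * indicator {a. 2 * \<bar>a\<bar> \<le> z} a * (w (z - 2 * a) - w z) \<partial>q) \<le> - \<kappa>"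
    and h_meas[measurable]: "h \<in> borel_measurable borel" and h1: "\<And>x. \<bar>h x\<bar> \<le> 1"
    and lip: "\<And>x y. \<bar>h x - h y\<bar> \<le> L * \<bar>x - y\<bar>" and L: "L \<ge> 0" and r: "r > 0"
begin

definition H :: "nat \<Rightarrow> real \<Rightarrow> real" where
  "H n x = (\<integral>\<omega>. h (x + (\<Sum>i<n. \<omega> i)) \<partial>PiM UNIV (\<lambda>_::nat. q))"

lemma S_prob: "prob_space (PiM UNIV (\<lambda>_::nat. q))"
  by (intro prob_space_PiM prob_space_axioms)

lemma space_q[simp]: "space q = UNIV" using sets_eq_imp_space_eq[OF sets_q] by simp

lemma prob_UNIV[simp]: "prob UNIV = 1" using prob_space by simp

lemma integrable_bounded: "f \<in> borel_measurable q \<Longrightarrow> (\<And>x. \<bar>f x\<bar> \<le> B) \<Longrightarrow> integrable q f" for f :: "real \<Rightarrow> real"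
  by (rule integrable_const_bound[where B=B]) auto

lemma sum_measurable[measurable]: "(\<lambda>\<omega>. \<Sum>i<n. \<omega> i) \<in> borel_measurable (PiM UNIV (\<lambda>_::nat. q))" for n
  by measurable

lemma integrable_h: "integrable (PiM UNIV (\<lambda>_::nat. q)) (\<lambda>\<omega>. h (x + (\<Sum>i<n. \<omega> i)))"
proof -
  interpret P: prob_space "PiM UNIV (\<lambda>_::nat. q)" by (rule S_prob)
  show ?thesis by (rule P.integrable_const_bound[where B=1]) (use h1 in auto)
qed

lemma H_measurable[measurable]: "H n \<in> borel_measurable borel"
proof -
  interpret P: prob_space "PiM UNIV (\<lambda>_::nat. q)" by (rule S_prob)
  have "(\<lambda>(x, \<omega>). h (x + (\<Sum>i<n. \<omega> i))) \<in> borel_measurable (borel \<Otimes>\<^sub>M PiM UNIV (\<lambda>_::nat. q))" by measurable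
  then show ?thesis unfolding H_def by (rule P.borel_measurable_lebesgue_integral)
qed

lemma H_bound: "\<bar>H n x\<bar> \<le> 1"
proof -
  interpret P: prob_space "PiM UNIV (\<lambda>_::nat. q)" by (rule S_prob)
  have "\<bar>H n x\<bar> \<le> (\<integral>\<omega>. \<bar>h (x + (\<Sum>i<n. \<omega> i))\<bar> \<partial>PiM UNIV (\<lambda>_::nat. q))"
    unfolding H_def by (rule integral_abs_bound)
  also have "\<dots> \<le> (\<integral>\<omega>. 1 \<partial>PiM UNIV (\<lambda>_::nat. q))"
    by (rule integral_mono) (use h1 integrable_h in auto)
  finally show ?thesis by (simp add: P.prob_space)
qed

lemma H_lipschitz: "\<bar>H n x - H n y\<bar> \<le> L * \<bar>x - y\<bar>"
proof -
  interpret P: prob_space "PiM UNIV (\<lambda>_::nat. q)" by (rule S_prob)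
  have "\<bar>H n x - H n y\<bar> = \<bar>\<integral>\<omega>. h (x + (\<Sum>i<n. \<omega> i)) - h (y + (\<Sum>i<n. \<omega> i)) \<partial>PiM UNIV (\<lambda>_::nat. q)\<bar>"
    unfolding H_def by (simp add: integrable_h)
  also have "\<dots> \<le> (\<integral>\<omega>. \<bar>h (x + (\<Sum>i<n. \<omega> i)) - h (y + (\<Sum>i<n. \<omega> i))\<bar> \<partial>PiM UNIV (\<lambda>_::nat. q))"
    by (rule integral_abs_bound)
  also have "\<dots> \<le> (\<integral>\<omega>. L * \<bar>x - y\<bar> \<partial>PiM UNIV (\<lambda>_::nat. q))"
  proof (rule integral_mono)
    show "\<bar>h (x + (\<Sum>i<n. \<omega> i)) - h (y + (\<Sum>i<n. \<omega> i))\<bar> \<le> L * \<bar>x - y\<bar>" for \<omega>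
      using lip[of "x + (\<Sum>i<n. \<omega> i)" "y + (\<Sum>i<n. \<omega> i)"] by simp
  qed (simp_all add: integrable_h)
  finally show ?thesis by (simp add: P.prob_space)
qed

lemma H_Suc: "H (Suc n) x = (\<integral>a. H n (x + a) \<partial>q)"
proof -
  interpret Q: prob_space "PiM UNIV (\<lambda>_::nat. q)" by (rule S_prob)
  interpret pair_prob_space q "PiM UNIV (\<lambda>_::nat. q)" ..
  interpret S: sequence_space q ..
  have m: "(\<lambda>(s, \<omega>). case_nat s \<omega>) \<in> q \<Otimes>\<^sub>M PiM UNIV (\<lambda>_::nat. q) \<rightarrow>\<^sub>M PiM UNIV (\<lambda>_::nat. q)"
    by measurable
  have "H (Suc n) x = (\<integral>\<omega>. h (x + (\<Sum>i<Suc n. \<omega> i)) \<partial>distr (q \<Otimes>\<^sub>M PiM UNIV (\<lambda>_::nat. q)) (PiM UNIV (\<lambda>_::nat. q)) (\<lambda>(s, \<omega>). case_nat s \<omega>))"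
    unfolding H_def S.PiM_iter ..
  also have "\<dots> = (\<integral>z. h (x + fst z + (\<Sum>i<n. snd z i)) \<partial>(q \<Otimes>\<^sub>M PiM UNIV (\<lambda>_::nat. q)))"
    by (subst integral_distr[OF m])
       (simp_all add: case_prod_beta sum.lessThan_Suc_shift add.assoc del: sum.lessThan_Suc)
  also have "\<dots> = (\<integral>a. (\<integral>\<omega>. h (x + fst (a, \<omega>) + (\<Sum>i<n. snd (a, \<omega>) i)) \<partial>PiM UNIV (\<lambda>_::nat. q)) \<partial>q)"
  proof (rule integral_fst'[symmetric])
    show "integrable (q \<Otimes>\<^sub>M PiM UNIV (\<lambda>_::nat. q)) (\<lambda>z. h (x + fst z + (\<Sum>i<n. snd z i)))"
      by (rule P.integrable_const_bound[where B=1]) (use h1 in auto)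
  qed
  finally show ?thesis by (simp add: H_def)
qed

text \<open>The mean decrease cannot exceed the value itself: \<open>w\<close> is nonnegative and
  the reflected jumps have total weight at most \<open>1\<close>. This starts the induction, where
  the last term has to reach \<open>2\<close>.\<close>

lemma w_le_of_drop: "r < z \<Longrightarrow> z < 1 \<Longrightarrow> \<kappa> \<le> w z"
proof -
  assume z: "r < z" "z < 1"
  define P where "P a = p a * indicator {a. 2 * \<bar>a\<bar> \<le> z} a" for a
  have P: "0 \<le> P a" "P a \<le> 1" for a using p01[of a] by (auto simp: P_def indicator_def)
  have [measurable]: "P \<in> borel_measurable borel" unfolding P_def by measurable
  have "- w z = (\<integral>a. - w z \<partial>q)" by (simp add: prob_space)
  also have "\<dots> \<le> (\<integral>a. P a * (w (z - 2 * a) - w z) \<partial>q)"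
  proof (rule integral_mono)
    show "integrable q (\<lambda>a. P a * (w (z - 2 * a) - w z))"
    proof (rule integrable_bounded[where B="W"])
      fix a
      have "\<bar>w (z - 2 * a) - w z\<bar> \<le> W" using w_bounds[of z] w_bounds[of "z - 2 * a"] by linarith
      then show "\<bar>P a * (w (z - 2 * a) - w z)\<bar> \<le> W"
        using mult_mono[of "\<bar>P a\<bar>" 1 "\<bar>w (z - 2 * a) - w z\<bar>" W] P[of a] by (simp add: abs_mult)
    qed measurable
    fix a
    have "P a * (- w z) \<le> P a * (w (z - 2 * a) - w z)"
      using P[of a] w_bounds[of "z - 2 * a"] by (intro mult_left_mono) auto
    moreover have "- w z \<le> P a * (- w z)"
      using P[of a] w_bounds(1)[of z] by (simp add: mult_left_le_one_le)
    ultimately show "- w z \<le> P a * (w (z - 2 * a) - w z)" by linarith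
  qed simp
  also have "\<dots> \<le> - \<kappa>" unfolding P_def by (rule drop[OF z])
  finally show ?thesis by simp
qed

text \<open>One step of the walk is coupled by reflecting the jumps \<open>a\<close> with \<open>2 * \<bar>a\<bar> \<le> z\<close> of the symmetric part;
  then the distance \<open>z\<close> becomes \<open>z - 2 * a\<close>, a martingale on which \<open>w\<close> decreases on average.\<close>

lemma H_translate: "0 \<le> z \<Longrightarrow> \<bar>H n (x + z) - H n x\<bar> \<le> L * r + 2 * z + 2 / (\<kappa> * (real n + 1)) * w z"
proof (induction n arbitrary: x z)
  case 0
  show ?case
  proof (cases "z \<le> r")
    case True
    have "\<bar>H 0 (x + z) - H 0 x\<bar> \<le> L * r"
      using H_lipschitz[of 0 "x + z" x] mult_left_mono[OF True L] 0 by simp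
    moreover have "0 \<le> 2 / (\<kappa> * (real 0 + 1)) * w z" using \<kappa> w_bounds by simp
    ultimately show ?thesis using 0 by linarith
  next
    case False
    have b: "\<bar>H 0 (x + z) - H 0 x\<bar> \<le> 2" using H_bound[of 0 "x + z"] H_bound[of 0 x] by linarith
    have Lr: "0 \<le> L * r" using L r by simp
    show ?thesis
    proof (cases "z < 1")
      case True
      then have "\<kappa> \<le> w z" using w_le_of_drop False by simp
      then have "2 \<le> 2 / (\<kappa> * (real 0 + 1)) * w z" using \<kappa> by (simp add: field_simps)
      then show ?thesis using b Lr 0 by linarith
    next
      case False
      moreover have "0 \<le> 2 / (\<kappa> * (real 0 + 1)) * w z" using \<kappa> w_bounds by simp
      ultimately show ?thesis using b Lr by linarith
    qed
  qed
next
  case (Suc n)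
  have b: "\<bar>H (Suc n) (x + z) - H (Suc n) x\<bar> \<le> 2" using H_bound[of "Suc n" "x + z"] H_bound[of "Suc n" x] by linarith
  have Lr: "0 \<le> L * r" using L r by simp
  have w0: "0 \<le> 2 / (\<kappa> * (real (Suc n) + 1)) * w z" using \<kappa> w_bounds by simp
  \<comment> \<open>In the first case \<open>L * r\<close> suffices. The difference is at most
    \<open>2\<close>, which \<open>2 * z\<close> reaches in the second case and the last term in the
    third. The remaining case carries \<open>w z < \<kappa> * (real n + 2)\<close>, and this is what
    closes the induction.\<close>
  consider "z \<le> r" | "1 \<le> z" | "r < z" "z < 1" "w z \<ge> \<kappa> * (real n + 2)" | "r < z" "z < 1" "w z < \<kappa> * (real n + 2)" by linarith
  then show ?case
  proof cases
    case 1
    have "\<bar>H (Suc n) (x + z) - H (Suc n) x\<bar> \<le> L * r"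
      using H_lipschitz[of "Suc n" "x + z" x] mult_left_mono[OF 1 L] Suc.prems by simp
    then show ?thesis using w0 Suc.prems by linarith
  next
    case 2
    then show ?thesis using w0 b Lr by linarith
  next
    case 3
    moreover have "0 < \<kappa> * (real n + 2)" using \<kappa> by simp
    ultimately have "1 \<le> w z / (\<kappa> * (real n + 2))" by (simp only: le_divide_eq_1_pos)
    then have "2 \<le> 2 / (\<kappa> * (real (Suc n) + 1)) * w z" by (simp add: add_ac)
    then show ?thesis using b Lr Suc.prems by linarith
  next
    case 4
    define P where "P a = p a * indicator {a. 2 * \<bar>a\<bar> \<le> z} a" for a
    have P: "0 \<le> P a" "P a \<le> 1" for a using p01[of a] by (auto simp: P_def indicator_def)
    have Pm[measurable]: "P \<in> borel_measurable borel" unfolding P_def by measurable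
    have Psym: "(\<integral>a. P a * g a \<partial>q) = (\<integral>a. P a * g (- a) \<partial>q)"
      if g[measurable]: "g \<in> borel_measurable borel" and gB: "\<And>a. 2 * \<bar>a\<bar> \<le> z \<Longrightarrow> \<bar>g a\<bar> \<le> B" and "B \<ge> 0" for g B
    proof -
      have "(\<integral>a. p a * (indicator {a. 2 * \<bar>a\<bar> \<le> z} a * g a) \<partial>q) = (\<integral>a. p a * (indicator {a. 2 * \<bar>a\<bar> \<le> z} (- a) * g (- a)) \<partial>q)"
        by (rule reflect[of _ B]) (use gB \<open>B \<ge> 0\<close> in \<open>auto simp: indicator_def\<close>)
      then show ?thesis by (simp add: P_def indicator_def mult.assoc)
    qed
    define c where "c = 2 / (\<kappa> * (real n + 1))"
    have c0: "c \<ge> 0" using \<kappa> by (simp add: c_def)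
    have intP: "integrable q (\<lambda>a. P a * g a)" if "g \<in> borel_measurable borel" "\<And>a. 2 * \<bar>a\<bar> \<le> z \<Longrightarrow> \<bar>g a\<bar> \<le> B" "B \<ge> 0" for g B
    proof (rule integrable_bounded[where B=B])
      show "(\<lambda>a. P a * g a) \<in> borel_measurable q" using that(1) by measurable
      show "\<bar>P a * g a\<bar> \<le> B" for a
      proof (cases "2 * \<bar>a\<bar> \<le> z")
        case True
        then show ?thesis using mult_mono[of "\<bar>P a\<bar>" 1 "\<bar>g a\<bar>" B] P[of a] that by (simp add: abs_mult)
      qed (use that in \<open>simp add: P_def\<close>)
    qed
    have HB: "\<bar>H n y - H n y'\<bar> \<le> 2" for y y' using H_bound[of n y] H_bound[of n y'] by linarith
    have i1: "integrable q (\<lambda>a. (1 - P a) * (H n (x + z + a) - H n (x + a)))"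
    proof (rule integrable_bounded[where B=2])
      show "\<bar>(1 - P a) * (H n (x + z + a) - H n (x + a))\<bar> \<le> 2" for a
        using mult_mono[of "\<bar>1 - P a\<bar>" 1 "\<bar>H n (x + z + a) - H n (x + a)\<bar>" 2] P[of a] HB by (simp add: abs_mult)
    qed measurable
    have i2: "integrable q (\<lambda>a. P a * H n (x + z + a))" "integrable q (\<lambda>a. P a * H n (x + z - a))" "integrable q (\<lambda>a. P a * H n (x + a))"
      by (rule intP[of _ 1]; use H_bound in simp)+
    have iH: "integrable q (\<lambda>a. H n (y + a))" for y
      by (rule integrable_bounded[where B=1]) (use H_bound in auto)
    have "H (Suc n) (x + z) - H (Suc n) x = (\<integral>a. H n (x + z + a) - H n (x + a) \<partial>q)"
      unfolding H_Suc using iH by simp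
    also have "\<dots> = (\<integral>a. (1 - P a) * (H n (x + z + a) - H n (x + a)) + (P a * H n (x + z + a) - P a * H n (x + a)) \<partial>q)"
      by (rule Bochner_Integration.integral_cong) (auto simp: algebra_simps)
    also have "\<dots> = (\<integral>a. (1 - P a) * (H n (x + z + a) - H n (x + a)) \<partial>q) + ((\<integral>a. P a * H n (x + z + a) \<partial>q) - (\<integral>a. P a * H n (x + a) \<partial>q))"
      using i1 i2 by simp
    \<comment> \<open>Only the walk from \<open>x + z\<close> is reflected, and only on the part
      weighted by \<open>P\<close>; the symmetry of that part leaves its mean unchanged.\<close>
    also have "(\<integral>a. P a * H n (x + z + a) \<partial>q) = (\<integral>a. P a * H n (x + z - a) \<partial>q)"
      using Psym[of "\<lambda>a. H n (x + z + a)" 1] H_bound by simp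
    also have "(\<integral>a. (1 - P a) * (H n (x + z + a) - H n (x + a)) \<partial>q) + ((\<integral>a. P a * H n (x + z - a) \<partial>q) - (\<integral>a. P a * H n (x + a) \<partial>q))
        = (\<integral>a. (1 - P a) * (H n (x + z + a) - H n (x + a)) + (P a * H n (x + z - a) - P a * H n (x + a)) \<partial>q)"
      using i1 i2 by simp
    finally have eq: "H (Suc n) (x + z) - H (Suc n) x = (\<integral>a. (1 - P a) * (H n (x + z + a) - H n (x + a)) + (P a * H n (x + z - a) - P a * H n (x + a)) \<partial>q)" .
    define B where "B z = L * r + 2 * z + c * w z" for z
    have wB: "\<bar>w (z - 2 * a) - w z\<bar> \<le> W" for a using w_bounds[of z] w_bounds[of "z - 2 * a"] by linarith
    have W0: "W \<ge> 0" using w_bounds[of 0] by linarith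
    have i3: "integrable q (\<lambda>a. P a * (w (z - 2 * a) - w z))" by (rule intP[of _ W]) (use wB W0 in auto)
    have i4: "integrable q (\<lambda>a. P a * a)" by (rule intP[of _ 1]) (use 4 in auto)
    have P1: "(\<integral>a. P a * a \<partial>q) = 0"
    proof -
      have "(\<integral>a. P a * a \<partial>q) = (\<integral>a. P a * (- a) \<partial>q)" by (rule Psym[of _ 1]) (use 4 in auto)
      then show ?thesis by simp
    qed
    \<comment> \<open>The induction hypothesis gives a mixture of \<open>B z\<close> and
      \<open>B (z - 2 * a)\<close>. Rewritten around \<open>B z\<close>, it separates a term linear
      in \<open>a\<close>, whose integral vanishes by symmetry, from the increment of
      \<open>w\<close>, which \<open>drop\<close> controls.\<close>
    have eB: "B z + (P a * (- 4 * a) + c * (P a * (w (z - 2 * a) - w z))) = (1 - P a) * B z + P a * B (z - 2 * a)" for a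
      by (simp add: B_def algebra_simps)
    have i5: "integrable q (\<lambda>a. B z + (P a * (- 4 * a) + c * (P a * (w (z - 2 * a) - w z))))"
      using integrable_mult_right[of "-4", OF i4] integrable_mult_right[of c, OF i3] by (simp add: mult_ac)
    have "\<bar>H (Suc n) (x + z) - H (Suc n) x\<bar> \<le> (\<integral>a. B z + (P a * (- 4 * a) + c * (P a * (w (z - 2 * a) - w z))) \<partial>q)"
      unfolding eq real_norm_def[symmetric]
    proof (rule Bochner_Integration.integral_norm_bound_integral[OF _ i5])
      show "integrable q (\<lambda>a. (1 - P a) * (H n (x + z + a) - H n (x + a)) + (P a * H n (x + z - a) - P a * H n (x + a)))"
        using i1 i2 by simp
      fix a
      have "\<bar>(1 - P a) * (H n (x + z + a) - H n (x + a))\<bar> \<le> (1 - P a) * B z"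
        unfolding abs_mult using P[of a] Suc.IH[of z "x + a"] Suc.prems
        by (intro mult_mono) (auto simp: B_def c_def add_ac)
      moreover have "\<bar>P a * H n (x + z - a) - P a * H n (x + a)\<bar> \<le> P a * B (z - 2 * a)"
      proof (cases "2 * \<bar>a\<bar> \<le> z")
        case True
        then have "0 \<le> z - 2 * a" by linarith
        from Suc.IH[OF this, of "x + a"] have "\<bar>H n (x + z - a) - H n (x + a)\<bar> \<le> B (z - 2 * a)"
          by (simp add: B_def c_def algebra_simps)
        then show ?thesis unfolding right_diff_distrib[symmetric] abs_mult using P[of a] by (intro mult_mono) auto
      qed (simp add: P_def)
      ultimately show "norm ((1 - P a) * (H n (x + z + a) - H n (x + a)) + (P a * H n (x + z - a) - P a * H n (x + a)))
          \<le> B z + (P a * (- 4 * a) + c * (P a * (w (z - 2 * a) - w z)))"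
        unfolding eB real_norm_def by linarith
    qed
    also have "\<dots> = B z + c * (\<integral>a. P a * (w (z - 2 * a) - w z) \<partial>q)"
    proof -
      have "(\<integral>a. B z + (P a * (- 4 * a) + c * (P a * (w (z - 2 * a) - w z))) \<partial>q)
        = (\<integral>a. B z + (- 4 * (P a * a) + c * (P a * (w (z - 2 * a) - w z))) \<partial>q)"
        by (rule Bochner_Integration.integral_cong) auto
      also have "\<dots> = B z + (- 4 * (\<integral>a. P a * a \<partial>q) + c * (\<integral>a. P a * (w (z - 2 * a) - w z) \<partial>q))"
        using i3 i4 by (simp add: prob_space)
      finally show ?thesis by (simp add: P1)
    qed
    also have "\<dots> \<le> B z + c * (- \<kappa>)"
      using drop[OF 4(1,2)] c0 unfolding P_def by (intro add_left_mono mult_left_mono)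
    also have "\<dots> \<le> L * r + 2 * z + 2 / (\<kappa> * (real (Suc n) + 1)) * w z"
    proof -
      have "c * (w z - \<kappa>) \<le> 2 / (\<kappa> * (real (Suc n) + 1)) * w z"
      proof -
        \<comment> \<open>This is equivalent to \<open>w z \<le> \<kappa> * (real n + 2)\<close>. It
          is a discrete form of the decay in time: losing \<open>\<kappa>\<close> per step improves
          the factor \<open>1 / (real n + 1)\<close> to \<open>1 / (real n + 2)\<close>.\<close>
        have "(w z - \<kappa>) * (real n + 2) \<le> w z * (real n + 1)"
          using 4(3) by (simp add: algebra_simps)
        then have "(w z - \<kappa>) / (real n + 1) \<le> w z / (real n + 2)"
          by (subst pos_divide_le_eq, simp, subst times_divide_eq_left, subst pos_le_divide_eq) simp_all
        then have "(2 / \<kappa>) * ((w z - \<kappa>) / (real n + 1)) \<le> (2 / \<kappa>) * (w z / (real n + 2))"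
          using \<kappa> by (intro mult_left_mono) auto
        then show ?thesis by (simp add: c_def add_ac)
      qed
      then show ?thesis by (simp add: B_def algebra_simps)
    qed
    finally show ?thesis .
  qed
qed

text \<open>Dividing the Poisson weights by \<open>real n + 1\<close> shifts the index in the
  exponential series, so the mean is \<open>(1 - exp (- \<Lambda>)) / \<Lambda>\<close>.\<close>

lemma pois_inverse: 
  assumes "\<Lambda> > 0"
  shows "(\<integral>n. 1 / (real n + 1) \<partial>measure_pmf (pois \<Lambda>)) \<le> 1 / \<Lambda>"
proof -
  have s: "(\<lambda>n. (\<Lambda> ^ n / fact n * exp (-\<Lambda>)) *\<^sub>R (1 / (real n + 1))) sums (\<integral>n. 1 / (real n + 1) \<partial>measure_pmf (pois \<Lambda>))"
    by (rule integral_pois[where B=1]) (use assms in auto)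
  have "(\<lambda>n. \<Lambda> ^ n /\<^sub>R fact n) sums exp \<Lambda>" by (rule exp_converges)
  then have "(\<lambda>n. \<Lambda> ^ Suc n /\<^sub>R fact (Suc n)) sums (exp \<Lambda> - 1)"
    by (subst sums_Suc_iff) simp
  then have "(\<lambda>n. exp (-\<Lambda>) / \<Lambda> * (\<Lambda> ^ Suc n /\<^sub>R fact (Suc n))) sums (exp (-\<Lambda>) / \<Lambda> * (exp \<Lambda> - 1))"
    by (rule sums_mult)
  also have "(\<lambda>n. exp (-\<Lambda>) / \<Lambda> * (\<Lambda> ^ Suc n /\<^sub>R fact (Suc n))) = (\<lambda>n. (\<Lambda> ^ n / fact n * exp (-\<Lambda>)) *\<^sub>R (1 / (real n + 1)))"
    using assms by (auto simp: fun_eq_iff field_simps)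
  finally have "(\<integral>n. 1 / (real n + 1) \<partial>measure_pmf (pois \<Lambda>)) = exp (-\<Lambda>) / \<Lambda> * (exp \<Lambda> - 1)"
    by (rule sums_unique2[OF s])
  also have "\<dots> = (1 - exp (-\<Lambda>)) / \<Lambda>"
  proof -
    have "exp (-\<Lambda>) * exp \<Lambda> = 1" by (simp add: exp_minus)
    then have "exp (-\<Lambda>) * (exp \<Lambda> - 1) = 1 - exp (-\<Lambda>)" by (simp add: right_diff_distrib)
    then show ?thesis by simp
  qed
  also have "\<dots> \<le> 1 / \<Lambda>" using assms by (intro divide_right_mono) auto
  finally show ?thesis .
qed

text \<open>The bound for \<open>n\<close> steps is averaged over the Poisson number of steps, which
  turns \<open>1 / (real n + 1)\<close> into at most \<open>1 / \<Lambda>\<close>.\<close>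

lemma cloud_translate:
  assumes "\<Lambda> > 0" "0 \<le> z"
  shows "\<bar>(\<integral>\<omega>. h (x + z + (\<Sum>i<fst \<omega>. snd \<omega> i)) \<partial>cloud \<Lambda> q) - (\<integral>\<omega>. h (x + (\<Sum>i<fst \<omega>. snd \<omega> i)) \<partial>cloud \<Lambda> q)\<bar>
    \<le> L * r + 2 * z + 2 * w z / (\<kappa> * \<Lambda>)"
proof -
  interpret Q: prob_space "PiM UNIV (\<lambda>_::nat. q)" by (rule S_prob)
  interpret C: prob_space "cloud \<Lambda> q" by (rule prob_space_cloud) (rule prob_space_axioms)
  interpret pair_prob_space "measure_pmf (pois \<Lambda>)" "PiM UNIV (\<lambda>_::nat. q)" ..
  have eq: "(\<integral>\<omega>. h (x + (\<Sum>i<fst \<omega>. snd \<omega> i)) \<partial>cloud \<Lambda> q) = (\<integral>n. H n x \<partial>measure_pmf (pois \<Lambda>))" for x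
  proof -
    have [measurable]: "(\<lambda>\<omega>. \<Sum>i<fst \<omega>. snd \<omega> i) \<in> borel_measurable (cloud \<Lambda> q)"
      using measurable_cloud_sum[of "\<lambda>x. x" q \<Lambda>] by simp
    have "integrable (cloud \<Lambda> q) (\<lambda>\<omega>. h (x + (\<Sum>i<fst \<omega>. snd \<omega> i)))"
      by (rule C.integrable_const_bound[where B=1]) (use h1 in auto)
    then show ?thesis unfolding cloud_def H_def by (subst integral_fst'[symmetric]) auto
  qed
  have iH: "integrable (measure_pmf (pois \<Lambda>)) (\<lambda>n. H n x)" for x
    by (rule measure_pmf.integrable_const_bound[where B=1]) (use H_bound in auto)
  have ii: "integrable (measure_pmf (pois \<Lambda>)) (\<lambda>n. 1 / (real n + 1))"
    by (rule measure_pmf.integrable_const_bound[where B=1]) auto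
  have i6: "integrable (measure_pmf (pois \<Lambda>)) (\<lambda>n. L * r + 2 * z + (2 * w z / \<kappa>) * (1 / (real n + 1)))"
    by (intro Bochner_Integration.integrable_add integrable_mult_right ii) auto
  have "\<bar>(\<integral>n. H n (x + z) \<partial>measure_pmf (pois \<Lambda>)) - (\<integral>n. H n x \<partial>measure_pmf (pois \<Lambda>))\<bar>
     = norm (\<integral>n. H n (x + z) - H n x \<partial>measure_pmf (pois \<Lambda>))"
    using iH by simp
  also have "\<dots> \<le> (\<integral>n. L * r + 2 * z + (2 * w z / \<kappa>) * (1 / (real n + 1)) \<partial>measure_pmf (pois \<Lambda>))"
  proof (rule order_trans[OF integral_norm_bound integral_mono])
    show "norm (H n (x + z) - H n x) \<le> L * r + 2 * z + (2 * w z / \<kappa>) * (1 / (real n + 1))" for n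
      using H_translate[OF assms(2), of n x] by (simp add: mult_ac)
  qed (use iH i6 in auto)
  also have "\<dots> = L * r + 2 * z + (2 * w z / \<kappa>) * (\<integral>n. 1 / (real n + 1) \<partial>measure_pmf (pois \<Lambda>))"
    by (subst Bochner_Integration.integral_add[OF _ integrable_mult_right[OF ii]], simp, subst integral_mult_right_zero) simp
  also have "\<dots> \<le> L * r + 2 * z + (2 * w z / \<kappa>) * (1 / \<Lambda>)"
    using \<kappa> w_bounds(1)[of z] by (intro add_left_mono mult_left_mono pois_inverse assms) auto
  finally show ?thesis unfolding eq by simp
qed

end

section \<open>The condition on the small jumps\<close>

locale small_jump_condition =
  fixes \<nu> :: "real measure"
  assumes levy: "levy_measure \<nu>"
    and condition: "(\<integral>\<^sup>+ r. ennreal r / (\<integral>\<^sup>+ x. ennreal (x\<^sup>2) * indicator {0<..r} x \<partial>min_measure \<nu> (reflect_measure \<nu>)) * indicator {0<..1} r \<partial>lborel) < \<infinity>"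
begin

abbreviation "\<rho> \<equiv> min_measure \<nu> (reflect_measure \<nu>)"

definition \<eta> :: "real \<Rightarrow> ennreal" where
  "\<eta> r = (\<integral>\<^sup>+ x. ennreal (x\<^sup>2) * indicator {0<..r} x \<partial>\<rho>)"

lemma sets_\<nu>[measurable_cong]: "sets \<nu> = sets borel" by (rule levy_measure_sets[OF levy])

lemma space_\<nu>[simp]: "space \<nu> = UNIV" using sets_eq_imp_space_eq[OF sets_\<nu>] by simp

lemma sets_\<rho>[measurable_cong]: "sets \<rho> = sets borel"
  unfolding min_measure_def by (simp add: sets_measure_of_conv sets.sigma_sets_eq[of borel, simplified])

text \<open>The value of a measure introduced by \<open>measure_of\<close> is either the given set
  function or \<open>0\<close>, so the upper bound holds before countable additivity is
  examined.\<close>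

lemma \<rho>_le:
  assumes A: "A \<in> sets borel" and B: "B \<in> sets borel" "B \<subseteq> A"
  shows "emeasure \<rho> A \<le> emeasure \<nu> B + emeasure (reflect_measure \<nu>) (A - B)"
proof -
  have "emeasure \<rho> A \<le> (\<Sqinter>B\<in>{B. B \<in> sets borel \<and> B \<subseteq> A}. emeasure \<nu> B + emeasure (reflect_measure \<nu>) (A - B))"
    unfolding min_measure_def emeasure_measure_of_conv by simp
  also have "\<dots> \<le> emeasure \<nu> B + emeasure (reflect_measure \<nu>) (A - B)"
    by (rule INF_lower) (use B in auto)
  finally show ?thesis .
qed

lemma \<rho>_le_\<nu>: "\<rho> \<le> \<nu>"
proof (subst le_measure)
  show "sets \<rho> = sets \<nu>" by (simp add: sets_\<rho> sets_\<nu>)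
  show "\<forall>A\<in>sets \<rho>. emeasure \<rho> A \<le> emeasure \<nu> A"
  proof
    fix A assume "A \<in> sets \<rho>"
    then show "emeasure \<rho> A \<le> emeasure \<nu> A" using \<rho>_le[of A A] by (simp add: sets_\<rho>)
  qed
qed

lemma \<eta>_mono: "r \<le> s \<Longrightarrow> \<eta> r \<le> \<eta> s"
  unfolding \<eta>_def by (intro nn_integral_mono) (auto simp: indicator_def)

lemma \<eta>_le: "\<eta> r \<le> (\<integral>\<^sup>+ x. ennreal (x\<^sup>2) * indicator {x. \<bar>x\<bar> \<le> r} x \<partial>\<nu>)"
proof -
  have "\<eta> r \<le> (\<integral>\<^sup>+ x. ennreal (x\<^sup>2) * indicator {0<..r} x \<partial>\<nu>)"
    unfolding \<eta>_def by (intro nn_integral_mono_measure \<rho>_le_\<nu>) (simp add: sets_\<rho> sets_\<nu>)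
  also have "\<dots> \<le> (\<integral>\<^sup>+ x. ennreal (x\<^sup>2) * indicator {x. \<bar>x\<bar> \<le> r} x \<partial>\<nu>)"
    by (intro nn_integral_mono) (auto simp: indicator_def)
  finally show ?thesis .
qed

lemma \<eta>_finite: "r \<le> 1 \<Longrightarrow> \<eta> r < \<infinity>"
proof -
  assume "r \<le> 1"
  have "\<eta> r \<le> (\<integral>\<^sup>+ x. ennreal (x\<^sup>2) * indicator {x. \<bar>x\<bar> \<le> r} x \<partial>\<nu>)" by (rule \<eta>_le)
  also have "\<dots> \<le> (\<integral>\<^sup>+ x. ennreal (min 1 (x\<^sup>2)) \<partial>\<nu>)"
  proof (rule nn_integral_mono)
    fix x :: real
    show "ennreal (x\<^sup>2) * indicator {x. \<bar>x\<bar> \<le> r} x \<le> ennreal (min 1 (x\<^sup>2))"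
    proof (cases "\<bar>x\<bar> \<le> r")
      case True
      then have "x\<^sup>2 \<le> 1" using \<open>r \<le> 1\<close> abs_square_le_1[of x] by linarith
      then show ?thesis using True by (simp add: min_def)
    qed simp
  qed
  also have "\<dots> < \<infinity>" using levy by (simp add: levy_measure_def)
  finally show ?thesis .
qed

lemma condition': "(\<integral>\<^sup>+ r. ennreal r / \<eta> r * indicator {0<..1} r \<partial>lborel) < \<infinity>"
  using condition by (simp add: \<eta>_def)

text \<open>If \<open>\<eta>\<close> vanished at some \<open>r > 0\<close>, it would vanish on an
  interval next to \<open>0\<close>; there the quotient \<open>ennreal u / \<eta> u\<close> is
  infinite, and so would be the integral in the hypothesis.\<close>

lemma \<eta>_pos: "0 < r \<Longrightarrow> 0 < \<eta> r"
proof (rule ccontr)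
  assume "0 < r" "\<not> 0 < \<eta> r"
  define s where "s = min r 1"
  have s: "0 < s" "s \<le> 1" "s \<le> r" using \<open>0 < r\<close> by (auto simp: s_def)
  have z: "\<eta> u = 0" if "u \<le> s" for u
    using \<eta>_mono[of u r] that s \<open>\<not> 0 < \<eta> r\<close> by (auto simp: not_less)
  have "\<infinity> * emeasure lborel {0<..s} = (\<integral>\<^sup>+ u. \<infinity> * indicator {0<..s} u \<partial>lborel)"
    by (rule nn_integral_cmult_indicator[symmetric]) simp
  also have "\<dots> \<le> (\<integral>\<^sup>+ r. ennreal r / \<eta> r * indicator {0<..1} r \<partial>lborel)"
    using s z by (intro nn_integral_mono) (auto simp: indicator_def ennreal_divide_zero)
  also have "\<dots> < \<infinity>" by (rule condition')
  finally show False using s by (simp add: ennreal_top_mult)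
qed

text \<open>The real-valued form of \<open>\<eta>\<close>. Beyond \<open>1\<close> finiteness is not
  guaranteed; the cap keeps \<open>e\<close> finite and monotone on the whole line.\<close>

definition e :: "real \<Rightarrow> real" where "e u = enn2real (\<eta> (min u 1))"

lemma e_eq: "u \<le> 1 \<Longrightarrow> \<eta> u = ennreal (e u)"
  unfolding e_def using \<eta>_finite[of u] by (simp add: min_absorb1)

lemma e_pos: "0 < u \<Longrightarrow> 0 < e u"
  unfolding e_def using \<eta>_finite[of "min u 1"] \<eta>_pos[of "min u 1"] by (auto simp: enn2real_positive_iff)

lemma e_mono: "u \<le> v \<Longrightarrow> e u \<le> e v"
  unfolding e_def using \<eta>_finite[of "min v 1"] by (intro enn2real_mono \<eta>_mono) auto

lemma e_nonneg: "0 \<le> e u" by (simp add: e_def)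

lemma e_measurable[measurable]: "e \<in> borel_measurable borel"
  by (rule borel_measurable_mono) (simp add: mono_def e_mono)

lemma e_small: "\<delta> > 0 \<Longrightarrow> \<exists>c0>0. \<forall>c. c \<le> c0 \<longrightarrow> e c \<le> \<delta>"
proof -
  assume "\<delta> > 0"
  from levy_measure_small_jumps[OF levy zero_less_one this]
  obtain c where c: "c > 0" "c \<le> 1" "(\<integral>\<^sup>+x. ennreal (x\<^sup>2) * indicator {x. \<bar>x\<bar> \<le> c} x \<partial>\<nu>) \<le> ennreal \<delta>" by blast
  have "ennreal (e c) \<le> ennreal \<delta>"
    using order_trans[OF \<eta>_le c(3)] e_eq[OF c(2)] by simp
  then have "e c \<le> \<delta>" using \<open>\<delta> > 0\<close> by (simp add: ennreal_le_iff)
  then show ?thesis using c(1) e_mono order_trans by blast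
qed

text \<open>Concavity of \<open>w\<close> is what makes a reflected jump decrease it on average.\<close>

definition f0 :: "real \<Rightarrow> real" where "f0 u = indicator {0<..1/2} u * (2 * u / e u)"
definition fz :: "real \<Rightarrow> real \<Rightarrow> real" where "fz z u = indicator {0<..1/2} u * (min (max z 0) (2 * u) / e u)"
definition w :: "real \<Rightarrow> real" where "w z = (\<integral>u. fz z u \<partial>lborel)"

text \<open>The hypothesis in real form. \<open>f0\<close> dominates every \<open>fz z\<close>,
  which makes \<open>w\<close> finite and bounded and lets it tend to \<open>0\<close> by dominated
  convergence.\<close>

lemma integrable_f0: "integrable lborel f0"
proof (rule integrableI_nonneg)
  show "f0 \<in> borel_measurable lborel" unfolding f0_def by measurable
  show "AE u in lborel. 0 \<le> f0 u" by (auto simp: f0_def indicator_def e_nonneg)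
  have eq: "(\<integral>\<^sup>+ u. ennreal u / \<eta> u * indicator {0<..1} u \<partial>lborel) = (\<integral>\<^sup>+ u. ennreal (indicator {0<..1} u * (u / e u)) \<partial>lborel)"
  proof (rule nn_integral_cong)
    fix u :: real
    show "ennreal u / \<eta> u * indicator {0<..1} u = ennreal (indicator {0<..1} u * (u / e u))"
      using e_pos[of u] by (cases "u \<in> {0<..1}") (auto simp: e_eq divide_ennreal)
  qed
  have "(\<integral>\<^sup>+ u. ennreal (f0 u) \<partial>lborel) \<le> (\<integral>\<^sup>+ u. ennreal 2 * ennreal (indicator {0<..1} u * (u / e u)) \<partial>lborel)"
  proof (rule nn_integral_mono)
    fix u :: real
    have "f0 u \<le> 2 * (indicator {0<..1} u * (u / e u))"
      by (cases "u \<in> {0<..1/2}") (auto simp: f0_def indicator_def e_nonneg)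
    then show "ennreal (f0 u) \<le> ennreal 2 * ennreal (indicator {0<..1} u * (u / e u))"
      by (subst ennreal_mult[symmetric]) (auto simp: indicator_def e_nonneg intro!: ennreal_leI)
  qed
  also have "\<dots> = ennreal 2 * (\<integral>\<^sup>+ u. ennreal (indicator {0<..1} u * (u / e u)) \<partial>lborel)"
    by (rule nn_integral_cmult) measurable
  also have "\<dots> < \<infinity>" using condition' unfolding eq by (auto simp: ennreal_mult_less_top)
  finally show "(\<integral>\<^sup>+ u. ennreal (f0 u) \<partial>lborel) < \<infinity>" .
qed

lemma fz_bounds: "0 \<le> fz z u" "fz z u \<le> f0 u"
proof -
  show "0 \<le> fz z u" by (auto simp: fz_def indicator_def e_nonneg)
  show "fz z u \<le> f0 u" unfolding fz_def f0_def
    by (intro mult_left_mono divide_right_mono) (auto simp: e_nonneg)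
qed

lemma integrable_fz: "integrable lborel (fz z)"
proof (rule Bochner_Integration.integrable_bound[OF integrable_f0])
  show "fz z \<in> borel_measurable lborel" unfolding fz_def by measurable
  show "AE u in lborel. norm (fz z u) \<le> norm (f0 u)"
  proof (rule AE_I2)
    fix u show "norm (fz z u) \<le> norm (f0 u)" using fz_bounds[of z u] by simp
  qed
qed

lemma w_mono: "z \<le> z' \<Longrightarrow> w z \<le> w z'"
  unfolding w_def
proof (rule integral_mono[OF integrable_fz integrable_fz])
  fix u assume "z \<le> z'"
  then show "fz z u \<le> fz z' u"
    unfolding fz_def by (intro mult_left_mono divide_right_mono) (auto simp: e_nonneg)
qed

lemma w_measurable[measurable]: "w \<in> borel_measurable borel"
  by (rule borel_measurable_mono) (simp add: mono_def w_mono)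

lemma w_bounds: "0 \<le> w z" "w z \<le> (\<integral>u. f0 u \<partial>lborel)"
  unfolding w_def using fz_bounds by (auto intro!: integral_nonneg_AE integral_mono integrable_fz integrable_f0)

lemma w_tendsto_0: "\<delta> > 0 \<Longrightarrow> \<exists>z0>0. \<forall>z\<le>z0. w z \<le> \<delta>"
proof -
  assume \<delta>: "\<delta> > 0"
  have "(\<lambda>n. \<integral>u. fz (1 / real (Suc n)) u \<partial>lborel) \<longlonglongrightarrow> (\<integral>u. 0 \<partial>(lborel :: real measure))"
  proof (rule integral_dominated_convergence[where w=f0])
    show "integrable lborel f0" by (rule integrable_f0)
    show "AE u in lborel. (\<lambda>n. fz (1 / real (Suc n)) u) \<longlonglongrightarrow> 0"
    proof (rule AE_I2)
      fix u :: real
      have "(\<lambda>n. indicator {0<..1/2} u * (min (max (1 / real (Suc n)) 0) (2 * u) / e u)) \<longlonglongrightarrow> indicator {0<..1/2} u * (min (max 0 0) (2 * u) / e u)"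
        unfolding divide_inverse[of _ "e u"]
        by (intro tendsto_mult tendsto_min tendsto_max tendsto_const LIMSEQ_Suc[OF lim_1_over_n])
      also have "indicator {0<..1/2} u * (min (max 0 0) (2 * u) / e u) = (0 :: real)" by (auto simp: indicator_def)
      finally show "(\<lambda>n. fz (1 / real (Suc n)) u) \<longlonglongrightarrow> 0" by (simp add: fz_def)
    qed
    show "AE u in lborel. norm (fz (1 / real (Suc n)) u) \<le> f0 u" for n
      using fz_bounds by (intro AE_I2) simp
    show "fz (1 / real (Suc n)) \<in> borel_measurable lborel" for n using integrable_fz by blast
  qed simp
  then have "(\<lambda>n. w (1 / real (Suc n))) \<longlonglongrightarrow> 0" by (simp add: w_def)
  from order_tendstoD(2)[OF this \<delta>] obtain n where "w (1 / real (Suc n)) < \<delta>"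
    by (auto simp: eventually_sequentially)
  then have "\<forall>z\<le>1 / real (Suc n). w z \<le> \<delta>" using w_mono by (meson less_imp_le order_trans)
  then show ?thesis by (intro exI[of _ "1 / real (Suc n)"]) simp
qed

text \<open>For each \<open>u\<close> the function \<open>min z (2 * u)\<close> is concave in
  \<open>z\<close>, so its second difference is at most \<open>0\<close>. With step
  \<open>2 * b\<close>, where \<open>b = \<bar>a\<bar>\<close>, it is at most \<open>- b\<close> for
  \<open>u\<close> between \<open>(z - b) / 2\<close> and \<open>z / 2\<close>. That interval has
  length \<open>b / 2\<close>, and on it \<open>1 / e u\<close> is at least
  \<open>1 / e (z / 2)\<close>.\<close>

lemma w_second_difference:
  assumes z: "0 < z" "z < 1" and a: "2 * \<bar>a\<bar> \<le> z"
  shows "w (z + 2 * a) + w (z - 2 * a) - 2 * w z \<le> - (a\<^sup>2 / 2) / e (z / 2)"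
proof -
  define b where "b = \<bar>a\<bar>"
  have b: "0 \<le> b" "2 * b \<le> z" using a by (auto simp: b_def)
  have "w (z + 2 * a) + w (z - 2 * a) = w (z + 2 * b) + w (z - 2 * b)"
    by (cases "a \<ge> 0") (auto simp: b_def)
  moreover have "w (z + 2 * b) + w (z - 2 * b) - 2 * w z = (\<integral>u. fz (z + 2 * b) u + fz (z - 2 * b) u - 2 * fz z u \<partial>lborel)"
    unfolding w_def using integrable_fz by simp
  moreover have "(\<integral>u. fz (z + 2 * b) u + fz (z - 2 * b) u - 2 * fz z u \<partial>lborel) \<le> (\<integral>u. (- b / e (z / 2)) * indicator {(z - b) / 2..z / 2} u \<partial>lborel)"
  proof (rule integral_mono)
    show "integrable lborel (\<lambda>u. (- b / e (z / 2)) * indicator {(z - b) / 2..z / 2} u)"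
      by (intro integrable_mult_right integrable_real_indicator) (auto simp: b)
    show "integrable lborel (\<lambda>u. fz (z + 2 * b) u + fz (z - 2 * b) u - 2 * fz z u)" using integrable_fz by auto
    fix u :: real
    show "fz (z + 2 * b) u + fz (z - 2 * b) u - 2 * fz z u \<le> (- b / e (z / 2)) * indicator {(z - b) / 2..z / 2} u"
    proof (cases "u \<in> {0<..1/2}")
      case True
      then have eu: "0 < e u" using e_pos by simp
      have eq: "fz (z + 2 * b) u + fz (z - 2 * b) u - 2 * fz z u = (min (z + 2 * b) (2 * u) + min (z - 2 * b) (2 * u) - 2 * min z (2 * u)) / e u"
        using True b z by (simp add: fz_def add_divide_distrib diff_divide_distrib)
      show ?thesis
      proof (cases "u \<in> {(z - b) / 2..z / 2}")
        case True
        then have "min (z + 2 * b) (2 * u) + min (z - 2 * b) (2 * u) - 2 * min z (2 * u) \<le> - b"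
          using b by (auto simp: min_def)
        then have "(min (z + 2 * b) (2 * u) + min (z - 2 * b) (2 * u) - 2 * min z (2 * u)) / e u \<le> - b / e u"
          using eu by (intro divide_right_mono) auto
        also have "\<dots> \<le> - b / e (z / 2)"
          using eu b True e_mono[of u "z / 2"] by (auto intro!: divide_left_mono mult_pos_pos e_pos z)
        finally show ?thesis using True eq by simp
      next
        case False
        have "min (z + 2 * b) (2 * u) + min (z - 2 * b) (2 * u) - 2 * min z (2 * u) \<le> 0"
          using b by (auto simp: min_def)
        then show ?thesis using False eq eu by (simp add: divide_nonpos_pos)
      qed
    next
      case False
      \<comment> \<open>\<open>z < 1\<close> keeps the interval below \<open>1 / 2\<close>, and
        \<open>2 * b \<le> z\<close> with \<open>0 < z\<close> keeps it away from \<open>0\<close>,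
        so it lies in the range where \<open>fz\<close> is supported.\<close>
      then have "u \<notin> {(z - b) / 2..z / 2}" using b z by auto
      then show ?thesis using False by (simp add: fz_def)
    qed
  qed
  moreover have "(\<integral>u. (- b / e (z / 2)) * indicator {(z - b) / 2..z / 2} u \<partial>lborel) = (- b / e (z / 2)) * (b / 2)"
    using b by (subst integral_mult_right_zero) (simp add: field_simps)
  moreover have "(- b / e (z / 2)) * (b / 2) = - (a\<^sup>2 / 2) / e (z / 2)"
    by (simp add: b_def power2_eq_square)
  ultimately show ?thesis by linarith
qed

section \<open>The truncated Levy measure and its symmetric part\<close>

definition big :: "real \<Rightarrow> real set" where "big c = {x. \<bar>x\<bar> > c}"
definition \<mu> :: "real \<Rightarrow> real measure" where "\<mu> c = density \<nu> (indicator (big c))"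
definition jump_rate :: "real \<Rightarrow> real" where "jump_rate c = measure \<nu> (big c)"
definition jump_law :: "real \<Rightarrow> real measure" where "jump_law c = uniform_measure \<nu> (big c)"

lemma big_sets[measurable]: "big c \<in> sets borel" "big c \<in> sets \<nu>"
  unfolding sets_\<nu> big_def by simp_all

lemma emeasure_big: "c > 0 \<Longrightarrow> emeasure \<nu> (big c) = ennreal (jump_rate c)"
  unfolding jump_rate_def using levy_measure_tail_finite[OF levy, of c]
  by (intro emeasure_eq_ennreal_measure) (auto simp: big_def)

lemma sets_\<mu>[measurable_cong]: "sets (\<mu> c) = sets borel" by (simp add: \<mu>_def sets_\<nu>)

lemma emeasure_\<mu>: "A \<in> sets borel \<Longrightarrow> emeasure (\<mu> c) A = emeasure \<nu> (A \<inter> big c)"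
proof -
  assume A: "A \<in> sets borel"
  have "emeasure (\<mu> c) A = (\<integral>\<^sup>+x. indicator (big c) x * indicator A x \<partial>\<nu>)"
    unfolding \<mu>_def using A by (intro emeasure_density) (auto simp: sets_\<nu>)
  also have "\<dots> = (\<integral>\<^sup>+x. indicator (A \<inter> big c) x \<partial>\<nu>)"
    by (intro nn_integral_cong) (auto simp: indicator_def)
  also have "\<dots> = emeasure \<nu> (A \<inter> big c)" using A by (intro nn_integral_indicator) (auto simp: sets_\<nu>)
  finally show ?thesis .
qed

lemma finite_\<mu>: "c > 0 \<Longrightarrow> finite_measure (\<mu> c)"
proof (rule finite_measureI)
  assume "c > 0"
  have "space (\<mu> c) = UNIV" by (simp add: \<mu>_def)
  then show "emeasure (\<mu> c) (space (\<mu> c)) \<noteq> \<infinity>"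
    using emeasure_\<mu>[of UNIV c] emeasure_big[OF \<open>c > 0\<close>] by simp
qed

text \<open>The symmetric part is the minimum of \<open>\<mu> c\<close> and its reflection, and
  \<open>p\<close> is its density with respect to \<open>\<mu> c\<close>. It dominates
  \<open>\<rho>\<close> on jumps beyond \<open>c\<close>, since one suitable set in the infimum that
  defines \<open>\<rho>\<close> reproduces the splitting of this minimum.\<close>

lemma exists_symmetric_part:
  assumes c: "c > 0"
  shows "\<exists>p. p \<in> borel_measurable borel \<and> (\<forall>x. 0 \<le> p x \<and> p x \<le> (1::real)) \<and>
    (\<forall>g. g \<in> borel_measurable borel \<longrightarrow> (\<integral>x. p x * g x \<partial>\<mu> c) = (\<integral>x. p x * g (- x) \<partial>\<mu> c)) \<and>
    (\<forall>A. A \<in> sets borel \<longrightarrow> A \<subseteq> big c \<longrightarrow> emeasure \<rho> A \<le> (\<integral>\<^sup>+x. ennreal (p x) * indicator A x \<partial>\<mu> c))"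
proof -
  define \<mu>' where "\<mu>' = distr (\<mu> c) borel uminus"
  have sp: "space (\<mu> c) = UNIV" by (simp add: \<mu>_def)
  have sets': "sets \<mu>' = sets (\<mu> c)" by (simp add: \<mu>'_def sets_\<mu>)
  interpret M: finite_measure "\<mu> c" by (rule finite_\<mu>[OF c])
  have "finite_measure \<mu>'" unfolding \<mu>'_def by (rule M.finite_measure_distr) simp
  from overlap_densities[OF M.finite_measure_axioms this sets']
  obtain p b Y where *: "p \<in> borel_measurable (\<mu> c) \<and> b \<in> borel_measurable \<mu>' \<and>
    (\<forall>x. 0 \<le> p x \<and> p x \<le> 1 \<and> 0 \<le> b x \<and> b x \<le> (1::real)) \<and>
    density (\<mu> c) (\<lambda>x. ennreal (p x)) = density \<mu>' (\<lambda>x. ennreal (b x)) \<and>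
    (\<forall>A\<in>sets (\<mu> c). \<forall>B\<in>sets (\<mu> c). emeasure (density (\<mu> c) (\<lambda>x. ennreal (p x))) A \<le> emeasure \<mu>' (A \<inter> B) + emeasure (\<mu> c) (A - B)) \<and>
    Y \<in> sets (\<mu> c) \<and> (\<forall>A\<in>sets (\<mu> c). emeasure (density (\<mu> c) (\<lambda>x. ennreal (p x))) A = emeasure \<mu>' (A \<inter> Y) + emeasure (\<mu> c) (A - Y))"
    by (elim exE)
  define S where "S = density (\<mu> c) (\<lambda>x. ennreal (p x))"
  have sets_S: "sets S = sets borel" by (simp add: S_def sets_\<mu>)
  have min: "emeasure S A \<le> emeasure \<mu>' (A \<inter> B) + emeasure (\<mu> c) (A - B)" if "A \<in> sets borel" "B \<in> sets borel" for A B
    using * that unfolding S_def sets_\<mu> by (elim conjE) (drule (1) bspec, drule (1) bspec)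
  have split: "emeasure S A = emeasure \<mu>' (A \<inter> Y) + emeasure (\<mu> c) (A - Y)" if "A \<in> sets borel" for A
    using * that unfolding S_def sets_\<mu> by (elim conjE) (drule (1) bspec)+
  from * have pm: "p \<in> borel_measurable (\<mu> c)" and p01: "\<And>x. 0 \<le> p x" "\<And>x. p x \<le> 1" and Y: "Y \<in> sets borel"
    by (simp_all add: sets_\<mu>)
  have pb[measurable]: "p \<in> borel_measurable borel" using pm by (simp add: measurable_cong_sets[OF sets_\<mu> refl])
  have um: "uminus -` A \<in> sets borel" if "A \<in> sets borel" for A :: "real set"
    using measurable_sets[of uminus borel borel A] that by simp
  have m': "emeasure \<mu>' A = emeasure (\<mu> c) (uminus -` A)" if "A \<in> sets borel" for A
    unfolding \<mu>'_def using that by (subst emeasure_distr) (auto simp: sp)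
  have le: "emeasure S A \<le> emeasure S (uminus -` A)" if A: "A \<in> sets borel" for A
  proof -
    \<comment> \<open>Tested with the reflected complement of \<open>Y\<close>, the two terms of the
      bound for \<open>A\<close> become, in swapped order, the two terms of the splitting of
      \<open>S\<close> at the reflected \<open>A\<close>. Applied twice, this inequality yields the
      symmetry of \<open>S\<close>.\<close>
    define B where "B = uminus -` (- Y)"
    have B: "B \<in> sets borel" unfolding B_def by (rule um) (use Y in auto)
    have "emeasure S A \<le> emeasure \<mu>' (A \<inter> B) + emeasure (\<mu> c) (A - B)" by (rule min[OF A B])
    also have "emeasure \<mu>' (A \<inter> B) = emeasure (\<mu> c) (uminus -` A - Y)"
      using A B by (subst m') (auto simp: B_def intro!: arg_cong[where f="emeasure (\<mu> c)"])
    also have "emeasure (\<mu> c) (A - B) = emeasure \<mu>' (uminus -` A \<inter> Y)"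
      using um[OF A] Y by (subst m') (auto simp: B_def intro!: arg_cong[where f="emeasure (\<mu> c)"])
    finally show ?thesis using split[OF um[OF A]] by (simp add: add.commute)
  qed
  have eqS: "emeasure S (uminus -` A) = emeasure S A" if A: "A \<in> sets borel" for A
  proof (rule antisym)
    have "uminus -` (uminus -` A) = A" by auto
    then show "emeasure S (uminus -` A) \<le> emeasure S A" using le[OF um[OF A]] by simp
  qed (rule le[OF A])
  have S': "distr S borel uminus = S"
  proof (rule measure_eqI)
    fix A assume "A \<in> sets (distr S borel uminus)"
    then have A: "A \<in> sets borel" by simp
    have "emeasure (distr S borel uminus) A = emeasure S (uminus -` A \<inter> space S)"
      using A by (subst emeasure_distr) (auto simp: measurable_cong_sets[OF sets_S refl])
    then show "emeasure (distr S borel uminus) A = emeasure S A"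
      using eqS[OF A] by (simp add: S_def sp)
  qed (simp add: sets_S)
  have "(\<integral>x. p x * g x \<partial>\<mu> c) = (\<integral>x. p x * g (- x) \<partial>\<mu> c)" if g[measurable]: "g \<in> borel_measurable borel" for g
  proof -
    have "(\<integral>x. p x * g x \<partial>\<mu> c) = (\<integral>x. g x \<partial>S)"
      unfolding S_def using p01 by (subst integral_density) auto
    also have "\<dots> = (\<integral>x. g x \<partial>distr S borel uminus)" by (simp add: S')
    also have "\<dots> = (\<integral>x. g (- x) \<partial>S)"
      by (subst integral_distr) (auto simp: measurable_cong_sets[OF sets_S refl])
    also have "\<dots> = (\<integral>x. p x * g (- x) \<partial>\<mu> c)"
      unfolding S_def using p01 by (subst integral_density) auto
    finally show ?thesis .
  qed
  moreover have "emeasure \<rho> A \<le> (\<integral>\<^sup>+x. ennreal (p x) * indicator A x \<partial>\<mu> c)" if A: "A \<in> sets borel" "A \<subseteq> big c" for A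
  proof -
    \<comment> \<open>The set \<open>A - Y\<close> in the infimum matches the splitting of
      \<open>S\<close>: the measure itself off \<open>Y\<close>, its reflection on \<open>Y\<close>.
      As \<open>A\<close> lies beyond \<open>c\<close>, truncation changes neither term.\<close>
    have "emeasure \<rho> A \<le> emeasure \<nu> (A - Y) + emeasure (reflect_measure \<nu>) (A - (A - Y))"
      by (rule \<rho>_le) (use A Y in auto)
    also have "emeasure \<nu> (A - Y) = emeasure (\<mu> c) (A - Y)"
      using A Y by (subst emeasure_\<mu>) (auto intro!: arg_cong[where f="emeasure \<nu>"])
    also have "A - (A - Y) = A \<inter> Y" by auto
    also have "emeasure (reflect_measure \<nu>) (A \<inter> Y) = emeasure \<nu> (uminus -` (A \<inter> Y))"
      unfolding reflect_measure_def using A Y by (subst emeasure_distr) (auto simp: measurable_cong_sets[OF sets_\<nu> refl])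
    also have "\<dots> = emeasure \<mu>' (A \<inter> Y)"
    proof -
      have AY: "A \<inter> Y \<in> sets borel" using A Y by auto
      have "uminus -` (A \<inter> Y) \<inter> big c = uminus -` (A \<inter> Y)" using A by (auto simp: big_def)
      then show ?thesis using m'[OF AY] emeasure_\<mu>[OF um[OF AY], of c] by simp
    qed
    finally have "emeasure \<rho> A \<le> emeasure S A" using split[OF A(1)] by (simp add: add.commute)
    also have "\<dots> = (\<integral>\<^sup>+x. ennreal (p x) * indicator A x \<partial>\<mu> c)"
      unfolding S_def using A by (intro emeasure_density) (auto simp: sets_\<mu>)
    finally show ?thesis .
  qed
  ultimately show ?thesis
    by (intro exI[of _ p] conjI allI impI pb p01)
qed

text \<open>Jumps of size at most \<open>c\<close> account for \<open>e c\<close>, larger ones for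
  at most the second moment of the symmetric part. So truncation loses no more than
  \<open>e c\<close>.\<close>

lemma e_le:
  assumes c: "0 < c" "c \<le> s" "s \<le> 1" and p[measurable]: "p \<in> borel_measurable borel" and p01: "\<And>x. 0 \<le> p x" "\<And>x. p x \<le> (1::real)"
    and \<rho>p: "\<And>A. A \<in> sets borel \<Longrightarrow> A \<subseteq> big c \<Longrightarrow> emeasure \<rho> A \<le> (\<integral>\<^sup>+x. ennreal (p x) * indicator A x \<partial>\<mu> c)"
  shows "e s \<le> e c + (\<integral>x. p x * (x\<^sup>2 * indicator {0<..s} x) \<partial>\<mu> c)"
proof -
  interpret M: finite_measure "\<mu> c" by (rule finite_\<mu>[OF c(1)])
  have p0: "0 \<le> p x * (x\<^sup>2 * indicator {0<..s} x)" "p x * (x\<^sup>2 * indicator {0<..s} x) \<le> 1" for x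
  proof -
    show "0 \<le> p x * (x\<^sup>2 * indicator {0<..s} x)" using p01 by simp
    have "x\<^sup>2 * indicator {0<..s} x \<le> 1" using c by (auto simp: indicator_def abs_square_le_1)
    from mult_le_one[OF p01(2) _ this] show "p x * (x\<^sup>2 * indicator {0<..s} x) \<le> 1" by simp
  qed
  have int: "integrable (\<mu> c) (\<lambda>x. p x * (x\<^sup>2 * indicator {0<..s} x))"
    by (rule M.integrable_const_bound[where B=1]) (use p0 in auto)
  define A1 where "A1 = density \<rho> (indicator (big c))"
  define A2 where "A2 = density (\<mu> c) (\<lambda>x. ennreal (p x))"
  have s1: "sets A1 = sets borel" and s2: "sets A2 = sets borel" by (simp_all add: A1_def A2_def sets_\<rho> sets_\<mu>)
  have "A1 \<le> A2"
  proof (subst le_measure)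
    show "sets A1 = sets A2" by (simp add: s1 s2)
    show "\<forall>A\<in>sets A1. emeasure A1 A \<le> emeasure A2 A"
    proof
      fix A assume "A \<in> sets A1"
      then have A: "A \<in> sets borel" by (simp add: s1)
      have "emeasure A1 A = (\<integral>\<^sup>+x. indicator (big c) x * indicator A x \<partial>\<rho>)"
        unfolding A1_def using A by (intro emeasure_density) (auto simp: sets_\<rho>)
      also have "\<dots> = (\<integral>\<^sup>+x. indicator (A \<inter> big c) x \<partial>\<rho>)"
        by (intro nn_integral_cong) (auto simp: indicator_def)
      also have "\<dots> = emeasure \<rho> (A \<inter> big c)" using A by (intro nn_integral_indicator) (auto simp: sets_\<rho>)
      also have "\<dots> \<le> (\<integral>\<^sup>+x. ennreal (p x) * indicator (A \<inter> big c) x \<partial>\<mu> c)"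
        by (rule \<rho>p) (use A in auto)
      also have "\<dots> \<le> (\<integral>\<^sup>+x. ennreal (p x) * indicator A x \<partial>\<mu> c)"
        by (intro nn_integral_mono) (auto simp: indicator_def)
      also have "\<dots> = emeasure A2 A"
        unfolding A2_def using A by (intro emeasure_density[symmetric]) (auto simp: sets_\<mu>)
      finally show "emeasure A1 A \<le> emeasure A2 A" .
    qed
  qed
  then have mono: "(\<integral>\<^sup>+x. ennreal (x\<^sup>2 * indicator {0<..s} x) \<partial>A1) \<le> (\<integral>\<^sup>+x. ennreal (x\<^sup>2 * indicator {0<..s} x) \<partial>A2)"
    by (intro nn_integral_mono_measure) (simp_all add: s1 s2)
  have "\<eta> s = (\<integral>\<^sup>+ x. ennreal (x\<^sup>2) * indicator {0<..c} x + indicator (big c) x * ennreal (x\<^sup>2 * indicator {0<..s} x) \<partial>\<rho>)"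
    unfolding \<eta>_def using c by (intro nn_integral_cong) (auto simp: indicator_def big_def)
  also have "\<dots> = \<eta> c + (\<integral>\<^sup>+ x. indicator (big c) x * ennreal (x\<^sup>2 * indicator {0<..s} x) \<partial>\<rho>)"
    unfolding \<eta>_def by (rule nn_integral_add) measurable
  also have "(\<integral>\<^sup>+ x. indicator (big c) x * ennreal (x\<^sup>2 * indicator {0<..s} x) \<partial>\<rho>) = (\<integral>\<^sup>+x. ennreal (x\<^sup>2 * indicator {0<..s} x) \<partial>A1)"
    unfolding A1_def by (rule nn_integral_density[symmetric]) measurable
  also have "\<eta> c + (\<integral>\<^sup>+x. ennreal (x\<^sup>2 * indicator {0<..s} x) \<partial>A1) \<le> \<eta> c + (\<integral>\<^sup>+x. ennreal (x\<^sup>2 * indicator {0<..s} x) \<partial>A2)"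
    by (intro add_left_mono mono)
  also have "(\<integral>\<^sup>+x. ennreal (x\<^sup>2 * indicator {0<..s} x) \<partial>A2) = (\<integral>\<^sup>+x. ennreal (p x) * ennreal (x\<^sup>2 * indicator {0<..s} x) \<partial>\<mu> c)"
    unfolding A2_def by (rule nn_integral_density) measurable
  also have "\<dots> = (\<integral>\<^sup>+x. ennreal (p x * (x\<^sup>2 * indicator {0<..s} x)) \<partial>\<mu> c)"
    using p01 by (intro nn_integral_cong) (simp add: ennreal_mult)
  also have "\<dots> = ennreal (\<integral>x. p x * (x\<^sup>2 * indicator {0<..s} x) \<partial>\<mu> c)"
    by (rule nn_integral_eq_integral[OF int]) (use p0 in auto)
  finally have "ennreal (e s) \<le> ennreal (e c) + ennreal (\<integral>x. p x * (x\<^sup>2 * indicator {0<..s} x) \<partial>\<mu> c)"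
    using c by (simp add: e_eq)
  also have "\<dots> = ennreal (e c + (\<integral>x. p x * (x\<^sup>2 * indicator {0<..s} x) \<partial>\<mu> c))"
    using p0 by (intro ennreal_plus[symmetric] e_nonneg integral_nonneg_AE) auto
  finally show ?thesis
    using p0 by (subst (asm) ennreal_le_iff) (auto intro!: add_nonneg_nonneg e_nonneg integral_nonneg_AE)
qed

lemma integral_jump_law:
  fixes f :: "real \<Rightarrow> 'b::{banach, second_countable_topology}"
  assumes c: "c > 0" and pos: "jump_rate c > 0" and [measurable]: "f \<in> borel_measurable borel"
  shows "(\<integral>x. f x \<partial>jump_law c) = (1 / jump_rate c) *\<^sub>R (\<integral>x. f x \<partial>\<mu> c)"
proof -
  have "(\<integral>x. f x \<partial>jump_law c) = (\<integral>x. f x \<partial>density \<nu> (\<lambda>x. ennreal (indicator (big c) x / jump_rate c)))"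
    unfolding jump_law_def uniform_measure_def using pos
    by (simp add: emeasure_big[OF c] divide_ennreal[symmetric] ennreal_indicator)
  also have "\<dots> = (\<integral>x. (indicator (big c) x / jump_rate c) *\<^sub>R f x \<partial>\<nu>)"
    by (rule integral_density) (use pos in auto)
  also have "\<dots> = (\<integral>x. (1 / jump_rate c) *\<^sub>R (indicator (big c) x *\<^sub>R f x) \<partial>\<nu>)"
    by (intro Bochner_Integration.integral_cong) auto
  also have "\<dots> = (1 / jump_rate c) *\<^sub>R (\<integral>x. indicator (big c) x *\<^sub>R f x \<partial>\<nu>)"
    by (rule integral_scaleR_right)
  also have "(\<integral>x. indicator (big c) x *\<^sub>R f x \<partial>\<nu>) = (\<integral>x. f x \<partial>density \<nu> (\<lambda>x. ennreal (indicator (big c) x)))"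
    by (rule integral_density[symmetric]) auto
  also have "density \<nu> (\<lambda>x. ennreal (indicator (big c) x)) = \<mu> c"
    unfolding \<mu>_def by (simp add: ennreal_indicator)
  finally show ?thesis .
qed

text \<open>The threshold \<open>c0\<close> depends on \<open>r\<close> only and not on
  \<open>h\<close> or \<open>L\<close>. It is such that the truncated symmetric part keeps at least
  half of \<open>e s\<close> for every \<open>s\<close> in \<open>{s0..1}\<close>. Reflection then
  lowers \<open>w\<close> at rate at least \<open>1 / 8\<close> per unit of time, and a single step
  of the walk takes \<open>1 / jump_rate c\<close> units on average.\<close>

lemma exists_reflected_walk:
  assumes r: "0 < r"
  shows "\<exists>c0>0. \<forall>c. 0 < c \<longrightarrow> c \<le> c0 \<longrightarrow> jump_rate c > 0 \<and>
    (\<forall>h L. h \<in> borel_measurable borel \<longrightarrow> (\<forall>x. \<bar>h x\<bar> \<le> 1) \<longrightarrow> (\<forall>x y. \<bar>h x - h y\<bar> \<le> L * \<bar>x - y\<bar>) \<longrightarrow> L \<ge> 0 \<longrightarrow>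
      (\<exists>p. reflected_walk (jump_law c) p w h (\<integral>u. f0 u \<partial>lborel) (1 / (8 * jump_rate c)) r L))"
proof -
  \<comment> \<open>Distances \<open>z\<close> above \<open>r\<close> involve jumps up to
    \<open>z / 2\<close>, and this is at least \<open>s0\<close>; so one condition at
    \<open>s0\<close> serves all of them by monotonicity of \<open>e\<close>.\<close>
  define s0 where "s0 = min r 1 / 2"
  have s0: "0 < s0" "s0 \<le> r / 2" "s0 \<le> 1 / 2" using r by (auto simp: s0_def)
  have "e s0 / 2 > 0" using e_pos[OF s0(1)] by simp
  from e_small[OF this] obtain c1 where c1: "c1 > 0" "\<And>c. c \<le> c1 \<Longrightarrow> e c \<le> e s0 / 2" by blast
  define c0 where "c0 = min c1 s0"
  have "jump_rate c > 0 \<and>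
    (\<forall>h L. h \<in> borel_measurable borel \<longrightarrow> (\<forall>x. \<bar>h x\<bar> \<le> 1) \<longrightarrow> (\<forall>x y. \<bar>h x - h y\<bar> \<le> L * \<bar>x - y\<bar>) \<longrightarrow> L \<ge> 0 \<longrightarrow>
      (\<exists>p. reflected_walk (jump_law c) p w h (\<integral>u. f0 u \<partial>lborel) (1 / (8 * jump_rate c)) r L))"
    if c: "0 < c" "c \<le> c0" for c
  proof -
    have cs: "c \<le> s0" "e c \<le> e s0 / 2" using c c1 by (auto simp: c0_def)
    interpret M: finite_measure "\<mu> c" by (rule finite_\<mu>[OF c(1)])
    from exists_symmetric_part[OF c(1)] obtain p where p[measurable]: "p \<in> borel_measurable borel"
      and p01': "\<forall>x. 0 \<le> p x \<and> p x \<le> (1::real)"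
      and refl: "\<forall>g. g \<in> borel_measurable borel \<longrightarrow> (\<integral>x. p x * g x \<partial>\<mu> c) = (\<integral>x. p x * g (- x) \<partial>\<mu> c)"
      and \<rho>p: "\<forall>A. A \<in> sets borel \<longrightarrow> A \<subseteq> big c \<longrightarrow> emeasure \<rho> A \<le> (\<integral>\<^sup>+x. ennreal (p x) * indicator A x \<partial>\<mu> c)"
      by (elim exE conjE)
    have p01: "0 \<le> p x" "p x \<le> 1" for x using p01' by auto
    have e_le': "e s \<le> e c + (\<integral>x. p x * (x\<^sup>2 * indicator {0<..s} x) \<partial>\<mu> c)" if "s0 \<le> s" "s \<le> 1" for s
      by (rule e_le[OF c(1) _ that(2) p p01]) (use \<rho>p that cs in auto)
    have half: "e s / 2 \<le> (\<integral>x. p x * (x\<^sup>2 * indicator {0<..s} x) \<partial>\<mu> c)" if "s0 \<le> s" "s \<le> 1" for s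
      using e_le'[OF that] cs(2) e_mono[OF that(1)] by linarith
    \<comment> \<open>Without jumps beyond \<open>c\<close> the symmetric part would be zero,
      against \<open>half\<close> and the positivity of \<open>e s0\<close>.\<close>
    have jr: "jump_rate c > 0"
    proof (rule ccontr)
      assume "\<not> jump_rate c > 0"
      then have "jump_rate c = 0" by (simp add: jump_rate_def not_less measure_le_0_iff)
      then have "emeasure (\<mu> c) UNIV = 0" using emeasure_big[OF c(1)] by (simp add: emeasure_\<mu>)
      moreover have "space (\<mu> c) = UNIV" by (simp add: \<mu>_def)
      ultimately have "AE x in \<mu> c. False" by (intro AE_I[of _ _ UNIV]) (auto simp: sets_\<mu>)
      then have "(\<integral>x. p x * (x\<^sup>2 * indicator {0<..s0} x) \<partial>\<mu> c) = (\<integral>x. 0 \<partial>\<mu> c)"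
        by (intro integral_cong_AE) auto
      then show False using half[of s0] e_pos[OF s0(1)] s0 by simp
    qed
    have pq: "prob_space (jump_law c)"
      unfolding jump_law_def using jr by (intro prob_space_uniform_measure) (auto simp: emeasure_big[OF c(1)])
    have "reflected_walk (jump_law c) p w h (\<integral>u. f0 u \<partial>lborel) (1 / (8 * jump_rate c)) r L"
      if h: "h \<in> borel_measurable borel" "\<forall>x. \<bar>h x\<bar> \<le> 1" "\<forall>x y. \<bar>h x - h y\<bar> \<le> L * \<bar>x - y\<bar>" "L \<ge> 0" for h L
    proof (intro reflected_walk.intro pq reflected_walk_axioms.intro)
      show "(\<integral>x. p x * g x \<partial>jump_law c) = (\<integral>x. p x * g (- x) \<partial>jump_law c)"
        if g[measurable]: "g \<in> borel_measurable borel" for g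
      proof -
        have "(\<integral>x. p x * g x \<partial>jump_law c) = (1 / jump_rate c) *\<^sub>R (\<integral>x. p x * g x \<partial>\<mu> c)"
          by (rule integral_jump_law[OF c(1) jr]) measurable
        moreover have "(\<integral>x. p x * g (- x) \<partial>jump_law c) = (1 / jump_rate c) *\<^sub>R (\<integral>x. p x * g (- x) \<partial>\<mu> c)"
          by (rule integral_jump_law[OF c(1) jr]) measurable
        ultimately show ?thesis using refl[rule_format, OF g] by (simp only:)
      qed
      fix z assume z: "r < z" "z < 1"
      then have z0: "0 < z" using r by simp
      define P where "P a = p a * indicator {a. 2 * \<bar>a\<bar> \<le> z} a" for a
      have P: "0 \<le> P a" "P a \<le> 1" for a using p01[of a] by (auto simp: P_def indicator_def)
      have [measurable]: "P \<in> borel_measurable borel" unfolding P_def by measurable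
      have iw: "integrable (\<mu> c) (\<lambda>a. P a * (w (z + k * a) - w z))" for k
      proof (rule M.integrable_const_bound[where B="\<integral>u. f0 u \<partial>lborel"])
        have "norm (P a * (w (z + k * a) - w z)) \<le> (\<integral>u. f0 u \<partial>lborel)" for a
        proof -
          have "\<bar>w (z + k * a) - w z\<bar> \<le> (\<integral>u. f0 u \<partial>lborel)"
            using w_bounds[of z] w_bounds[of "z + k * a"] by linarith
          then show ?thesis
            using mult_mono[of "\<bar>P a\<bar>" 1 "\<bar>w (z + k * a) - w z\<bar>" "\<integral>u. f0 u \<partial>lborel"] P[of a] by (simp add: abs_mult)
        qed
        then show "AE a in \<mu> c. norm (P a * (w (z + k * a) - w z)) \<le> (\<integral>u. f0 u \<partial>lborel)" by simp
      qed measurable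
      have i2: "integrable (\<mu> c) (\<lambda>a. p a * (a\<^sup>2 * indicator {0<..z/2} a))"
      proof (rule M.integrable_const_bound[where B=1])
        have "norm (p a * (a\<^sup>2 * indicator {0<..z/2} a)) \<le> 1" for a
        proof -
          have "a\<^sup>2 * indicator {0<..z/2} a \<le> 1" using z by (auto simp: indicator_def abs_square_le_1)
          from mult_le_one[OF p01(2) _ this] have "p a * (a\<^sup>2 * indicator {0<..z/2} a) \<le> 1" by simp
          then show ?thesis using p01(1)[of a] by simp
        qed
        then show "AE a in \<mu> c. norm (p a * (a\<^sup>2 * indicator {0<..z/2} a)) \<le> 1" by simp
      qed measurable
      have ez: "0 < e (z / 2)" using z0 by (intro e_pos) simp
      \<comment> \<open>By symmetry the mean increments for \<open>a\<close> and \<open>- a\<close>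
        agree, so twice the integral is that of a second difference of \<open>w\<close>, to which
        concavity applies.\<close>
      have flip: "(\<integral>a. P a * (w (z - 2 * a) - w z) \<partial>\<mu> c) = (\<integral>a. P a * (w (z + 2 * a) - w z) \<partial>\<mu> c)"
      proof -
        have "(\<integral>a. p a * (indicator {a. 2 * \<bar>a\<bar> \<le> z} a * (w (z - 2 * a) - w z)) \<partial>\<mu> c) = (\<integral>a. p a * (indicator {a. 2 * \<bar>a\<bar> \<le> z} (- a) * (w (z - 2 * (- a)) - w z)) \<partial>\<mu> c)"
          using refl[rule_format, of "\<lambda>a. indicator {a. 2 * \<bar>a\<bar> \<le> z} a * (w (z - 2 * a) - w z)"] by simp
        then show ?thesis by (simp add: P_def mult.assoc indicator_def)
      qed
      have "2 * (\<integral>a. P a * (w (z - 2 * a) - w z) \<partial>\<mu> c) = (\<integral>a. P a * (w (z + 2 * a) - w z) \<partial>\<mu> c) + (\<integral>a. P a * (w (z - 2 * a) - w z) \<partial>\<mu> c)"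
        using flip by simp
      also have "\<dots> = (\<integral>a. P a * (w (z + 2 * a) - w z) + P a * (w (z - 2 * a) - w z) \<partial>\<mu> c)"
        using iw[of 2] iw[of "-2"] by simp
      also have "\<dots> \<le> (\<integral>a. - (1 / (2 * e (z / 2))) * (p a * (a\<^sup>2 * indicator {0<..z/2} a)) \<partial>\<mu> c)"
      proof (rule integral_mono)
        show "integrable (\<mu> c) (\<lambda>a. P a * (w (z + 2 * a) - w z) + P a * (w (z - 2 * a) - w z))"
          using iw[of 2] iw[of "-2"] by simp
        show "integrable (\<mu> c) (\<lambda>a. - (1 / (2 * e (z / 2))) * (p a * (a\<^sup>2 * indicator {0<..z/2} a)))"
          using i2 by simp
        fix a
        show "P a * (w (z + 2 * a) - w z) + P a * (w (z - 2 * a) - w z) \<le> - (1 / (2 * e (z / 2))) * (p a * (a\<^sup>2 * indicator {0<..z/2} a))"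
        proof (cases "2 * \<bar>a\<bar> \<le> z")
          case True
          have "P a * (w (z + 2 * a) - w z) + P a * (w (z - 2 * a) - w z) = p a * (w (z + 2 * a) + w (z - 2 * a) - 2 * w z)"
            using True by (simp add: P_def algebra_simps)
          also have "\<dots> \<le> p a * (- (a\<^sup>2 / 2) / e (z / 2))"
            by (intro mult_left_mono w_second_difference z0 z True p01)
          also have "\<dots> = - (1 / (2 * e (z / 2))) * (p a * a\<^sup>2)" by simp
          \<comment> \<open>Negative jumps are discarded, as their contribution is at most
            \<open>0\<close>; what remains is the one-sided second moment that \<open>half\<close>
            bounds from below.\<close>
          also have "\<dots> \<le> - (1 / (2 * e (z / 2))) * (p a * (a\<^sup>2 * indicator {0<..z/2} a))"
            using ez p01[of a] by (intro mult_left_mono_neg mult_left_mono) (auto simp: indicator_def)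
          finally show ?thesis .
        next
          case False
          then have "a \<notin> {0<..z/2}" by auto
          then show ?thesis using False by (simp add: P_def)
        qed
      qed
      also have "\<dots> = - (1 / (2 * e (z / 2))) * (\<integral>a. p a * (a\<^sup>2 * indicator {0<..z/2} a) \<partial>\<mu> c)"
        by (rule integral_mult_right_zero)
      also have "\<dots> \<le> - (1 / (2 * e (z / 2))) * (e (z / 2) / 2)"
        using ez half[of "z / 2"] z s0 by (intro mult_left_mono_neg) auto
      \<comment> \<open>The factor \<open>e (z / 2)\<close> cancels, by the choice of
        \<open>w\<close>. Since twice the integral was estimated, the drift is at most
        \<open>- 1/8\<close>.\<close>
      also have "\<dots> = - (1 / 4)" using ez by simp
      finally have *: "(\<integral>a. P a * (w (z - 2 * a) - w z) \<partial>\<mu> c) \<le> - (1 / 8)" by simp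
      have "(\<integral>a. P a * (w (z - 2 * a) - w z) \<partial>jump_law c) = (1 / jump_rate c) * (\<integral>a. P a * (w (z - 2 * a) - w z) \<partial>\<mu> c)"
        by (subst integral_jump_law[OF c(1) jr]) auto
      also have "\<dots> \<le> (1 / jump_rate c) * (- (1 / 8))"
        using jr by (intro mult_left_mono *) auto
      finally show "(\<integral>a. p a * indicator {a. 2 * \<bar>a\<bar> \<le> z} a * (w (z - 2 * a) - w z) \<partial>jump_law c) \<le> - (1 / (8 * jump_rate c))"
        by (simp add: P_def)
    qed (use h p01 w_bounds jr r in \<open>auto simp: jump_law_def sets_\<nu>\<close>)
    then show ?thesis using jr by blast
  qed
  moreover have "c0 > 0" using c1 s0 by (simp add: c0_def)
  ultimately show ?thesis by blast
qed

end

section \<open>Total variation of translates\<close>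

text \<open>\<open>D\<close> does not depend on the Lipschitz constant. So it survives the
  approximation of the indicator of a closed set by functions of slope \<open>n\<close>, and inner
  regularity by compact sets reaches all Borel sets.\<close>

lemma measure_diff_le_of_lipschitz:
  fixes \<alpha>1 \<alpha>2 :: "real measure"
  assumes "prob_space \<alpha>1" "prob_space \<alpha>2" and s1[measurable_cong]: "sets \<alpha>1 = sets borel" and s2[measurable_cong]: "sets \<alpha>2 = sets borel"
    and le: "\<And>h L. h \<in> borel_measurable borel \<Longrightarrow> (\<And>x. \<bar>h x\<bar> \<le> 1) \<Longrightarrow> 0 \<le> L \<Longrightarrow> (\<And>x y. \<bar>h x - h y\<bar> \<le> L * \<bar>x - y\<bar>) \<Longrightarrow>
        (\<integral>x. h x \<partial>\<alpha>1) - (\<integral>x. h x \<partial>\<alpha>2) \<le> D"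
    and A: "A \<in> sets borel"
  shows "measure \<alpha>1 A - measure \<alpha>2 A \<le> D"
proof -
  interpret \<alpha>1: prob_space \<alpha>1 by fact
  interpret \<alpha>2: prob_space \<alpha>2 by fact
  have D0: "0 \<le> D" using le[of "\<lambda>_. 0" 0] by simp
  have closed: "\<alpha>1.prob K - \<alpha>2.prob K \<le> D" if K: "closed K" for K
  \<comment> \<open>\<open>infdist\<close> to the empty set is \<open>0\<close> by convention, which
    would make the approximating functions constantly \<open>1\<close>.\<close>
  proof (cases "K = {}")
    case False
    define h where "h n x = max 0 (1 - real n * infdist x K)" for n x
    have hm[measurable]: "h n \<in> borel_measurable borel" for n
      unfolding h_def by (intro borel_measurable_continuous_onI continuous_intros)
    have h01: "0 \<le> h n x" "h n x \<le> 1" for n x by (auto simp: h_def infdist_nonneg)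
    have lip: "\<bar>h n x - h n y\<bar> \<le> real n * \<bar>x - y\<bar>" for n x y
    proof -
      have "\<bar>infdist x K - infdist y K\<bar> \<le> \<bar>x - y\<bar>"
        using infdist_triangle[of x K y] infdist_triangle[of y K x] by (auto simp: dist_real_def abs_minus_commute)
      then have "real n * \<bar>infdist x K - infdist y K\<bar> \<le> real n * \<bar>x - y\<bar>" by (intro mult_left_mono) auto
      moreover have "real n * \<bar>infdist x K - infdist y K\<bar> = \<bar>real n * infdist x K - real n * infdist y K\<bar>"
        by (simp add: right_diff_distrib[symmetric] abs_mult)
      moreover have "\<bar>h n x - h n y\<bar> \<le> \<bar>real n * infdist x K - real n * infdist y K\<bar>"
        unfolding h_def by (auto simp: max_def)
      ultimately show ?thesis by linarith
    qed
    have Km: "K \<in> sets borel" using K by (rule borel_closed)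
    have hK: "indicator K x \<le> h n x" for n x
      using h01(1)[of n x] by (cases "x \<in> K") (auto simp: h_def)
    have "\<alpha>1.prob K \<le> (\<integral>x. h n x \<partial>\<alpha>2) + D" for n
    proof -
      have "\<alpha>1.prob K = (\<integral>x. indicator K x \<partial>\<alpha>1)" using Km by (simp add: s1)
      also have "\<dots> \<le> (\<integral>x. h n x \<partial>\<alpha>1)"
      proof (rule integral_mono)
        show "integrable \<alpha>1 (\<lambda>x. indicator K x :: real)"
          using Km by (intro integrable_real_indicator) (auto simp: s1 \<alpha>1.emeasure_eq_measure)
        show "integrable \<alpha>1 (h n)" by (rule \<alpha>1.integrable_const_bound[where B=1]) (use h01 in auto)
      qed (rule hK)
      finally show ?thesis using le[OF hm[of n] _ _ lip[of n]] h01 by (simp add: abs_le_iff)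
    qed
    moreover have "(\<lambda>n. (\<integral>x. h n x \<partial>\<alpha>2) + D) \<longlonglongrightarrow> (\<integral>x. indicator K x \<partial>\<alpha>2) + D"
    proof (intro tendsto_add tendsto_const integral_dominated_convergence[where w="\<lambda>_. 1"])
      show "AE x in \<alpha>2. (\<lambda>n. h n x) \<longlonglongrightarrow> indicator K x"
      proof (rule AE_I2)
        fix x
        show "(\<lambda>n. h n x) \<longlonglongrightarrow> indicator K x"
        proof (cases "x \<in> K")
          case True
          then show ?thesis by (simp add: h_def)
        next
          case False
          then have d: "0 < infdist x K" using K \<open>K \<noteq> {}\<close> by (simp add: infdist_pos_not_in_closed)
          obtain N where N: "1 / infdist x K < real N" using reals_Archimedean2 by blast
          have "h n x = 0" if "n \<ge> N" for n
          proof -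
            have "1 \<le> real N * infdist x K" using N d by (simp add: field_simps)
            also have "\<dots> \<le> real n * infdist x K" using that d by (intro mult_right_mono) auto
            finally show ?thesis by (simp add: h_def)
          qed
          then show ?thesis using False by (intro tendsto_eventually) (auto simp: eventually_sequentially)
        qed
      qed
      show "(\<lambda>x. indicator K x :: real) \<in> borel_measurable \<alpha>2" using Km by (simp add: s2)
    qed (use h01 in auto)
    ultimately have "\<alpha>1.prob K \<le> (\<integral>x. indicator K x \<partial>\<alpha>2) + D"
      by (intro LIMSEQ_le_const[of "\<lambda>n. (\<integral>x. h n x \<partial>\<alpha>2) + D"]) auto
    then show ?thesis using Km by (simp add: s2)
  qed (use D0 in simp)
  have "emeasure \<alpha>1 A = (SUP K\<in>{K. K \<subseteq> A \<and> compact K}. emeasure \<alpha>1 K)"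
    by (rule inner_regular[OF s1 _ A]) (simp add: \<alpha>1.emeasure_eq_measure)
  also have "\<dots> \<le> ennreal (\<alpha>2.prob A + D)"
  proof (rule SUP_least)
    fix K assume "K \<in> {K. K \<subseteq> A \<and> compact K}"
    then have K: "K \<subseteq> A" "closed K" by (auto intro: compact_imp_closed)
    have "\<alpha>1.prob K \<le> \<alpha>2.prob K + D" using closed[OF K(2)] by simp
    also have "\<alpha>2.prob K \<le> \<alpha>2.prob A" using K A by (intro \<alpha>2.finite_measure_mono) (auto simp: s2)
    finally show "emeasure \<alpha>1 K \<le> ennreal (\<alpha>2.prob A + D)"
      by (simp add: \<alpha>1.emeasure_eq_measure ennreal_leI)
  qed
  finally show ?thesis using D0 by (simp add: \<alpha>1.emeasure_eq_measure ennreal_le_iff del: ennreal_plus)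
qed

section \<open>Compound Poisson approximation at a fixed time\<close>

context small_jump_condition
begin

lemma integral_\<mu>:
  fixes f :: "real \<Rightarrow> 'b::{banach, second_countable_topology}"
  assumes [measurable]: "f \<in> borel_measurable borel"
  shows "(\<integral>x. f x \<partial>\<mu> c) = (\<integral>x. indicator (big c) x *\<^sub>R f x \<partial>\<nu>)"
proof -
  have "\<mu> c = density \<nu> (\<lambda>x. ennreal (indicator (big c) x))"
    unfolding \<mu>_def by (simp add: ennreal_indicator)
  then show ?thesis by (simp only:) (rule integral_density; auto)
qed

definition approx_drift :: "real \<Rightarrow> real" where
  "approx_drift c = (\<integral>x. x * indicator {-1..1} x \<partial>\<mu> c)"

text \<open>The law at time \<open>t\<close> of the process from which the jumps of size at most
  \<open>c\<close> have been removed; the drift compensates the remaining jumps in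
  \<open>{-1..1}\<close>.\<close>

definition approx_law :: "real \<Rightarrow> real \<Rightarrow> real measure" where
  "approx_law t c = distr (cloud (t * jump_rate c) (jump_law c)) borel (\<lambda>\<omega>. (\<Sum>i<fst \<omega>. snd \<omega> i) - t * approx_drift c)"

lemma sets_jump_law[measurable_cong]: "sets (jump_law c) = sets borel"
  by (simp add: jump_law_def sets_\<nu>)

lemma prob_space_jump_law: "c > 0 \<Longrightarrow> jump_rate c > 0 \<Longrightarrow> prob_space (jump_law c)"
  unfolding jump_law_def by (intro prob_space_uniform_measure) (auto simp: emeasure_big)

lemma cloud_sum_measurable[measurable]:
  "(\<lambda>\<omega>. \<Sum>i<fst \<omega>. snd \<omega> i) \<in> borel_measurable (cloud \<Lambda> (jump_law c))"
  using measurable_cloud_sum[of "\<lambda>x. x" "jump_law c" \<Lambda>] by simp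

lemma real_distribution_approx_law:
  assumes "c > 0" "jump_rate c > 0"
  shows "real_distribution (approx_law t c)"
proof -
  interpret prob_space "cloud (t * jump_rate c) (jump_law c)"
    by (intro prob_space_cloud prob_space_jump_law assms)
  show ?thesis unfolding approx_law_def by (rule real_distribution_distr) measurable
qed

lemma char_approx_law:
  assumes c: "c > 0" "jump_rate c > 0" and t: "t \<ge> 0"
  shows "char (approx_law t c) \<theta> = exp (of_real t * (\<integral>x. indicator (big c) x *\<^sub>R levy_integrand \<theta> x \<partial>\<nu>))"
proof -
  let ?C = "cloud (t * jump_rate c) (jump_law c)"
  interpret M: finite_measure "\<mu> c" by (rule finite_\<mu>[OF c(1)])
  interpret q: prob_space "jump_law c" by (rule prob_space_jump_law[OF c])
  have i1: "integrable (\<mu> c) (\<lambda>x. iexp (\<theta> * x) - 1)"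
    by (rule M.integrable_const_bound[where B=2]) (auto intro!: order_trans[OF norm_triangle_ineq4])
  have i2: "integrable (\<mu> c) (\<lambda>x. x * indicator {-1..1} x :: real)"
    by (rule M.integrable_const_bound[where B=1]) (auto simp: indicator_def)
  have iq: "integrable (jump_law c) (\<lambda>x. iexp (\<theta> * x))"
    by (rule q.integrable_const_bound[where B=1]) auto
  have J: "of_real (t * jump_rate c) * ((\<integral>x. iexp (\<theta> * x) \<partial>jump_law c) - 1) = of_real t * (\<integral>x. iexp (\<theta> * x) - 1 \<partial>\<mu> c)"
  proof -
    have "(\<integral>x. iexp (\<theta> * x) \<partial>jump_law c) - 1 = (\<integral>x. iexp (\<theta> * x) - 1 \<partial>jump_law c)"
      using iq q.prob_space by simp
    also have "\<dots> = (1 / jump_rate c) *\<^sub>R (\<integral>x. iexp (\<theta> * x) - 1 \<partial>\<mu> c)"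
      by (rule integral_jump_law[OF c]) measurable
    finally show ?thesis using c by (simp add: scaleR_conv_of_real)
  qed
  have "char (approx_law t c) \<theta> = (\<integral>\<omega>. iexp (\<theta> * ((\<Sum>i<fst \<omega>. snd \<omega> i) - t * approx_drift c)) \<partial>?C)"
    unfolding char_def approx_law_def by (subst integral_distr) simp_all
  also have "\<dots> = (\<integral>\<omega>. iexp (\<Sum>i<fst \<omega>. \<theta> * snd \<omega> i) * iexp (- (\<theta> * t * approx_drift c)) \<partial>?C)"
    by (rule Bochner_Integration.integral_cong)
       (auto simp: exp_add[symmetric] sum_distrib_left[symmetric] algebra_simps)
  also have "\<dots> = (\<integral>\<omega>. iexp (\<Sum>i<fst \<omega>. \<theta> * snd \<omega> i) \<partial>?C) * iexp (- (\<theta> * t * approx_drift c))"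
    by (rule integral_mult_left_zero)
  also have "(\<integral>\<omega>. iexp (\<Sum>i<fst \<omega>. \<theta> * snd \<omega> i) \<partial>?C) = exp (of_real (t * jump_rate c) * ((\<integral>x. iexp (\<theta> * x) \<partial>jump_law c) - 1))"
    by (rule cloud_char[OF q.prob_space_axioms]) (use c t in auto)
  also have "\<dots> = exp (of_real t * (\<integral>x. iexp (\<theta> * x) - 1 \<partial>\<mu> c))" unfolding J ..
  also have "exp (of_real t * (\<integral>x. iexp (\<theta> * x) - 1 \<partial>\<mu> c)) * iexp (- (\<theta> * t * approx_drift c))
      = exp (of_real t * ((\<integral>x. iexp (\<theta> * x) - 1 \<partial>\<mu> c) - \<i> * of_real \<theta> * of_real (approx_drift c)))"
    by (simp add: exp_add[symmetric] algebra_simps)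
  also have "(\<integral>x. iexp (\<theta> * x) - 1 \<partial>\<mu> c) - \<i> * of_real \<theta> * of_real (approx_drift c) = (\<integral>x. levy_integrand \<theta> x \<partial>\<mu> c)"
  proof -
    have "\<i> * of_real \<theta> * of_real (approx_drift c) = (\<integral>x. \<i> * of_real \<theta> * of_real (x * indicator {-1..1} x) \<partial>\<mu> c)"
      unfolding approx_drift_def by (simp only: integral_mult_right_zero integral_complex_of_real)
    moreover have "integrable (\<mu> c) (\<lambda>x. \<i> * of_real \<theta> * complex_of_real (x * indicator {-1..1} x))"
      by (intro integrable_mult_right integrable_of_real i2)
    ultimately have "(\<integral>x. iexp (\<theta> * x) - 1 \<partial>\<mu> c) - \<i> * of_real \<theta> * of_real (approx_drift c)
       = (\<integral>x. (iexp (\<theta> * x) - 1) - \<i> * of_real \<theta> * of_real (x * indicator {-1..1} x) \<partial>\<mu> c)"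
      using i1 by (simp only: Bochner_Integration.integral_diff)
    also have "\<dots> = (\<integral>x. levy_integrand \<theta> x \<partial>\<mu> c)"
      by (rule Bochner_Integration.integral_cong) (auto simp: levy_integrand_def indicator_def)
    finally show ?thesis .
  qed
  finally show ?thesis by (simp add: integral_\<mu>)
qed

text \<open>For fixed \<open>r\<close> the compound Poisson laws satisfy the bound with an error
  \<open>L * r\<close> that does not depend on the cutoff. They converge weakly to \<open>M\<close>
  as the cutoff vanishes, and a Lipschitz \<open>h\<close> is a continuous test function. Finally
  \<open>r\<close> is arbitrary.\<close>

lemma translate_bound:
  assumes t: "t > 0" and z: "0 \<le> z" and M: "real_distribution M" and char: "char M = (\<lambda>\<theta>. exp (of_real t * levy_exponent \<nu> \<theta>))"
    and h[measurable]: "h \<in> borel_measurable borel" and h1: "\<And>x. \<bar>h x\<bar> \<le> 1" and L: "0 \<le> L" and lip: "\<And>x y. \<bar>h x - h y\<bar> \<le> L * \<bar>x - y\<bar>"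
  shows "\<bar>(\<integral>x. h (z + x) \<partial>M) - (\<integral>x. h x \<partial>M)\<bar> \<le> 2 * z + 16 * w z / t"
proof (rule field_le_epsilon)
  fix \<epsilon> :: real assume "\<epsilon> > 0"
  \<comment> \<open>The denominator \<open>L + 1\<close> instead of \<open>L\<close> covers the
    constant functions with \<open>L = 0\<close>.\<close>
  define r where "r = \<epsilon> / (L + 1)"
  have r: "r > 0" "L * r \<le> \<epsilon>" using \<open>\<epsilon> > 0\<close> L by (auto simp: r_def field_simps)
  from exists_reflected_walk[OF r(1)] obtain c0 where c0: "c0 > 0" and walk: "\<forall>c. 0 < c \<longrightarrow> c \<le> c0 \<longrightarrow> jump_rate c > 0 \<and>
    (\<forall>h L. h \<in> borel_measurable borel \<longrightarrow> (\<forall>x. \<bar>h x\<bar> \<le> 1) \<longrightarrow> (\<forall>x y. \<bar>h x - h y\<bar> \<le> L * \<bar>x - y\<bar>) \<longrightarrow> L \<ge> 0 \<longrightarrow>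
      (\<exists>p. reflected_walk (jump_law c) p w h (\<integral>u. f0 u \<partial>lborel) (1 / (8 * jump_rate c)) r L))"
    by (elim exE conjE)
  define c where "c n = c0 / real (Suc n)" for n
  have c: "0 < c n" "c n \<le> c0" for n using c0 by (simp_all add: c_def divide_le_eq)
  have clim: "c \<longlonglongrightarrow> 0" unfolding c_def by (intro LIMSEQ_Suc[OF lim_const_over_n])
  have jr: "jump_rate (c n) > 0" for n
    by (rule conjunct1[OF walk[rule_format, OF c]])
  have contL: "continuous_on UNIV h"
    by (rule lipschitz_on_continuous_on[where L=L], rule lipschitz_onI) (simp_all only: dist_real_def lip L)
  have cont_h: "isCont h y" for y
    using contL by (simp add: continuous_on_eq_continuous_at)
  have cont_hz: "isCont (\<lambda>x. h (z + x)) y" for y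
    by (rule isCont_o2[OF _ cont_h]) (intro continuous_intros)
  interpret M: real_distribution M by fact
  have "weak_conv_m (\<lambda>n. approx_law t (c n)) M"
  proof (rule levy_continuity)
    fix \<theta>
    have "(\<lambda>n. \<integral>x. indicator (big (c n)) x *\<^sub>R levy_integrand \<theta> x \<partial>\<nu>) \<longlonglongrightarrow> (\<integral>x. levy_integrand \<theta> x \<partial>\<nu>)"
    proof (rule integral_dominated_convergence[where w="\<lambda>x. cmod (levy_integrand \<theta> x)"])
      show "AE x in \<nu>. (\<lambda>n. indicator (big (c n)) x *\<^sub>R levy_integrand \<theta> x) \<longlonglongrightarrow> levy_integrand \<theta> x"
      proof (rule AE_I2)
        fix x
        show "(\<lambda>n. indicator (big (c n)) x *\<^sub>R levy_integrand \<theta> x) \<longlonglongrightarrow> levy_integrand \<theta> x"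
        proof (cases "x = 0")
          case True
          then show ?thesis by (simp add: levy_integrand_def)
        next
          case False
          then have "0 < \<bar>x\<bar>" by simp
          from order_tendstoD(2)[OF clim this]
          have "\<forall>\<^sub>F n in sequentially. indicator (big (c n)) x *\<^sub>R levy_integrand \<theta> x = levy_integrand \<theta> x"
            by eventually_elim (simp add: big_def)
          then show ?thesis by (rule tendsto_eventually)
        qed
      qed
      show "integrable \<nu> (\<lambda>x. cmod (levy_integrand \<theta> x))" by (intro integrable_norm levy_integrand_integrable levy)
      show "AE x in \<nu>. cmod (indicator (big (c n)) x *\<^sub>R levy_integrand \<theta> x) \<le> cmod (levy_integrand \<theta> x)" for n
        by (auto simp: indicator_def)
    qed measurable
    moreover have "(\<integral>x. levy_integrand \<theta> x \<partial>\<nu>) = levy_exponent \<nu> \<theta>"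
      by (simp add: levy_exponent_def levy_integrand_def)
    ultimately show "(\<lambda>n. char (approx_law t (c n)) \<theta>) \<longlonglongrightarrow> char M \<theta>"
      unfolding char using t by (simp add: char_approx_law[OF c(1) jr] tendsto_intros)
  qed (use M c jr in \<open>auto intro: real_distribution_approx_law\<close>)
  note conv = weak_conv_imp_integral_bdd_continuous_conv[OF real_distribution_approx_law[OF c(1) jr] M this]
  have l1: "(\<lambda>n. \<integral>x. h (z + x) \<partial>approx_law t (c n)) \<longlonglongrightarrow> (\<integral>x. h (z + x) \<partial>M)"
    by (rule conv[where B=1]) (simp_all add: h1 cont_hz)
  have l2: "(\<lambda>n. \<integral>x. h x \<partial>approx_law t (c n)) \<longlonglongrightarrow> (\<integral>x. h x \<partial>M)"
    by (rule conv[where B=1]) (simp_all add: h1 cont_h)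
  have bound: "\<bar>(\<integral>x. h (z + x) \<partial>approx_law t (c n)) - (\<integral>x. h x \<partial>approx_law t (c n))\<bar> \<le> L * r + 2 * z + 16 * w z / t" for n
  proof -
    have "\<exists>p. reflected_walk (jump_law (c n)) p w h (\<integral>u. f0 u \<partial>lborel) (1 / (8 * jump_rate (c n))) r L"
      by (rule conjunct2[OF walk[rule_format, OF c], rule_format]) (use h h1 L lip in auto)
    then obtain p where "reflected_walk (jump_law (c n)) p w h (\<integral>u. f0 u \<partial>lborel) (1 / (8 * jump_rate (c n))) r L" ..
    then interpret W: reflected_walk "jump_law (c n)" p w h "\<integral>u. f0 u \<partial>lborel" "1 / (8 * jump_rate (c n))" r L .
    define x where "x = - (t * approx_drift (c n))"
    have e1: "(\<integral>x. h (z + x) \<partial>approx_law t (c n)) = (\<integral>\<omega>. h (x + z + (\<Sum>i<fst \<omega>. snd \<omega> i)) \<partial>cloud (t * jump_rate (c n)) (jump_law (c n)))"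
      unfolding approx_law_def x_def by (subst integral_distr) (auto simp: algebra_simps)
    have e2: "(\<integral>x. h x \<partial>approx_law t (c n)) = (\<integral>\<omega>. h (x + (\<Sum>i<fst \<omega>. snd \<omega> i)) \<partial>cloud (t * jump_rate (c n)) (jump_law (c n)))"
      unfolding approx_law_def x_def by (subst integral_distr) (auto simp: algebra_simps)
    \<comment> \<open>The number of steps has mean \<open>t * jump_rate (c n)\<close>, while each
      step gains \<open>1 / (8 * jump_rate (c n))\<close>. The rates cancel, and the bound is free
      of the cutoff.\<close>
    have "2 * w z / (1 / (8 * jump_rate (c n)) * (t * jump_rate (c n))) = 16 * w z / t"
      using jr[of n] t by (simp add: field_simps)
    then show ?thesis
      unfolding e1 e2 using W.cloud_translate[of "t * jump_rate (c n)" z x] jr[of n] t z by simp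
  qed
  have "\<bar>(\<integral>x. h (z + x) \<partial>M) - (\<integral>x. h x \<partial>M)\<bar> \<le> L * r + 2 * z + 16 * w z / t"
    by (rule LIMSEQ_le_const2[OF tendsto_rabs[OF tendsto_diff[OF l1 l2]]]) (use bound in auto)
  then show "\<bar>(\<integral>x. h (z + x) \<partial>M) - (\<integral>x. h x \<partial>M)\<bar> \<le> 2 * z + 16 * w z / t + \<epsilon>"
    using r(2) by linarith
qed

lemma translate_measure_bound:
  assumes t: "t > 0" and M: "real_distribution M" and char: "char M = (\<lambda>\<theta>. exp (of_real t * levy_exponent \<nu> \<theta>))"
    and A: "A \<in> sets borel"
  shows "measure M {u. x + u \<in> A} - measure M {u. y + u \<in> A} \<le> 2 * \<bar>y - x\<bar> + 16 * w \<bar>y - x\<bar> / t"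
proof -
  interpret M: real_distribution M by fact
  have "measure (distr M borel ((+) x)) A - measure (distr M borel ((+) y)) A \<le> 2 * \<bar>y - x\<bar> + 16 * w \<bar>y - x\<bar> / t"
  proof (rule measure_diff_le_of_lipschitz[OF _ _ _ _ _ A])
    fix h :: "real \<Rightarrow> real" and L
    assume h[measurable]: "h \<in> borel_measurable borel" and h1: "\<And>x. \<bar>h x\<bar> \<le> 1" and L: "0 \<le> L" and lip: "\<And>x y. \<bar>h x - h y\<bar> \<le> L * \<bar>x - y\<bar>"
    have tb: "\<bar>(\<integral>u. h (a + (z + u)) \<partial>M) - (\<integral>u. h (a + u) \<partial>M)\<bar> \<le> 2 * z + 16 * w z / t" if "0 \<le> z" for a z
    proof (rule translate_bound[OF t that M char, of "\<lambda>u. h (a + u)" L])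
      show "\<bar>h (a + u) - h (a + v)\<bar> \<le> L * \<bar>u - v\<bar>" for u v using lip[of "a + u" "a + v"] by simp
    qed (use h1 L in auto)
    have "(\<integral>u. h u \<partial>distr M borel ((+) x)) = (\<integral>u. h (x + u) \<partial>M)" "(\<integral>u. h u \<partial>distr M borel ((+) y)) = (\<integral>u. h (y + u) \<partial>M)"
      by (subst integral_distr; simp)+
    moreover have "\<bar>(\<integral>u. h (x + u) \<partial>M) - (\<integral>u. h (y + u) \<partial>M)\<bar> \<le> 2 * \<bar>y - x\<bar> + 16 * w \<bar>y - x\<bar> / t"
    proof (cases "x \<le> y")
      case True
      then show ?thesis using tb[of "y - x" x] by (simp add: add.assoc[symmetric] abs_minus_commute)
    next
      case False
      then show ?thesis using tb[of "x - y" y] by (simp add: add.assoc[symmetric])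
    qed
    ultimately show "(\<integral>u. h u \<partial>distr M borel ((+) x)) - (\<integral>u. h u \<partial>distr M borel ((+) y)) \<le> 2 * \<bar>y - x\<bar> + 16 * w \<bar>y - x\<bar> / t"
      by linarith
  qed (auto intro!: M.prob_space_distr)
  moreover have "measure (distr M borel ((+) a)) A = measure M {u. a + u \<in> A}" for a
    using A by (subst measure_distr) (auto simp: vimage_def)
  ultimately show ?thesis by simp
qed

end

section \<open>The coupling of paths\<close>

lemma levy_exponent_0: "levy_exponent \<nu> 0 = 0"
  by (simp add: levy_exponent_def)

lemma levy_process_fromI:
  assumes "prob_space M" and X: "\<And>t. 0 \<le> t \<Longrightarrow> X t \<in> borel_measurable M"
    and "\<And>\<omega>. \<omega> \<in> space M \<Longrightarrow> cadlag (\<lambda>t. X t \<omega>)" and "AE \<omega> in M. X 0 \<omega> = x"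
    and joint: "\<And>n t \<theta>. t 0 = 0 \<Longrightarrow> \<forall>i<n. t i < t (Suc i) \<Longrightarrow>
      (\<integral>\<omega>. iexp (\<Sum>j<n. \<theta> j * (X (t (Suc j)) \<omega> - X (t j) \<omega>)) \<partial>M) = exp (\<Sum>j<n. of_real (t (Suc j) - t j) * levy_exponent \<nu> (\<theta> j))"
  shows "levy_process_from \<nu> x M X"
proof -
  interpret prob_space M by fact
  have "indep_vars (\<lambda>_. borel) (\<lambda>i \<omega>. X (t (Suc i)) \<omega> - X (t i) \<omega>) {..<n} \<and>
      (\<forall>i<n. char (distr M borel (\<lambda>\<omega>. X (t (Suc i)) \<omega> - X (t i) \<omega>)) = (\<lambda>\<xi>. exp (of_real (t (Suc i) - t i) * levy_exponent \<nu> \<xi>)))"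
    if t: "t 0 = 0" "\<forall>i<n. t i < t (Suc i)" for n and t :: "nat \<Rightarrow> real"
  proof -
    have tm: "t i \<ge> 0" if "i \<le> n" for i
      using that
    proof (induction i)
      case (Suc i)
      then show ?case using t(2)[rule_format, of i] by simp
    qed (simp add: t)
    have Z: "(\<lambda>\<omega>. X (t (Suc i)) \<omega> - X (t i) \<omega>) \<in> borel_measurable M" if "i < n" for i
      by (intro borel_measurable_diff X tm) (use that in auto)
    have J: "(\<integral>\<omega>. iexp (\<Sum>i<n. \<theta> i * (X (t (Suc i)) \<omega> - X (t i) \<omega>)) \<partial>M) = (\<Prod>i<n. exp (of_real (t (Suc i) - t i) * levy_exponent \<nu> (\<theta> i)))" for \<theta>
      unfolding joint[OF t] by (rule exp_sum) simp
    have 0: "exp (of_real (t (Suc i) - t i) * levy_exponent \<nu> 0) = 1" for i by (simp add: levy_exponent_0)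
    show ?thesis
      using indep_vars_of_joint_char(1)[where \<phi>="\<lambda>i \<xi>. exp (of_real (t (Suc i) - t i) * levy_exponent \<nu> \<xi>)", OF Z J 0]
        indep_vars_of_joint_char(2)[where \<phi>="\<lambda>i \<xi>. exp (of_real (t (Suc i) - t i) * levy_exponent \<nu> \<xi>)", OF Z J 0]
      by blast
  qed
  then show ?thesis unfolding levy_process_from_def using assms(1-4) by blast
qed

text \<open>\<open>levy_process_from\<close> wants every point of the space to give a cadlag path,
  hence the restriction. The trace of the product sigma-algebra makes sense on any set, so
  measurability of the set of cadlag paths does not come up.\<close>

definition path_pairs :: "((real \<Rightarrow> real) \<times> (real \<Rightarrow> real)) measure" where
  "path_pairs = restrict_space (PiM UNIV (\<lambda>_. borel) \<Otimes>\<^sub>M PiM UNIV (\<lambda>_. borel)) (Collect cadlag \<times> Collect cadlag)"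

lemma space_path_pairs: "space path_pairs = Collect cadlag \<times> Collect cadlag"
  unfolding path_pairs_def by (simp add: space_restrict_space space_pair_measure space_PiM)

lemma path_pairs_eval[measurable]:
  "(\<lambda>\<omega>. fst \<omega> t) \<in> borel_measurable path_pairs" "(\<lambda>\<omega>. snd \<omega> t) \<in> borel_measurable path_pairs"
  unfolding path_pairs_def by (intro measurable_restrict_space1; measurable)+

lemma measurable_path_pairs:
  assumes "\<And>t. (\<lambda>\<omega>. X t \<omega>) \<in> borel_measurable R" "\<And>t. (\<lambda>\<omega>. Y t \<omega>) \<in> borel_measurable R"
    and "\<And>\<omega>. cadlag (\<lambda>t. X t \<omega>)" "\<And>\<omega>. cadlag (\<lambda>t. Y t \<omega>)"
  shows "(\<lambda>\<omega>. (\<lambda>t. X t \<omega>, \<lambda>t. Y t \<omega>)) \<in> R \<rightarrow>\<^sub>M path_pairs"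
  unfolding path_pairs_def
proof (rule measurable_restrict_space2)
  show "(\<lambda>\<omega>. (\<lambda>t. X t \<omega>, \<lambda>t. Y t \<omega>)) \<in> R \<rightarrow>\<^sub>M PiM UNIV (\<lambda>_. borel) \<Otimes>\<^sub>M PiM UNIV (\<lambda>_. borel)"
    by (intro measurable_Pair measurable_PiM_single') (use assms in auto)
qed (use assms in auto)

lemma cadlag_shift: "cadlag f \<Longrightarrow> cadlag (\<lambda>t. x + f t)"
  by (rule cadlag_add[OF cadlag_continuous]) auto

context small_jump_condition
begin

text \<open>One process \<open>X\<close> on the clouds serves both starting points.
  \<open>exists_gluing\<close> couples two copies of the cloud space along the values of
  \<open>x + X \<epsilon>\<close> and \<open>y + X \<epsilon>\<close>; each copy keeps its law, so
  each shifted process has the right increments, and the pair of paths is transported to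
  \<open>path_pairs\<close>.\<close>

lemma exists_coupling:
  assumes \<epsilon>: "\<epsilon> > 0"
  shows "\<exists>M. levy_process_from \<nu> x M (\<lambda>t \<omega>. fst \<omega> t) \<and> levy_process_from \<nu> y M (\<lambda>t \<omega>. snd \<omega> t) \<and>
    (\<exists>A\<in>sets M. {\<omega>\<in>space M. ereal \<epsilon> < coupling_time \<omega>} \<subseteq> A \<and> measure M A \<le> 2 * \<bar>y - x\<bar> + 16 * w \<bar>y - x\<bar> / \<epsilon>)"
proof -
  obtain c :: "nat \<Rightarrow> real" where c: "\<And>n. c n > 0" "\<And>n. c n \<le> 1 / real (Suc n)" "\<And>n. c (Suc n) \<le> c n"
    "\<And>n. (\<integral>\<^sup>+x. ennreal (x\<^sup>2) * indicator {x. \<bar>x\<bar> \<le> c n} x \<partial>\<nu>) \<le> ennreal ((1/16) ^ n)"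
    by (rule levy_cutoffs[OF levy]) blast
  interpret Y: levy_layers \<nu> c by (intro levy_layers.intro levy c)
  from Y.exists_levy_process obtain X where X: "(\<forall>t. X t \<in> borel_measurable Y.clouds) \<and> (\<forall>\<omega>. cadlag (\<lambda>t. X t \<omega>)) \<and> (\<forall>\<omega>. X 0 \<omega> = 0) \<and>
    (\<forall>n t \<theta>. t 0 = 0 \<longrightarrow> (\<forall>i<n. t i < t (Suc i)) \<longrightarrow>
       (\<integral>\<omega>. iexp (\<Sum>j<n. \<theta> j * (X (t (Suc j)) \<omega> - X (t j) \<omega>)) \<partial>Y.clouds) =
       exp (\<Sum>j<n. of_real (t (Suc j) - t j) * levy_exponent \<nu> (\<theta> j)))"
    by (elim exE)
  have Xm[measurable]: "X t \<in> borel_measurable Y.clouds" for t using X by (elim conjE) (erule spec)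
  have Xc: "cadlag (\<lambda>t. X t \<omega>)" for \<omega> using X by (elim conjE) (erule spec)
  have X0: "X 0 \<omega> = 0" for \<omega> using X by (elim conjE) (erule spec)
  have joint: "(\<integral>\<omega>. iexp (\<Sum>j<n. \<theta> j * (X (t (Suc j)) \<omega> - X (t j) \<omega>)) \<partial>Y.clouds) =
       exp (\<Sum>j<n. of_real (t (Suc j) - t j) * levy_exponent \<nu> (\<theta> j))"
    if "t 0 = 0" "\<forall>i<n. t i < t (Suc i)" for n t \<theta>
    using conjunct2[OF conjunct2[OF conjunct2[OF X]]] that by (simp only: simp_thms)
  define D where "D = 2 * \<bar>y - x\<bar> + 16 * w \<bar>y - x\<bar> / \<epsilon>"
  define L where "L = distr Y.clouds borel (X \<epsilon>)"
  have L: "real_distribution L" unfolding L_def by (rule Y.clouds.real_distribution_distr) simp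
  have charL: "char L = (\<lambda>\<theta>. exp (of_real \<epsilon> * levy_exponent \<nu> \<theta>))"
  proof
    fix \<theta>
    have "char L \<theta> = (\<integral>\<omega>. iexp (\<theta> * X \<epsilon> \<omega>) \<partial>Y.clouds)"
      unfolding char_def L_def by (subst integral_distr) simp_all
    also have "\<dots> = exp (of_real \<epsilon> * levy_exponent \<nu> \<theta>)"
      using joint[of "\<lambda>i. real i * \<epsilon>" 1 "\<lambda>_. \<theta>"] \<epsilon> by (simp add: X0)
    finally show "char L \<theta> = exp (of_real \<epsilon> * levy_exponent \<nu> \<theta>)" .
  qed
  have close: "Y.clouds.prob {\<omega>\<in>space Y.clouds. x + X \<epsilon> \<omega> \<in> A} - Y.clouds.prob {\<omega>\<in>space Y.clouds. y + X \<epsilon> \<omega> \<in> A} \<le> D"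
    if A: "A \<in> sets borel" for A
  proof -
    have "measure L {u. a + u \<in> A} = Y.clouds.prob {\<omega>\<in>space Y.clouds. a + X \<epsilon> \<omega> \<in> A}" for a
    proof -
      have "(\<lambda>u. a + u) -` A \<inter> space borel \<in> sets borel" by (rule measurable_sets[OF _ A]) simp
      then have "{u. a + u \<in> A} \<in> sets borel" by (simp add: vimage_def)
      then show ?thesis unfolding L_def by (subst measure_distr) (auto intro!: arg_cong[where f=Y.clouds.prob])
    qed
    then show ?thesis
      using translate_measure_bound[OF \<epsilon> L charL A, of x y] by (simp add: D_def)
  qed
  have "\<exists>(R :: (((real \<times> real) \<times> real) \<times> (real \<times> real)) measure) \<Phi>1 \<Phi>2. prob_space R \<and> \<Phi>1 \<in> R \<rightarrow>\<^sub>M Y.clouds \<and> \<Phi>2 \<in> R \<rightarrow>\<^sub>M Y.clouds \<and>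
     distr R Y.clouds \<Phi>1 = Y.clouds \<and> distr R Y.clouds \<Phi>2 = Y.clouds \<and> measure R {z\<in>space R. x + X \<epsilon> (\<Phi>1 z) \<noteq> y + X \<epsilon> (\<Phi>2 z)} \<le> D"
    by (rule Y.clouds.exists_gluing[OF Y.coded_clouds]) (use close in auto)
  then obtain R :: "(((real \<times> real) \<times> real) \<times> (real \<times> real)) measure" and \<Phi>1 \<Phi>2 where
    R: "prob_space R" and \<Phi>1[measurable]: "\<Phi>1 \<in> R \<rightarrow>\<^sub>M Y.clouds" and \<Phi>2[measurable]: "\<Phi>2 \<in> R \<rightarrow>\<^sub>M Y.clouds"
    and d1: "distr R Y.clouds \<Phi>1 = Y.clouds" and d2: "distr R Y.clouds \<Phi>2 = Y.clouds"
    and ne: "measure R {z\<in>space R. x + X \<epsilon> (\<Phi>1 z) \<noteq> y + X \<epsilon> (\<Phi>2 z)} \<le> D"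
    by (elim exE conjE)
  interpret R: prob_space R by fact
  define F where "F z = ((\<lambda>t. x + X t (\<Phi>1 z)), (\<lambda>t. y + X t (\<Phi>2 z)))" for z
  have F[measurable]: "F \<in> R \<rightarrow>\<^sub>M path_pairs"
    unfolding F_def by (rule measurable_path_pairs) (auto intro!: cadlag_shift Xc)
  define M where "M = distr R path_pairs F"
  have M: "prob_space M" unfolding M_def by (rule R.prob_space_distr) simp
  have process: "levy_process_from \<nu> a M (\<lambda>t \<omega>. ev \<omega> t)"
    if ev[measurable]: "\<And>t. (\<lambda>\<omega>. ev \<omega> t) \<in> borel_measurable path_pairs" and evF: "\<And>z t. ev (F z) t = a + X t (\<Phi> z)"
      and cad: "\<And>\<omega>. \<omega> \<in> space path_pairs \<Longrightarrow> cadlag (ev \<omega>)"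
      and \<Phi>[measurable]: "\<Phi> \<in> R \<rightarrow>\<^sub>M Y.clouds" and d: "distr R Y.clouds \<Phi> = Y.clouds" for ev \<Phi> a
  proof (rule levy_process_fromI[OF M])
    show "(\<lambda>\<omega>. ev \<omega> t) \<in> borel_measurable M" for t unfolding M_def by simp
    show "cadlag (\<lambda>t. ev \<omega> t)" if "\<omega> \<in> space M" for \<omega> using cad that by (simp add: M_def)
    show "AE \<omega> in M. ev \<omega> 0 = a"
      unfolding M_def by (subst AE_distr_iff) (auto simp: evF X0)
    fix n and t \<theta> :: "nat \<Rightarrow> real" assume t: "t 0 = 0" "\<forall>i<n. t i < t (Suc i)"
    have "(\<integral>\<omega>. iexp (\<Sum>j<n. \<theta> j * (ev \<omega> (t (Suc j)) - ev \<omega> (t j))) \<partial>M)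
      = (\<integral>z. iexp (\<Sum>j<n. \<theta> j * (ev (F z) (t (Suc j)) - ev (F z) (t j))) \<partial>R)"
      unfolding M_def by (rule integral_distr[OF F]) measurable
    also have "\<dots> = (\<integral>z. iexp (\<Sum>j<n. \<theta> j * (X (t (Suc j)) (\<Phi> z) - X (t j) (\<Phi> z))) \<partial>R)"
      by (simp add: evF)
    also have "\<dots> = (\<integral>\<omega>. iexp (\<Sum>j<n. \<theta> j * (X (t (Suc j)) \<omega> - X (t j) \<omega>)) \<partial>distr R Y.clouds \<Phi>)"
      by (rule integral_distr[OF \<Phi>, symmetric]) measurable
    also have "\<dots> = exp (\<Sum>j<n. of_real (t (Suc j) - t j) * levy_exponent \<nu> (\<theta> j))"
      unfolding d by (rule joint[OF t])
    finally show "(\<integral>\<omega>. iexp (\<Sum>j<n. \<theta> j * (ev \<omega> (t (Suc j)) - ev \<omega> (t j))) \<partial>M) = exp (\<Sum>j<n. of_real (t (Suc j) - t j) * levy_exponent \<nu> (\<theta> j))" .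
  qed
  \<comment> \<open>\<open>A\<close> compares the paths at the single time \<open>\<epsilon>\<close>
    and is measurable in the product. The event in terms of \<open>coupling_time\<close> refers to
    uncountably many times and is only covered by \<open>A\<close>.\<close>
  define A where "A = {\<omega>\<in>space path_pairs. fst \<omega> \<epsilon> \<noteq> snd \<omega> \<epsilon>}"
  have Am[measurable]: "A \<in> sets path_pairs" unfolding A_def by measurable
  have "{\<omega>\<in>space M. ereal \<epsilon> < coupling_time \<omega>} \<subseteq> A"
  proof safe
    fix f g assume *: "(f, g) \<in> space M" "ereal \<epsilon> < coupling_time (f, g)"
    have "f \<epsilon> \<noteq> g \<epsilon>"
    proof
      assume "f \<epsilon> = g \<epsilon>"
      then have "coupling_time (f, g) \<le> ereal \<epsilon>"
        unfolding coupling_time_def using \<epsilon> by (intro Inf_lower) auto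
      with *(2) show False by simp
    qed
    then show "(f, g) \<in> A" using *(1) by (simp add: A_def M_def)
  qed
  moreover have "measure M A \<le> D"
  proof -
    have "measure M A = R.prob (F -` A \<inter> space R)" unfolding M_def by (rule measure_distr) auto
    also have "F -` A \<inter> space R = {z\<in>space R. x + X \<epsilon> (\<Phi>1 z) \<noteq> y + X \<epsilon> (\<Phi>2 z)}"
      using measurable_space[OF F] by (auto simp: A_def F_def)
    finally show ?thesis using ne by simp
  qed
  moreover have "levy_process_from \<nu> x M (\<lambda>t \<omega>. fst \<omega> t)"
    by (rule process[OF _ _ _ \<Phi>1 d1]) (auto simp: F_def space_path_pairs)
  moreover have "levy_process_from \<nu> y M (\<lambda>t \<omega>. snd \<omega> t)"
    by (rule process[OF _ _ _ \<Phi>2 d2]) (auto simp: F_def space_path_pairs)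
  ultimately show ?thesis
    using Am unfolding D_def by (intro exI[of _ M] conjI bexI[of _ A]) (auto simp: M_def)
qed

lemma local_coupling: "local_coupling_property \<nu>"
  unfolding local_coupling_property_def
proof (intro allI impI)
  fix x \<epsilon> :: real assume \<epsilon>: "0 < \<epsilon>"
  then have "\<epsilon>\<^sup>2 / 64 > 0" by simp
  from w_tendsto_0[OF this] obtain z0 where z0: "z0 > 0" "\<And>z. z \<le> z0 \<Longrightarrow> w z \<le> \<epsilon>\<^sup>2 / 64" by blast
  \<comment> \<open>The two terms of the coupling bound become less than
    \<open>\<epsilon> / 2\<close> and at most \<open>\<epsilon> / 4\<close>.\<close>
  define \<delta> where "\<delta> = min z0 (\<epsilon> / 4)"
  have "\<delta> > 0" using z0 \<epsilon> by (simp add: \<delta>_def)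
  moreover have "\<exists>M. levy_process_from \<nu> x M (\<lambda>t \<omega>. fst \<omega> t) \<and> levy_process_from \<nu> y M (\<lambda>t \<omega>. snd \<omega> t) \<and>
     (\<exists>A\<in>sets M. {\<omega>\<in>space M. ereal \<epsilon> < coupling_time \<omega>} \<subseteq> A \<and> measure M A < \<epsilon>)" if y: "\<bar>y - x\<bar> < \<delta>" for y
  proof -
    have "w \<bar>y - x\<bar> \<le> \<epsilon>\<^sup>2 / 64" using y by (intro z0) (simp add: \<delta>_def)
    then have "16 * w \<bar>y - x\<bar> / \<epsilon> \<le> \<epsilon> / 4" using \<epsilon> by (simp add: field_simps power2_eq_square)
    then have lt: "2 * \<bar>y - x\<bar> + 16 * w \<bar>y - x\<bar> / \<epsilon> < \<epsilon>" using y \<epsilon> by (simp add: \<delta>_def)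
    from exists_coupling[OF \<epsilon>, of x y] obtain M A where "levy_process_from \<nu> x M (\<lambda>t \<omega>. fst \<omega> t)" "levy_process_from \<nu> y M (\<lambda>t \<omega>. snd \<omega> t)"
      "A \<in> sets M" "{\<omega>\<in>space M. ereal \<epsilon> < coupling_time \<omega>} \<subseteq> A" "measure M A \<le> 2 * \<bar>y - x\<bar> + 16 * w \<bar>y - x\<bar> / \<epsilon>"
      by (elim exE conjE bexE)
    then show ?thesis using lt by (intro exI[of _ M] conjI bexI[of _ A]) auto
  qed
  ultimately show "\<exists>\<delta>>0. \<forall>y. \<bar>y - x\<bar> < \<delta> \<longrightarrow> (\<exists>M. levy_process_from \<nu> x M (\<lambda>t \<omega>. fst \<omega> t) \<and> levy_process_from \<nu> y M (\<lambda>t \<omega>. snd \<omega> t) \<and>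
     (\<exists>A\<in>sets M. {\<omega>\<in>space M. ereal \<epsilon> < coupling_time \<omega>} \<subseteq> A \<and> measure M A < \<epsilon>))"
    by blast
qed

end

theorem theorem3p5:
  fixes \<nu> :: "real measure"
  assumes "levy_measure \<nu>"
  defines "\<rho> \<equiv> min_measure \<nu> (reflect_measure \<nu>)"
  defines "\<eta> \<equiv> (\<lambda>r::real. \<integral>\<^sup>+ x. ennreal (x\<^sup>2) * indicator {0<..r} x \<partial>\<rho>)"
  assumes "(\<integral>\<^sup>+ r. ennreal r / \<eta> r * indicator {0<..1} r \<partial>lborel) < \<infinity>"
  shows "local_coupling_property \<nu>"
proof -
  have "small_jump_condition \<nu>"
    using assms(1,4) by (intro small_jump_condition.intro) (simp_all only: \<rho>_def \<eta>_def)
  then show ?thesis by (rule small_jump_condition.local_coupling)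
qed
end
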